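(* Suppose that $n\geq 3$, $1<s_1<\frac n2$ and $s_1\leq s_2$. Then the operator $\widetilde{\mathbf L}_0:\mathcal D(\widetilde{\mathbf L}_0)\subseteq\mathcal H^{s_1,s_2}\to\mathcal H^{s_1,s_2}$ is closable, and its closure $(\mathbf L_0,\mathcal D(\mathbf L_0))$ generates a strongly continuous semigroup $(\mathbf S_0(\tau))_{\tau\geq 0}$ of bounded operators on $\mathcal H^{s_1,s_2}$. Furthermore, $$\|\mathbf S_0(\tau)\mathbf u\|_{\mathcal H^{s_1,s_2}}\leq e^{(\frac n2-2-s_1)\tau}\|\mathbf u\|_{\mathcal H^{s_1,s_2}}$$ for all $\mathbf u\in\mathcal H^{s_1,s_2}$ and $\tau\geq 0$.
   Context: $\langle u,v\rangle_{\dot H^s(\mathbb{R}^n)}=\langle|\cdot|^s\mathcal Fu,|\cdot|^s\mathcal Fv\rangle_{L^2(\mathbb{R}^n)}$ with $\mathcal F$ the (unitary) Fourier transform. For $0\le s_1\le s_2$, $\langle u,v\rangle_{\dot H^{s_1}\cap\dot H^{s_2}}=\langle u,v\rangle_{\dot H^{s_1}}+\langle u,v\rangle_{\dot H^{s_2}}$ if $s_1<s_2$, and $=\langle u,v\rangle_{\dot H^{s_1}}$ if $s_1=s_2$. $C^\infty_{c,r}(\mathbb{R}^n)$ denotes the radial functions in $C^\infty_c(\mathbb{R}^n)$. For $1\le s_1\le s_2$, $\mathcal H^{s_1,s_2}$ is the completion of $C^\infty_{c,r}(\mathbb{R}^n)\times C^\infty_{c,r}(\mathbb{R}^n)$ under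 the norm induced by $$\langle\mathbf u,\mathbf v\rangle_{\mathcal H^{s_1,s_2}}=\langle u_1,v_1\rangle_{\dot H^{s_1}\cap\dot H^{s_2}(\mathbb{R}^n)}+\langle u_2,v_2\rangle_{\dot H^{s_1-1}\cap\dot H^{s_2-1}(\mathbb{R}^n)}.$$ With $\Lambda f(x)=x^i\partial_if(x)$, the operator $\widetilde{\mathbf L}_0$ has domain $\mathcal D(\widetilde{\mathbf L}_0)=C^\infty_{c,r}(\mathbb{R}^n)\times C^\infty_{c,r}(\mathbb{R}^n)$ and acts by $$\widetilde{\mathbf L}_0\begin{pmatrix} u_1 \\ u_2 \end{pmatrix}=\begin{pmatrix}-\Lambda u_1-2u_1+u_2 \\ \Delta u_1-\Lambda u_2-3u_2\end{pmatrix}.$$ *)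

theory Defs
  imports "HOL-Analysis.Analysis"
begin

section \<open>Complex Hilbert spaces and one-parameter semigroups\<close>

text \<open>The underlying real norm and its completeness come from \<^class>\<open>banach\<close>.
  The inner product is linear in its first argument.\<close>

class complex_hilbert = banach +
  fixes scaleC :: "complex \<Rightarrow> 'a \<Rightarrow> 'a" (infixr \<open>*\<^sub>C\<close> 75)
    and cinner :: "'a \<Rightarrow> 'a \<Rightarrow> complex"
  assumes scaleC_add_right: "c *\<^sub>C (x + y) = c *\<^sub>C x + c *\<^sub>C y"
    and scaleC_add_left: "(c + d) *\<^sub>C x = c *\<^sub>C x + d *\<^sub>C x"
    and scaleC_scaleC: "c *\<^sub>C d *\<^sub>C x = (c * d) *\<^sub>C x"
    and scaleC_of_real: "of_real r *\<^sub>C x = r *\<^sub>R x"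
    and cinner_commute: "cinner x y = cnj (cinner y x)"
    and cinner_add_left: "cinner (x + y) z = cinner x z + cinner y z"
    and cinner_scaleC_left: "cinner (c *\<^sub>C x) y = c * cinner x y"
    and cinner_self: "cinner x x = of_real ((norm x)\<^sup>2)"

definition bounded_clinear :: "('h::complex_hilbert \<Rightarrow> 'h) \<Rightarrow> bool" where
  "bounded_clinear T \<longleftrightarrow> bounded_linear T \<and> (\<forall>c x. T (c *\<^sub>C x) = c *\<^sub>C T x)"

definition C0_semigroup :: "(real \<Rightarrow> 'h::complex_hilbert \<Rightarrow> 'h) \<Rightarrow> bool" where
  "C0_semigroup S \<longleftrightarrow>
     (\<forall>\<tau>\<ge>0. bounded_clinear (S \<tau>)) \<and>
     S 0 = id \<and>
     (\<forall>\<sigma>\<ge>0. \<forall>\<tau>\<ge>0. S (\<sigma> + \<tau>) = S \<sigma> \<circ> S \<tau>) \<and>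
     (\<forall>x. continuous_on {0..} (\<lambda>\<tau>. S \<tau> x))"

text \<open>An unbounded operator is represented by its graph, a subset of \<open>'h \<times> 'h\<close>; the graph of
  the closure of a closable operator is then the topological \<^const>\<open>closure\<close> of its graph.\<close>

definition closable :: "('h::complex_hilbert \<times> 'h) set \<Rightarrow> bool" where
  "closable A \<longleftrightarrow> single_valued (closure A)"

definition generator :: "(real \<Rightarrow> 'h::complex_hilbert \<Rightarrow> 'h) \<Rightarrow> ('h \<times> 'h) set" where
  "generator S = {(x, y). ((\<lambda>\<tau>. (S \<tau> x - x) /\<^sub>R \<tau>) \<longlongrightarrow> y) (at_right 0)}"


section \<open>Radial test functions and differential operators\<close>

definition partial :: "'n::finite \<Rightarrow> (real^'n \<Rightarrow> complex) \<Rightarrow> real^'n \<Rightarrow> complex" where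
  "partial i f x = frechet_derivative f (at x) (axis i 1)"

primrec C_k :: "nat \<Rightarrow> (real^'n::finite \<Rightarrow> complex) \<Rightarrow> bool" where
  "C_k 0 f \<longleftrightarrow> continuous_on UNIV f"
| "C_k (Suc k) f \<longleftrightarrow> (\<forall>x. f differentiable (at x)) \<and> (\<forall>i. C_k k (partial i f))"

definition test_functions :: "(real^'n::finite \<Rightarrow> complex) set" where
  "test_functions = {f. (\<forall>k. C_k k f) \<and> compact (closure {x. f x \<noteq> 0})}"

definition radial_test_functions :: "(real^'n::finite \<Rightarrow> complex) set" where
  "radial_test_functions = {f \<in> test_functions. \<forall>x y. norm x = norm y \<longrightarrow> f x = f y}"

definition Lam :: "(real^'n::finite \<Rightarrow> complex) \<Rightarrow> real^'n \<Rightarrow> complex" where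
  "Lam f x = (\<Sum>i\<in>UNIV. of_real (x $ i) * partial i f x)"

definition Laplacian :: "(real^'n::finite \<Rightarrow> complex) \<Rightarrow> real^'n \<Rightarrow> complex" where
  "Laplacian f x = (\<Sum>i\<in>UNIV. partial i (partial i f) x)"

type_synonym 'n fpair = "(real^'n \<Rightarrow> complex) \<times> (real^'n \<Rightarrow> complex)"

definition L0_domain :: "'n::finite fpair set" where
  "L0_domain = radial_test_functions \<times> radial_test_functions"

definition L0_tilde :: "'n::finite fpair \<Rightarrow> 'n fpair" where
  "L0_tilde = (\<lambda>(u1, u2).
     (\<lambda>x. - Lam u1 x - 2 * u1 x + u2 x,
      \<lambda>x. Laplacian u1 x - Lam u2 x - 3 * u2 x))"


section \<open>The spaces \<open>H^{s1,s2}\<close>\<close>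

definition fourier :: "(real^'n::finite \<Rightarrow> complex) \<Rightarrow> real^'n \<Rightarrow> complex" where
  "fourier f \<xi> = of_real ((2 * pi) powr (- real CARD('n) / 2)) *
     (LINT x|lborel. exp (- (\<i> * of_real (\<xi> \<bullet> x))) * f x)"

definition L2_inner :: "(real^'n::finite \<Rightarrow> complex) \<Rightarrow> (real^'n \<Rightarrow> complex) \<Rightarrow> complex" where
  "L2_inner f g = (LINT x|lborel. f x * cnj (g x))"

definition Hdot_inner ::
    "real \<Rightarrow> (real^'n::finite \<Rightarrow> complex) \<Rightarrow> (real^'n \<Rightarrow> complex) \<Rightarrow> complex" where
  "Hdot_inner s u v =
     L2_inner (\<lambda>\<xi>. of_real (norm \<xi> powr s) * fourier u \<xi>)
              (\<lambda>\<xi>. of_real (norm \<xi> powr s) * fourier v \<xi>)"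

text \<open>Only meant for \<open>0 \<le> s1 \<le> s2\<close>.\<close>

definition Hdot_cap_inner ::
    "real \<Rightarrow> real \<Rightarrow> (real^'n::finite \<Rightarrow> complex) \<Rightarrow> (real^'n \<Rightarrow> complex) \<Rightarrow> complex" where
  "Hdot_cap_inner s1 s2 u v =
     (if s1 < s2 then Hdot_inner s1 u v + Hdot_inner s2 u v else Hdot_inner s1 u v)"

definition H_inner :: "real \<Rightarrow> real \<Rightarrow> 'n::finite fpair \<Rightarrow> 'n fpair \<Rightarrow> complex" where
  "H_inner s1 s2 u v =
     Hdot_cap_inner s1 s2 (fst u) (fst v) + Hdot_cap_inner (s1 - 1) (s2 - 1) (snd u) (snd v)"

text \<open>The type \<open>'h\<close> together with \<open>\<iota>\<close> is a completion of the pre-Hilbert space of pairs of radial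
  test functions under \<^const>\<open>H_inner\<close>: \<open>\<iota>\<close> is a linear isometry with dense range into a complete
  space. This determines \<open>('h, \<iota>)\<close> up to a unique isometric isomorphism. The values of \<open>\<iota>\<close>
  outside \<^const>\<open>L0_domain\<close> are irrelevant.\<close>

definition H_completion ::
    "real \<Rightarrow> real \<Rightarrow> ('n::finite fpair \<Rightarrow> 'h::complex_hilbert) \<Rightarrow> bool" where
  "H_completion s1 s2 \<iota> \<longleftrightarrow>
     (\<forall>u\<in>L0_domain. \<forall>v\<in>L0_domain.
        \<iota> (\<lambda>x. fst u x + fst v x, \<lambda>x. snd u x + snd v x) = \<iota> u + \<iota> v) \<and>
     (\<forall>c. \<forall>u\<in>L0_domain. \<iota> (\<lambda>x. c * fst u x, \<lambda>x. c * snd u x) = c *\<^sub>C \<iota> u) \<and>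
     (\<forall>u\<in>L0_domain. \<forall>v\<in>L0_domain. cinner (\<iota> u) (\<iota> v) = H_inner s1 s2 u v) \<and>
     closure (\<iota> ` L0_domain) = UNIV"

text \<open>The graph of the operator with domain \<^const>\<open>L0_domain\<close>, viewed inside the completion.\<close>

definition L0_tilde_graph :: "('n::finite fpair \<Rightarrow> 'h::complex_hilbert) \<Rightarrow> ('h \<times> 'h) set" where
  "L0_tilde_graph \<iota> = {(\<iota> u, \<iota> (L0_tilde u)) | u. u \<in> L0_domain}"

end

theory Submission
  imports Defs
begin

text \<open>On the Fourier side, with \<open>r = |\<xi>|\<close>, the evolution is explicit: it is the composition of the wave
  propagator at time \<open>1 - exp (- \<tau>)\<close>, which is pointwise isometric for \<open>r\<^sup>2 |\<Phi>\<^sub>1|\<^sup>2 + |\<Phi>\<^sub>2|\<^sup>2\<close>, with a dilation,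
  whose norm in the weights \<open>r\<^sup>2\<^sup>(\<^sup>s\<^sup>-\<^sup>1\<^sup>)\<close>, \<open>s \<ge> s\<^sub>1\<close>, is at most \<open>exp ((n / 2 - 2 - s\<^sub>1) \<tau>)\<close>. What has to be shown is
  that this flow lives on the completion and that test functions form a core.

  Both follow once the flow of a test pair is approximated, in the graph norm, by test pairs. The wave
  multipliers \<open>cos (t r)\<close> and \<open>sin (t r) / r\<close> are limits of Chebyshev polynomials \<open>T\<^sub>k(c)\<close> and
  \<open>(t / k) U\<^bsub>k-1\<^esub>(c)\<close>, where \<open>c\<close> is the multiplier of averaging over balls of radius about \<open>1 / k\<close>; polynomials
  in averaging operators preserve radial test functions, and the classical bounds for Chebyshev polynomials
  and their derivatives on \<open>[-1, 1]\<close> allow dominated convergence, also after applying \<open>\<Lambda>\<close>. Neither Plancherel's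
  theorem nor finite speed of propagation is needed.

  Hence \<open>(S(\<tau>) u, S(\<tau>) L u)\<close> lies in the closed graph for test pairs \<open>u\<close>. Integrating, the closed graph contains
  \<open>(\<integral>\<^sub>0\<^sup>h S(\<tau>) x d\<tau>, S(h) x - x)\<close> for test pairs and then, by density, for all \<open>x\<close>; dividing by \<open>h\<close> and letting
  \<open>h\<close> tend to \<open>0\<close> identifies the generator with the closure.\<close>

section \<open>Test functions\<close>

text \<open>The recurrence T(k+1) = 2 c T(k) - T(k-1) is the leapfrog scheme for the wave equation,
  with a multiple of the ball average minus the identity in place of the Laplacian. If c = cos
  \<theta>, then k steps produce cos (k \<theta>) exactly; as 1 - c is of order r^2 / k^2, the angle
  k \<theta> can converge to t r. The graph norm is the real obstacle: \<Lambda> differentiates a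
  multiplier in log r, and the derivative of T(k) near 1 is as large as k^2. The average
  compensates, since its own logarithmic derivative is of order r^2 / k^2. Derivatives in frequency
  are all taken along the curve \<sigma> -> exp \<sigma> \<xi>, the one direction in which \<Lambda>
  acts, so that only functions of one real variable are differentiated. The completion is abstract,
  and its elements are handled through functions on the Fourier side. Such a function determines its
  element, but an element does not determine the function, so each operation has to be shown to
  respect this ambiguity.\<close>

definition smooth :: "(real^'n::finite \<Rightarrow> complex) \<Rightarrow> bool" where
  "smooth f \<longleftrightarrow> (\<forall>k. C_k k f)"

text \<open>A bound on the norm instead of compactness of the support: sums, dilations and averages
  change the radius in a controlled way.\<close>

definition csupp :: "(real^'n::finite \<Rightarrow> complex) \<Rightarrow> bool" where
  "csupp f \<longleftrightarrow> (\<exists>R. \<forall>x. R < norm x \<longrightarrow> f x = 0)"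

definition radial :: "(real^'n::finite \<Rightarrow> complex) \<Rightarrow> bool" where
  "radial f \<longleftrightarrow> (\<forall>x y. norm x = norm y \<longrightarrow> f x = f y)"

lemma csupp_iff: "csupp f \<longleftrightarrow> compact (closure {x. f x \<noteq> 0})"
proof -
  have "csupp f \<longleftrightarrow> bounded {x. f x \<noteq> 0}"
    unfolding csupp_def bounded_iff by (intro ex_cong1) (auto simp: linorder_not_less[symmetric])
  then show ?thesis by simp
qed

lemma test_functions_iff: "f \<in> test_functions \<longleftrightarrow> smooth f \<and> csupp f"
  by (simp add: test_functions_def smooth_def csupp_iff)

lemma radial_test_functions_iff: "f \<in> radial_test_functions \<longleftrightarrow> smooth f \<and> csupp f \<and> radial f"
  by (simp add: radial_test_functions_def test_functions_iff radial_def)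

lemma C_k_SucD: "C_k (Suc k) f \<Longrightarrow> C_k k f"
proof (induction k arbitrary: f)
  case 0
  then show ?case
    by (auto intro!: differentiable_imp_continuous_on simp: differentiable_on_def differentiable_at_withinI)
qed auto

lemma smooth_iff: "smooth f \<longleftrightarrow> (\<forall>x. f differentiable (at x)) \<and> (\<forall>i. smooth (partial i f))"
proof
  assume "smooth f"
  then have "C_k (Suc k) f" for k unfolding smooth_def by blast
  then show "(\<forall>x. f differentiable (at x)) \<and> (\<forall>i. smooth (partial i f))"
    by (auto simp: smooth_def)
next
  assume *: "(\<forall>x. f differentiable (at x)) \<and> (\<forall>i. smooth (partial i f))"
  then have "C_k (Suc k) f" for k by (auto simp: smooth_def)
  then show "smooth f" using C_k_SucD unfolding smooth_def by blast
qed

lemma smooth_differentiable: "smooth f \<Longrightarrow> f differentiable (at x)"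
  using smooth_iff by blast

lemma smooth_partial: "smooth f \<Longrightarrow> smooth (partial i f)"
  using smooth_iff by blast

lemma smooth_continuous: "smooth f \<Longrightarrow> continuous_on S f"
  unfolding smooth_def by (metis C_k.simps(1) continuous_on_subset subset_UNIV)

lemma smooth_measurable: "smooth f \<Longrightarrow> f \<in> borel_measurable borel"
  by (intro borel_measurable_continuous_onI smooth_continuous)

section \<open>Partial derivatives and the algebra of smooth functions\<close>

lemma partial_eq:
  assumes "(f has_derivative f') (at x)"
  shows "partial i f x = f' (axis i 1)"
  using frechet_derivative_at[OF assms] by (simp add: partial_def)

lemma linear_axis_expansion:
  fixes g :: "real^'n::finite \<Rightarrow> complex"
  assumes "linear g"
  shows "g h = (\<Sum>i\<in>UNIV. of_real (h $ i) * g (axis i 1))"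
proof -
  have "g h = g (\<Sum>i\<in>UNIV. h $ i *\<^sub>R axis i 1)"
    by (simp add: basis_expansion scalar_mult_eq_scaleR[symmetric])
  also have "\<dots> = (\<Sum>i\<in>UNIV. h $ i *\<^sub>R g (axis i 1))"
    by (simp add: linear_sum[OF assms] linear_scale[OF assms] o_def)
  finally show ?thesis by (simp add: scaleR_conv_of_real)
qed

lemma sum_axis: "(\<Sum>l\<in>UNIV. of_real (axis k 1 $ l) * g l) = (g k :: complex)"
proof -
  have "of_real (axis k 1 $ l) * g l = (if l = k then g l else 0)" for l
    by (simp add: axis_def)
  then show ?thesis by simp
qed

lemma has_derivative_partials:
  assumes "f differentiable (at x)"
  shows "(f has_derivative (\<lambda>h. \<Sum>i\<in>UNIV. of_real (h $ i) * partial i f x)) (at x)"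
proof -
  have d: "(f has_derivative frechet_derivative f (at x)) (at x)"
    using assms frechet_derivative_works by blast
  have "frechet_derivative f (at x) = (\<lambda>h. \<Sum>i\<in>UNIV. of_real (h $ i) * partial i f x)"
    unfolding partial_def by (intro ext linear_axis_expansion has_derivative_linear[OF d])
  then show ?thesis using d by simp
qed

lemma partial_add:
  assumes "f differentiable (at x)" "g differentiable (at x)"
  shows "partial i (\<lambda>x. f x + g x) x = partial i f x + partial i g x"
  using partial_eq[OF has_derivative_add[OF has_derivative_partials[OF assms(1)] has_derivative_partials[OF assms(2)]], of i]
    partial_eq[OF has_derivative_partials[OF assms(1)], of i] partial_eq[OF has_derivative_partials[OF assms(2)], of i]
  by simp

lemma partial_mult:
  assumes "f differentiable (at x)" "g differentiable (at x)"
  shows "partial i (\<lambda>x. f x * g x) x = f x * partial i g x + partial i f x * g x"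
  using partial_eq[OF has_derivative_mult[OF has_derivative_partials[OF assms(1)] has_derivative_partials[OF assms(2)]], of i]
    partial_eq[OF has_derivative_partials[OF assms(1)], of i] partial_eq[OF has_derivative_partials[OF assms(2)], of i]
  by simp

lemma partial_const [simp]: "partial i (\<lambda>x. c) = (\<lambda>x. 0)"
  by (rule ext, subst partial_eq[OF has_derivative_const]) simp

lemma partial_coord: "partial i (\<lambda>x. of_real (x $ j)) = (\<lambda>x. if i = j then 1 else 0)"
proof
  fix x :: "real^'a"
  have "((\<lambda>x::real^'a. complex_of_real (x $ j)) has_derivative (\<lambda>h. of_real (h $ j))) (at x)"
    by (intro bounded_linear.has_derivative[OF bounded_linear_of_real] bounded_linear.has_derivative[OF bounded_linear_vec_nth] has_derivative_ident)
  from partial_eq[OF this, of i] show "partial i (\<lambda>x. complex_of_real (x $ j)) x = (if i = j then 1 else 0)"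
    by (auto simp: axis_def)
qed

lemma has_derivative_scale_arg:
  fixes f :: "real^'n::finite \<Rightarrow> complex"
  assumes "f differentiable (at (a *\<^sub>R x))"
  shows "((\<lambda>x. f (a *\<^sub>R x)) has_derivative
           (\<lambda>h. \<Sum>i\<in>UNIV. of_real (h $ i) * (of_real a * partial i f (a *\<^sub>R x)))) (at x)"
proof -
  have "((\<lambda>x. f (a *\<^sub>R x)) has_derivative
           (\<lambda>h. \<Sum>i\<in>UNIV. of_real ((a *\<^sub>R h) $ i) * partial i f (a *\<^sub>R x))) (at x)"
    by (rule has_derivative_compose[of "\<lambda>x. a *\<^sub>R x" _ _ _ f, OF _ has_derivative_partials[OF assms]])
       (auto intro!: derivative_eq_intros)
  then show ?thesis by (simp add: algebra_simps)
qed

lemma partial_scale_arg: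
  assumes "\<And>x. f differentiable (at x)"
  shows "partial i (\<lambda>x. f (a *\<^sub>R x)) = (\<lambda>x. of_real a * partial i f (a *\<^sub>R x))"
  by (rule ext, subst partial_eq[OF has_derivative_scale_arg[OF assms]])
     (rule sum_axis)

lemma C_k_const: "C_k k (\<lambda>x. c)"
  by (induction k arbitrary: c) auto

lemma C_k_add: "C_k k f \<Longrightarrow> C_k k g \<Longrightarrow> C_k k (\<lambda>x. f x + g x)"
proof (induction k arbitrary: f g)
  case (Suc k)
  have "partial i (\<lambda>x. f x + g x) = (\<lambda>x. partial i f x + partial i g x)" for i
    using Suc.prems by (auto intro!: ext partial_add)
  with Suc show ?case by (auto intro: differentiable_add)
qed (auto intro: continuous_on_add)

lemma C_k_mult: "C_k k f \<Longrightarrow> C_k k g \<Longrightarrow> C_k k (\<lambda>x. f x * g x)"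
proof (induction k arbitrary: f g)
  case (Suc k)
  have "partial i (\<lambda>x. f x * g x) = (\<lambda>x. f x * partial i g x + partial i f x * g x)" for i
    using Suc.prems by (auto intro!: ext partial_mult)
  moreover have "C_k k f" "C_k k g" using Suc.prems C_k_SucD by blast+
  ultimately show ?case using Suc by (auto intro!: differentiable_mult C_k_add)
qed (auto intro: continuous_on_mult)

lemma C_k_scale_arg: "C_k k f \<Longrightarrow> C_k k (\<lambda>x. f (a *\<^sub>R x))"
proof (induction k arbitrary: f)
  case 0
  then show ?case
    by (auto intro!: continuous_on_compose2[of UNIV f] continuous_intros)
next
  case (Suc k)
  have "partial i (\<lambda>x. f (a *\<^sub>R x)) = (\<lambda>x. of_real a * partial i f (a *\<^sub>R x))" for i
    using Suc.prems by (auto intro!: partial_scale_arg)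
  moreover have "(\<lambda>x. f (a *\<^sub>R x)) differentiable (at x)" for x
    by (rule differentiableI[OF has_derivative_scale_arg]) (use Suc.prems in auto)
  ultimately show ?case using Suc by (auto intro!: C_k_mult C_k_const)
qed

lemma smooth_const: "smooth (\<lambda>x. c)" by (simp add: smooth_def C_k_const)
lemma smooth_add: "smooth f \<Longrightarrow> smooth g \<Longrightarrow> smooth (\<lambda>x. f x + g x)" by (simp add: smooth_def C_k_add)
lemma smooth_mult: "smooth f \<Longrightarrow> smooth g \<Longrightarrow> smooth (\<lambda>x. f x * g x)" by (simp add: smooth_def C_k_mult)
lemma smooth_scale_arg: "smooth f \<Longrightarrow> smooth (\<lambda>x. f (a *\<^sub>R x))" by (simp add: smooth_def C_k_scale_arg)

lemma smooth_sum: "finite I \<Longrightarrow> (\<And>i. i \<in> I \<Longrightarrow> smooth (f i)) \<Longrightarrow> smooth (\<lambda>x. \<Sum>i\<in>I. f i x)"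
  by (induction I rule: finite_induct) (auto intro: smooth_const smooth_add)

lemma smooth_coord: "smooth (\<lambda>x. of_real (x $ j))"
proof -
  have "(\<lambda>x. complex_of_real (x $ j)) differentiable (at x)" for x :: "real^'a"
    by (intro differentiableI[of _ "\<lambda>h. of_real (h $ j)"] bounded_linear.has_derivative[OF bounded_linear_of_real]
          bounded_linear.has_derivative[OF bounded_linear_vec_nth] has_derivative_ident)
  then show ?thesis by (subst smooth_iff) (auto simp: partial_coord intro: smooth_const)
qed

lemma csupp_add: "csupp f \<Longrightarrow> csupp g \<Longrightarrow> csupp (\<lambda>x. f x + g x)"
proof -
  assume "csupp f" "csupp g"
  then obtain R R' where "\<forall>x. R < norm x \<longrightarrow> f x = 0" "\<forall>x. R' < norm x \<longrightarrow> g x = 0"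
    by (auto simp: csupp_def)
  then show ?thesis unfolding csupp_def by (intro exI[of _ "max R R'"]) auto
qed

lemma csupp_zero: "csupp (\<lambda>x. 0)" by (simp add: csupp_def)

lemma csupp_mult: "csupp g \<Longrightarrow> csupp (\<lambda>x. f x * g x)"
  unfolding csupp_def by auto

lemma csupp_sum: "finite I \<Longrightarrow> (\<And>i. i \<in> I \<Longrightarrow> csupp (f i)) \<Longrightarrow> csupp (\<lambda>x. \<Sum>i\<in>I. f i x)"
  by (induction I rule: finite_induct) (auto intro!: csupp_add csupp_zero)

lemma csupp_scale_arg: "a \<noteq> 0 \<Longrightarrow> csupp f \<Longrightarrow> csupp (\<lambda>x. f (a *\<^sub>R x))"
proof -
  assume a: "a \<noteq> 0" and "csupp f"
  then obtain R where R: "\<forall>x. R < norm x \<longrightarrow> f x = 0" by (auto simp: csupp_def)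
  have "f (a *\<^sub>R x) = 0" if "R / \<bar>a\<bar> < norm x" for x
    using that R a by (auto simp: field_simps)
  then show ?thesis unfolding csupp_def by blast
qed

lemma csupp_partial: "csupp f \<Longrightarrow> csupp (partial i f)"
proof -
  assume "csupp f"
  then obtain R where R: "\<forall>x. R < norm x \<longrightarrow> f x = 0" by (auto simp: csupp_def)
  have "partial i f x = 0" if "R < norm x" for x
  proof -
    have o: "open {y::real^'a. R < norm y}" by (intro open_Collect_less continuous_intros)
    have "(f has_derivative (\<lambda>h. 0)) (at x)"
      by (rule has_derivative_transform_within_open[OF has_derivative_const o]) (use that R in auto)
    from partial_eq[OF this] show ?thesis by simp
  qed
  then show ?thesis unfolding csupp_def by blast
qed

section \<open>The operators \<Lambda> and \<Delta> on radial test functions\<close>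

lemma Lam_smooth: "smooth f \<Longrightarrow> smooth (Lam f)"
  unfolding Lam_def by (intro smooth_sum smooth_mult smooth_coord smooth_partial) auto

lemma Lam_csupp: "csupp f \<Longrightarrow> csupp (Lam f)"
  unfolding Lam_def by (intro csupp_sum csupp_mult csupp_partial) auto

lemma Laplacian_smooth: "smooth f \<Longrightarrow> smooth (Laplacian f)"
  unfolding Laplacian_def by (intro smooth_sum smooth_partial) auto

lemma Laplacian_csupp: "csupp f \<Longrightarrow> csupp (Laplacian f)"
  unfolding Laplacian_def by (intro csupp_sum csupp_partial) auto

lemma has_vector_derivative_ray:
  assumes "smooth f"
  shows "((\<lambda>s. f (s *\<^sub>R x)) has_vector_derivative (\<Sum>i\<in>UNIV. of_real (x $ i) * partial i f (s *\<^sub>R x))) (at s)"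
proof -
  have "((\<lambda>s. f (s *\<^sub>R x)) has_derivative
           (\<lambda>h. \<Sum>i\<in>UNIV. of_real ((h *\<^sub>R x) $ i) * partial i f (s *\<^sub>R x))) (at s)"
    by (rule has_derivative_compose[OF _ has_derivative_partials[OF smooth_differentiable[OF assms]]])
       (auto intro!: derivative_eq_intros)
  then show ?thesis
    unfolding has_vector_derivative_def
    by (rule has_derivative_eq_rhs) (simp add: scaleR_conv_of_real[where 'a=complex] sum_distrib_left mult.assoc)
qed

text \<open>Written as a derivative along the ray through \<open>x\<close>, \<Lambda> sees only the
  values of \<open>f\<close> on that ray, so radial symmetry passes to it.\<close>

lemma Lam_ray:
  assumes "smooth f"
  shows "((\<lambda>s. f (s *\<^sub>R x)) has_vector_derivative Lam f x) (at 1)"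
  using has_vector_derivative_ray[OF assms, of x 1] by (simp add: Lam_def)

lemma radial_Lam:
  assumes "smooth f" "radial f"
  shows "radial (Lam f)"
  unfolding radial_def
proof (intro allI impI)
  fix x y :: "real^'a" assume "norm x = norm y"
  then have "(\<lambda>s. f (s *\<^sub>R x)) = (\<lambda>s. f (s *\<^sub>R y))"
    using assms(2) by (auto simp: radial_def)
  then show "Lam f x = Lam f y"
    using Lam_ray[OF assms(1), of x] Lam_ray[OF assms(1), of y] vector_derivative_unique_at by metis
qed

text \<open>Chain rule twice for the invariant function; the double sum over second derivatives
  collapses to its diagonal because \<open>R\<close> is orthogonal.\<close>

lemma Laplacian_orthogonal:
  fixes f :: "real^'n::finite \<Rightarrow> complex"
  assumes f: "smooth f" and R: "orthogonal_transformation R" and inv: "\<And>x. f (R x) = f x"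
  shows "Laplacian f (R x) = Laplacian f x"
proof -
  define r where "r i = R (axis i 1)" for i
  have lin: "linear R" using R orthogonal_transformation_linear by blast
  have comp: "partial i (\<lambda>x. g (R x)) x = (\<Sum>j\<in>UNIV. of_real (r i $ j) * partial j g (R x))"
    if g: "smooth g" for g :: "real^'n \<Rightarrow> complex" and i x
  proof -
    have "((\<lambda>x. g (R x)) has_derivative
           (\<lambda>h. \<Sum>j\<in>UNIV. of_real (R h $ j) * partial j g (R x))) (at x)"
      by (rule has_derivative_compose[OF _ has_derivative_partials[OF smooth_differentiable[OF g]]])
         (rule linear_imp_has_derivative[OF lin])
    from partial_eq[OF this] show ?thesis by (simp add: r_def)
  qed
  \<comment> \<open>The vectors \<open>r i\<close> are the columns of the matrix; summing over
    \<open>i\<close> at fixed coordinates \<open>j\<close>, \<open>k\<close> gives an entry of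
    \<open>matrix R ** transpose (matrix R)\<close>.\<close>
  have orth: "(\<Sum>i\<in>UNIV. r i $ j * r i $ k) = (if j = k then 1 else 0)" for j k
  proof -
    have "orthogonal_matrix (matrix R)" using R orthogonal_transformation_matrix by blast
    then have "(matrix R ** transpose (matrix R)) $ j $ k = mat 1 $ j $ k"
      by (simp add: orthogonal_matrix_def)
    then show ?thesis
      by (simp add: matrix_matrix_mult_def transpose_def mat_def matrix_def r_def)
  qed
  have p1: "partial i f = (\<lambda>x. \<Sum>j\<in>UNIV. of_real (r i $ j) * partial j f (R x))" for i
    using comp[OF f, of i] inv by (auto simp: fun_eq_iff)
  have sm: "smooth (\<lambda>x. \<Sum>j\<in>UNIV. of_real (r i $ j) * partial j f x)" for i
    by (intro smooth_sum smooth_mult smooth_const smooth_partial f) auto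
  have p2: "partial k (\<lambda>x. \<Sum>j\<in>UNIV. of_real (r i $ j) * partial j f x) x
      = (\<Sum>j\<in>UNIV. of_real (r i $ j) * partial k (partial j f) x)" for i k x
  proof -
    have "((\<lambda>x. \<Sum>j\<in>UNIV. of_real (r i $ j) * partial j f x) has_derivative
       (\<lambda>h. \<Sum>j\<in>UNIV. of_real (r i $ j) * (\<Sum>l\<in>UNIV. of_real (h $ l) * partial l (partial j f) x))) (at x)"
      by (intro has_derivative_sum has_derivative_mult_right has_derivative_partials smooth_differentiable smooth_partial f)
    moreover have "(\<Sum>l\<in>UNIV. of_real (axis k 1 $ l) * partial l (partial j f) x) = partial k (partial j f) x" for j
      by (rule sum_axis)
    ultimately show ?thesis using partial_eq by fastforce
  qed
  have "partial i (partial i f) x =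
     (\<Sum>k\<in>UNIV. \<Sum>j\<in>UNIV. of_real (r i $ k * r i $ j) * partial k (partial j f) (R x))" for i x
    by (subst p1, subst comp[OF sm], subst p2) (simp add: sum_distrib_left mult.assoc)
  then have "Laplacian f x = (\<Sum>i\<in>UNIV. \<Sum>k\<in>UNIV. \<Sum>j\<in>UNIV. of_real (r i $ k * r i $ j) * partial k (partial j f) (R x))"
    by (simp add: Laplacian_def)
  also have "\<dots> = (\<Sum>k\<in>UNIV. \<Sum>j\<in>UNIV. \<Sum>i\<in>UNIV. of_real (r i $ k * r i $ j) * partial k (partial j f) (R x))"
    by (subst sum.swap, rule sum.cong[OF refl], rule sum.swap)
  also have "\<dots> = (\<Sum>k\<in>UNIV. \<Sum>j\<in>UNIV. of_real (if k = j then 1 else 0) * partial k (partial j f) (R x))"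
    by (simp only: orth[symmetric] of_real_sum sum_distrib_right)
  also have "\<dots> = Laplacian f (R x)"
    by (simp add: Laplacian_def if_distrib[of of_real] if_distrib[of "\<lambda>c. c * _"] cong: if_cong)
  finally show ?thesis by simp
qed

text \<open>Some orthogonal transformation takes one of two points of equal norm to the other, and
  it leaves a radial \<open>f\<close> unchanged.\<close>

lemma radial_Laplacian:
  assumes "smooth f" "radial f"
  shows "radial (Laplacian f)"
  unfolding radial_def
proof (intro allI impI)
  fix x y :: "real^'a" assume "norm x = norm y"
  then obtain R where R: "orthogonal_transformation R" "R x = y"
    using orthogonal_transformation_exists by blast
  have "f (R z) = f z" for z
    using assms(2) R(1) by (metis radial_def orthogonal_transformation_norm)
  from Laplacian_orthogonal[OF assms(1) R(1) this, of x] R(2) show "Laplacian f x = Laplacian f y" by simp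
qed

lemma radial_add: "radial f \<Longrightarrow> radial g \<Longrightarrow> radial (\<lambda>x. f x + g x)"
  unfolding radial_def by metis
lemma radial_cmult: "radial f \<Longrightarrow> radial (\<lambda>x. c * f x)"
  unfolding radial_def by metis
lemma radial_scale_arg: "radial f \<Longrightarrow> radial (\<lambda>x. f (a *\<^sub>R x))"
  unfolding radial_def by (metis norm_scaleR)

lemma rt_add: "f \<in> radial_test_functions \<Longrightarrow> g \<in> radial_test_functions \<Longrightarrow> (\<lambda>x. f x + g x) \<in> radial_test_functions"
  by (simp add: radial_test_functions_iff smooth_add csupp_add radial_add)
lemma rt_cmult: "f \<in> radial_test_functions \<Longrightarrow> (\<lambda>x. c * f x) \<in> radial_test_functions"
  by (simp add: radial_test_functions_iff smooth_mult smooth_const csupp_mult radial_cmult)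
lemma rt_Lam: "f \<in> radial_test_functions \<Longrightarrow> Lam f \<in> radial_test_functions"
  by (simp add: radial_test_functions_iff Lam_smooth Lam_csupp radial_Lam)
lemma rt_Laplacian: "f \<in> radial_test_functions \<Longrightarrow> Laplacian f \<in> radial_test_functions"
  by (simp add: radial_test_functions_iff Laplacian_smooth Laplacian_csupp radial_Laplacian)
lemma rt_scale_arg: "a \<noteq> 0 \<Longrightarrow> f \<in> radial_test_functions \<Longrightarrow> (\<lambda>x. f (a *\<^sub>R x)) \<in> radial_test_functions"
  by (simp add: radial_test_functions_iff smooth_scale_arg csupp_scale_arg radial_scale_arg)

lemma L0_tilde_domain:
  assumes "u \<in> L0_domain"
  shows "L0_tilde u \<in> L0_domain"
proof -
  obtain u1 u2 where u: "u = (u1, u2)" "u1 \<in> radial_test_functions" "u2 \<in> radial_test_functions"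
    using assms by (auto simp: L0_domain_def)
  have "(\<lambda>x. ((-1) * Lam u1 x + (-2) * u1 x) + u2 x) \<in> radial_test_functions"
       "(\<lambda>x. (Laplacian u1 x + (-1) * Lam u2 x) + (-3) * u2 x) \<in> radial_test_functions"
    using u by (intro rt_add rt_cmult rt_Lam rt_Laplacian; simp)+
  then show ?thesis by (simp add: L0_domain_def L0_tilde_def u)
qed

section \<open>Integration lemmas\<close>

lemma nn_integral_lborel_translation:
  fixes f :: "'a::euclidean_space \<Rightarrow> ennreal"
  assumes "f \<in> borel_measurable borel"
  shows "(\<integral>\<^sup>+x. f (x + c) \<partial>lborel) = (\<integral>\<^sup>+x. f x \<partial>lborel)"
proof -
  have "(\<integral>\<^sup>+x. f x \<partial>lborel) = (\<integral>\<^sup>+x. f x \<partial>distr lborel borel ((+) c))" by (simp add: lborel_distr_plus)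
  also have "\<dots> = (\<integral>\<^sup>+x. f (c + x) \<partial>lborel)" by (rule nn_integral_distr) (use assms in auto)
  finally show ?thesis by (simp add: add.commute)
qed

lemma integral_lborel_translation:
  fixes f :: "'a::euclidean_space \<Rightarrow> 'b::{banach, second_countable_topology}"
  assumes "f \<in> borel_measurable borel"
  shows "(LINT x|lborel. f (x + c)) = (LINT x|lborel. f x)"
proof -
  have "(LINT x|lborel. f x) = (LINT x|distr lborel borel ((+) c). f x)" by (simp add: lborel_distr_plus)
  also have "\<dots> = (LINT x|lborel. f (c + x))" by (rule integral_distr) (use assms in auto)
  finally show ?thesis by (simp add: add.commute)
qed

lemma integral_lborel_scaleR:
  fixes f :: "'a::euclidean_space \<Rightarrow> 'b::{banach, second_countable_topology}"
  assumes "f \<in> borel_measurable borel" "0 < c"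
  shows "(LINT x|lborel. f (c *\<^sub>R x)) = (LINT x|lborel. f x) /\<^sub>R c ^ DIM('a)"
proof -
  have "(LINT x|lborel. f x) = (LINT x|density (distr lborel borel (\<lambda>x. 0 + c *\<^sub>R x)) (\<lambda>_. \<bar>c\<bar> ^ DIM('a)). f x)"
    using lborel_affine[of c "0::'a"] assms by simp
  also have "\<dots> = (LINT x|distr lborel borel (\<lambda>x. c *\<^sub>R x). c ^ DIM('a) *\<^sub>R f x)"
    using assms by (subst integral_density) auto
  also have "\<dots> = (LINT x|lborel. c ^ DIM('a) *\<^sub>R f (c *\<^sub>R x))"
    using assms by (subst integral_distr) auto
  finally show ?thesis using assms by simp
qed

text \<open>The uniqueness argument for Haar measure, comparing Lebesgue measure and its rotation by
  evaluating \<open>\<integral>\<integral> 1\<^sub>B(y) 1\<^sub>A(R x + y)\<close> in both orders; the library's change of variables for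
  linear maps needs a well-ordered index type.\<close>

lemma lborel_distr_orthogonal:
  fixes R :: "'a::euclidean_space \<Rightarrow> 'a"
  assumes R: "orthogonal_transformation R"
  shows "distr lborel borel R = lborel"
proof (rule measure_eqI)
  fix A assume "A \<in> sets (distr lborel borel R)"
  then have A[measurable]: "A \<in> sets borel" by simp
  have lin: "linear R" using R orthogonal_transformation_linear by blast
  have Rm[measurable]: "R \<in> borel_measurable borel"
    using lin by (intro borel_measurable_continuous_onI linear_continuous_on linear_conv_bounded_linear[THEN iffD1])
  obtain Q where Q: "orthogonal_transformation Q" "\<And>x. R (Q x) = x"
    using R by (metis orthogonal_transformation_inv orthogonal_transformation_surj surj_f_inv_f)
  define B where "B = ball (0::'a) 1"
  have B[measurable]: "B \<in> sets borel" by (simp add: B_def)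
  define K where "K = (\<integral>\<^sup>+x. indicator A (R x) \<partial>lborel)"
  have "(\<integral>\<^sup>+y. \<integral>\<^sup>+x. indicator B y * indicator A (R x + y) \<partial>lborel \<partial>lborel)
      = (\<integral>\<^sup>+y. indicator B y * K \<partial>lborel)"
  proof (rule nn_integral_cong)
    fix y :: 'a
    have "R x + y = R (x + Q y)" for x using Q lin by (simp add: linear_add)
    then have "(\<integral>\<^sup>+x. indicator A (R x + y) \<partial>lborel) = K"
      unfolding K_def by (simp add: nn_integral_lborel_translation[of "\<lambda>x. indicator A (R x)"])
    then show "(\<integral>\<^sup>+x. indicator B y * indicator A (R x + y) \<partial>lborel) = indicator B y * K"
      by (subst nn_integral_cmult) auto
  qed
  then have I1: "(\<integral>\<^sup>+y. \<integral>\<^sup>+x. indicator B y * indicator A (R x + y) \<partial>lborel \<partial>lborel) = emeasure lborel B * K"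
    by (simp add: nn_integral_multc)
  have "(\<integral>\<^sup>+y. \<integral>\<^sup>+x. indicator B y * indicator A (R x + y) \<partial>lborel \<partial>lborel)
      = (\<integral>\<^sup>+x. \<integral>\<^sup>+y. indicator B y * indicator A (R x + y) \<partial>lborel \<partial>lborel)"
    by (rule lborel_pair.Fubini') measurable
  also have "\<dots> = (\<integral>\<^sup>+x. \<integral>\<^sup>+y. indicator B (y - R x) * indicator A y \<partial>lborel \<partial>lborel)"
  proof (rule nn_integral_cong)
    fix x :: 'a
    show "(\<integral>\<^sup>+y. indicator B y * indicator A (R x + y) \<partial>lborel) = (\<integral>\<^sup>+y. indicator B (y - R x) * indicator A y \<partial>lborel)"
      using nn_integral_lborel_translation[of "\<lambda>y. indicator B (y - R x) * indicator A y" "R x"] by (simp add: add.commute)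
  qed
  also have "\<dots> = (\<integral>\<^sup>+y. \<integral>\<^sup>+x. indicator B (y - R x) * indicator A y \<partial>lborel \<partial>lborel)"
    by (rule lborel_pair.Fubini') measurable
  also have "\<dots> = (\<integral>\<^sup>+y. emeasure lborel B * indicator A y \<partial>lborel)"
  proof (rule nn_integral_cong)
    fix y :: 'a
    have "norm (y - R x) = norm (x - Q y)" for x
    proof -
      have "y - R x = R (Q y - x)" using Q by (simp add: linear_diff[OF lin])
      then show ?thesis using orthogonal_transformation_norm[OF R, of "Q y - x"] by (simp add: norm_minus_commute)
    qed
    then have "indicator B (y - R x) = (indicator B (x + - Q y) :: ennreal)" for x
      by (simp add: B_def indicator_def)
    then have "(\<integral>\<^sup>+x. indicator B (y - R x) \<partial>lborel) = emeasure lborel B"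
      using nn_integral_lborel_translation[of "\<lambda>x. indicator B x" "- Q y"] by (simp only:) simp
    then show "(\<integral>\<^sup>+x. indicator B (y - R x) * indicator A y \<partial>lborel) = emeasure lborel B * indicator A y"
      by (subst nn_integral_multc) auto
  qed
  also have "\<dots> = emeasure lborel B * emeasure lborel A"
    by (subst nn_integral_cmult) auto
  finally have "emeasure lborel B * K = emeasure lborel B * emeasure lborel A" using I1 by simp
  moreover have "emeasure lborel B \<noteq> 0" "emeasure lborel B \<noteq> \<infinity>"
    using content_ball_pos[of 1 "0::'a"] by (auto simp: B_def measure_def)
  ultimately have "K = emeasure lborel A" by (simp add: ennreal_mult_cancel_left)
  moreover have "K = emeasure (distr lborel borel R) A"
  proof -
    have "K = (\<integral>\<^sup>+x. indicator A x \<partial>distr lborel borel R)" unfolding K_def by (subst nn_integral_distr) auto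
    then show ?thesis by simp
  qed
  ultimately show "emeasure (distr lborel borel R) A = emeasure lborel A" by simp
qed simp

text \<open>A majorant for the derivative on a convex neighbourhood is enough: the mean value
  inequality transfers it to the difference quotients.\<close>

lemma has_derivative_integral_dominated:
  fixes f :: "'a::{real_normed_vector, perfect_space} \<Rightarrow> 'b \<Rightarrow> 'c::{banach, second_countable_topology}"
  assumes U: "open U" "convex U" "x0 \<in> U"
    and int: "\<And>x. x \<in> U \<Longrightarrow> integrable M (f x)"
    and meas: "\<And>h. (\<lambda>y. f' x0 y h) \<in> borel_measurable M"
    and der: "\<And>x y. y \<in> space M \<Longrightarrow> x \<in> U \<Longrightarrow> ((\<lambda>x. f x y) has_derivative f' x y) (at x)"
    and dom: "\<And>x y h. y \<in> space M \<Longrightarrow> x \<in> U \<Longrightarrow> norm (f' x y h) \<le> b y * norm h"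
    and b: "integrable M b"
  shows "((\<lambda>x. LINT y|M. f x y) has_derivative (\<lambda>h. LINT y|M. f' x0 y h)) (at x0)"
proof -
  have lin: "bounded_linear (f' x0 y)" if "y \<in> space M" for y
    using has_derivative_bounded_linear[OF der[OF that U(3)]] .
  have int': "integrable M (\<lambda>y. f' x0 y h)" for h
  proof (rule Bochner_Integration.integrable_bound)
    show "integrable M (\<lambda>y. b y * norm h)" using b by simp
    show "AE y in M. norm (f' x0 y h) \<le> norm (b y * norm h)" by (intro AE_I2) (auto intro: order_trans[OF dom[OF _ U(3)] abs_ge_self])
  qed (rule meas)
  have bl: "bounded_linear (\<lambda>h. LINT y|M. f' x0 y h)"
  proof (rule bounded_linear_intro)
    fix h k :: 'a and r :: real
    have "(LINT y|M. f' x0 y (h + k)) = (LINT y|M. f' x0 y h + f' x0 y k)"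
      by (rule Bochner_Integration.integral_cong) (use lin linear_add bounded_linear.linear in blast)+
    then show "(LINT y|M. f' x0 y (h + k)) = (LINT y|M. f' x0 y h) + (LINT y|M. f' x0 y k)"
      using int' by simp
    have "(LINT y|M. f' x0 y (r *\<^sub>R h)) = (LINT y|M. r *\<^sub>R f' x0 y h)"
      by (rule Bochner_Integration.integral_cong) (use lin linear_scale bounded_linear.linear in blast)+
    then show "(LINT y|M. f' x0 y (r *\<^sub>R h)) = r *\<^sub>R (LINT y|M. f' x0 y h)" by simp
    have "norm (LINT y|M. f' x0 y h) \<le> (LINT y|M. norm (f' x0 y h))" by (rule integral_norm_bound)
    also have "\<dots> \<le> (LINT y|M. b y * norm h)"
      using int' b dom[OF _ U(3)] by (intro integral_mono) auto
    finally show "norm (LINT y|M. f' x0 y h) \<le> norm h * (LINT y|M. b y)" by (simp add: mult.commute)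
  qed
  have "((\<lambda>x. LINT y|M. f x y) has_derivative (\<lambda>h. LINT y|M. f' x0 y h)) (at x0 within U)"
    unfolding has_derivative_within tendsto_at_iff_sequentially
  proof (intro conjI bl allI impI)
    fix X assume X: "\<forall>i. X i \<in> U - {x0}" "X \<longlonglongrightarrow> x0"
    \<comment> \<open>The normalised remainder of the first-order expansion. The increment and the
      linear term are each at most \<open>b y\<close> times the distance, hence the majorant
      \<open>2 * b y\<close>.\<close>
    define g where "g i y = (1 / norm (X i - x0)) *\<^sub>R (f (X i) y - (f x0 y + f' x0 y (X i - x0)))" for i y
    have "(\<lambda>i. LINT y|M. g i y) \<longlonglongrightarrow> (LINT y|M. 0)"
    proof (rule integral_dominated_convergence[where w = "\<lambda>y. 2 * b y"])
      show "g i \<in> borel_measurable M" for i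
        unfolding g_def using int[of "X i"] int[OF U(3)] X(1) meas
        by (intro borel_measurable_scaleR borel_measurable_diff borel_measurable_add) auto
      show "integrable M (\<lambda>y. 2 * b y)" using b by simp
      show "AE y in M. (\<lambda>i. g i y) \<longlonglongrightarrow> 0"
      proof (rule AE_I2)
        fix y assume "y \<in> space M"
        from der[OF this U(3)] have "((\<lambda>x. f x y) has_derivative f' x0 y) (at x0 within U)" by (rule has_derivative_at_withinI)
        then show "(\<lambda>i. g i y) \<longlonglongrightarrow> 0"
          using X unfolding has_derivative_within tendsto_at_iff_sequentially g_def by (auto simp: comp_def)
      qed
      show "AE y in M. norm (g i y) \<le> 2 * b y" for i
      proof (rule AE_I2)
        fix y assume y: "y \<in> space M"
        have Xi: "X i \<in> U" "X i \<noteq> x0" using X by auto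
        have "norm (f (X i) y - f x0 y) \<le> b y * norm (X i - x0)"
        proof (rule differentiable_bound[OF U(2) _ _ Xi(1) U(3), where f' = "\<lambda>x. f' x y"])
          show "((\<lambda>x. f x y) has_derivative f' x y) (at x within U)" if "x \<in> U" for x
            using der[OF y that] by (rule has_derivative_at_withinI)
          show "onorm (f' x y) \<le> b y" if "x \<in> U" for x
            using dom[OF y that] by (intro onorm_le)
        qed
        moreover have "norm (f' x0 y (X i - x0)) \<le> b y * norm (X i - x0)" using dom[OF y U(3)] .
        ultimately have "norm (f (X i) y - f x0 y - f' x0 y (X i - x0)) \<le> 2 * b y * norm (X i - x0)"
          using norm_triangle_ineq4[of "f (X i) y - f x0 y" "f' x0 y (X i - x0)"] by simp
        then show "norm (g i y) \<le> 2 * b y"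
          using Xi(2) unfolding g_def norm_scaleR by (simp add: divide_le_eq diff_diff_eq)
      qed
    qed simp
    moreover have "(LINT y|M. g i y) = (1 / norm (X i - x0)) *\<^sub>R ((LINT y|M. f (X i) y) - ((LINT y|M. f x0 y) + (LINT y|M. f' x0 y (X i - x0))))" for i
    proof -
      have i1: "integrable M (f (X i))" and i2: "integrable M (f x0)" using int[of "X i"] int[OF U(3)] X(1) by auto
      note i3 = int'[of "X i - x0"]
      show ?thesis
        unfolding g_def integral_scaleR_right Bochner_Integration.integral_diff[OF i1 Bochner_Integration.integrable_add[OF i2 i3]]
          Bochner_Integration.integral_add[OF i2 i3] ..
    qed
    ultimately show "((\<lambda>x. (1 / norm (x - x0)) *\<^sub>R ((LINT y|M. f x y) - ((LINT y|M. f x0 y) + (LINT y|M. f' x0 y (x - x0))))) \<circ> X) \<longlonglongrightarrow> 0"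
      by (simp add: comp_def)
  qed
  then show ?thesis by (simp only: at_within_open[OF U(3) U(1)])
qed

lemma integrable_csupp:
  assumes "continuous_on UNIV f" "csupp f"
  shows "integrable lborel f"
proof -
  obtain R where R: "\<forall>x. R < norm x \<longrightarrow> f x = 0" using assms(2) by (auto simp: csupp_def)
  have "integrable lborel (\<lambda>x. indicator (cball 0 R) x *\<^sub>R f x)"
    by (rule borel_integrable_compact) (use assms continuous_on_subset in auto)
  moreover have "(\<lambda>x. indicator (cball 0 R) x *\<^sub>R f x) = f"
    using R by (auto simp: fun_eq_iff indicator_def)
  ultimately show ?thesis by simp
qed

lemma bounded_csupp:
  assumes "continuous_on UNIV f" "csupp f"
  obtains B where "0 \<le> B" "\<And>x. norm (f x) \<le> B"
proof -
  obtain R where R: "\<forall>x. R < norm x \<longrightarrow> f x = 0" using assms(2) by (auto simp: csupp_def)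
  have "bounded (f ` cball 0 R)"
    by (intro compact_imp_bounded compact_continuous_image continuous_on_subset[OF assms(1)]) auto
  then obtain B where B: "\<forall>x\<in>cball 0 R. norm (f x) \<le> B" unfolding bounded_iff by auto
  have "norm (f x) \<le> \<bar>B\<bar>" for x using B R by (cases "norm x \<le> R") force+
  then show ?thesis using that[of "\<bar>B\<bar>"] by simp
qed

text \<open>By translation invariance the integral of \<open>g (x + s *\<^sub>R axis i 1)\<close> is
  constant in \<open>s\<close>; differentiating at \<open>s = 0\<close> under the integral gives the
  claim.\<close>

lemma integral_partial_eq_0:
  assumes d: "\<And>x. g differentiable (at x)" and c: "continuous_on UNIV (partial i g)" and s: "csupp g"
  shows "(LINT x|lborel. partial i g x) = 0"
proof -
  obtain R where R: "\<forall>x. R < norm x \<longrightarrow> partial i g x = 0" using csupp_partial[OF s] by (auto simp: csupp_def)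
  obtain B where B: "0 \<le> B" "\<And>x. norm (partial i g x) \<le> B" using bounded_csupp[OF c csupp_partial[OF s]] by blast
  have gc: "continuous_on UNIV g"
    using d by (intro differentiable_imp_continuous_on) (simp add: differentiable_on_def differentiable_at_withinI)
  have gi: "integrable lborel g" by (rule integrable_csupp[OF gc s])
  have gm[measurable]: "g \<in> borel_measurable borel" by (rule borel_measurable_continuous_onI[OF gc])
  have pm[measurable]: "partial i g \<in> borel_measurable borel" by (rule borel_measurable_continuous_onI[OF c])
  have nz: "norm (x + s *\<^sub>R axis i 1) \<ge> norm x - \<bar>s\<bar>" for x :: "real^'a" and s
    using norm_triangle_ineq2[of x "- (s *\<^sub>R axis i 1)"] by simp
  have "((\<lambda>s. LINT x|lborel. g (x + s *\<^sub>R axis i 1)) has_derivative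
      (\<lambda>h. LINT x|lborel. of_real h * partial i g (x + 0 *\<^sub>R axis i 1))) (at 0)"
  \<comment> \<open>With shifts shorter than 1 the shifted derivative lives in the ball of radius
    \<open>R + 1\<close>, which provides an integrable majorant.\<close>
  proof (rule has_derivative_integral_dominated[where U = "ball 0 1" and b = "\<lambda>x. B * indicator (cball 0 (R + 1)) x"
        and f' = "\<lambda>s x h. of_real h * partial i g (x + s *\<^sub>R axis i 1)"])
    show "integrable lborel (\<lambda>x. g (x + s *\<^sub>R axis i 1))" for s
    proof -
      have "integrable (distr lborel borel ((+) (s *\<^sub>R axis i 1))) g" using gi by (simp add: lborel_distr_plus)
      then show ?thesis by (subst (asm) integrable_distr_eq) (auto simp: add.commute)
    qed
    show "((\<lambda>s. g (x + s *\<^sub>R axis i 1)) has_derivative (\<lambda>h. of_real h * partial i g (x + s *\<^sub>R axis i 1))) (at s)" for x s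
    proof -
      have "((\<lambda>s. g (x + s *\<^sub>R axis i 1)) has_derivative
         (\<lambda>h. \<Sum>l\<in>UNIV. of_real ((h *\<^sub>R axis i 1) $ l) * partial l g (x + s *\<^sub>R axis i 1))) (at s)"
        by (rule has_derivative_compose[of "\<lambda>s. x + s *\<^sub>R axis i 1" _ _ _ g, OF _ has_derivative_partials[OF d]])
           (auto intro!: derivative_eq_intros)
      moreover have "(\<Sum>l\<in>UNIV. of_real ((h *\<^sub>R axis i 1) $ l) * partial l g (x + s *\<^sub>R axis i 1)) = of_real h * partial i g (x + s *\<^sub>R axis i 1)" for h
        by (simp add: sum_axis sum_distrib_left[symmetric] mult.assoc)
      ultimately show ?thesis by simp
    qed
    show "norm (of_real h * partial i g (x + s *\<^sub>R axis i 1)) \<le> B * indicator (cball 0 (R + 1)) x * norm h"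
      if "s \<in> ball 0 1" for s x h
    proof (cases "norm x \<le> R + 1")
      case True then show ?thesis using mult_right_mono[OF B(2), of "\<bar>h\<bar>"] by (simp add: norm_mult mult.commute)
    next
      case False
      then have "R < norm (x + s *\<^sub>R axis i 1)" using nz[of x s] that by (simp add: dist_norm)
      then show ?thesis using R B by simp
    qed
    show "integrable lborel (\<lambda>x. B * indicator (cball 0 (R + 1)) x :: real)"
      using emeasure_bounded_finite[OF bounded_cball]
      by (intro integrable_mult_right) (simp add: integrable_indicator_iff)
  qed (auto simp: convex_ball)
  moreover have "(\<lambda>s. LINT x|lborel. g (x + s *\<^sub>R axis i 1)) = (\<lambda>s. LINT x|lborel. g x)"
    by (intro ext integral_lborel_translation) simp
  ultimately have "((\<lambda>s. LINT x|lborel. g x) has_derivative (\<lambda>h. LINT x|lborel. of_real h * partial i g x)) (at (0::real))"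
    by simp
  from has_derivative_unique[OF this has_derivative_const] have "(LINT x|lborel. of_real 1 * partial i g x) = 0"
    by metis
  then show ?thesis by simp
qed

section \<open>The Fourier transform of test functions\<close>

abbreviation ekern :: "real^'n::finite \<Rightarrow> real^'n \<Rightarrow> complex" where
  "ekern \<xi> x \<equiv> exp (- (\<i> * of_real (\<xi> \<bullet> x)))"

lemma norm_ekern [simp]: "norm (ekern \<xi> x) = 1"
  by (simp add: norm_exp_eq_Re)

lemma integrable_ekern:
  assumes "continuous_on UNIV f" "csupp f"
  shows "integrable lborel (\<lambda>x. ekern \<xi> x * f x)"
  by (rule integrable_csupp) (intro continuous_intros assms csupp_mult)+

lemma has_derivative_exp_i:
  assumes "(g has_derivative g') (at x within S)"
  shows "((\<lambda>x. exp (- (\<i> * complex_of_real (g x)))) has_derivative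
     (\<lambda>h. - (\<i> * of_real (g' h)) * exp (- (\<i> * of_real (g x))))) (at x within S)"
proof -
  have "((\<lambda>x. - (\<i> * complex_of_real (g x))) has_derivative (\<lambda>h. - (\<i> * of_real (g' h)))) (at x within S)"
    using assms by (auto intro!: derivative_eq_intros)
  from has_derivative_compose[OF this DERIV_exp[unfolded has_field_derivative_def]]
  show ?thesis by (simp add: mult.commute)
qed

lemma has_derivative_ekern:
  "((\<lambda>x. ekern \<xi> x) has_derivative (\<lambda>h. - (\<i> * of_real (\<xi> \<bullet> h)) * ekern \<xi> x)) (at x)"
  by (intro has_derivative_exp_i) (auto intro!: derivative_eq_intros)

text \<open>Integration by parts: the kernel times \<open>f\<close> has compact support, so its
  derivative integrates to zero.\<close>

lemma fourier_partial:
  assumes f: "smooth f" "csupp f"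
  shows "fourier (partial i f) \<xi> = \<i> * of_real (\<xi> $ i) * fourier f \<xi>"
proof -
  let ?g = "\<lambda>x. ekern \<xi> x * f x"
  have de: "(\<lambda>x. ekern \<xi> x) differentiable (at x)" for x using differentiableI[OF has_derivative_ekern] .
  have pe: "partial i (ekern \<xi>) x = - (\<i> * of_real (\<xi> $ i)) * ekern \<xi> x" for x
    using partial_eq[OF has_derivative_ekern, of i \<xi> x] by (simp add: inner_axis)
  have p: "partial i ?g = (\<lambda>x. ekern \<xi> x * partial i f x - \<i> * of_real (\<xi> $ i) * (ekern \<xi> x * f x))"
    using partial_mult[OF de smooth_differentiable[OF f(1)], of i] pe by (simp add: fun_eq_iff)
  have fc: "continuous_on UNIV f" "continuous_on UNIV (partial i f)"
    using f smooth_continuous smooth_partial by blast+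
  have "(LINT x|lborel. partial i ?g x) = 0"
  proof (rule integral_partial_eq_0)
    show "?g differentiable at x" for x by (intro differentiable_mult de smooth_differentiable f)
    show "continuous_on UNIV (partial i ?g)" unfolding p by (intro continuous_intros fc)
    show "csupp ?g" by (rule csupp_mult[OF f(2)])
  qed
  then have "(LINT x|lborel. ekern \<xi> x * partial i f x) = \<i> * of_real (\<xi> $ i) * (LINT x|lborel. ekern \<xi> x * f x)"
    unfolding p using integrable_ekern[OF fc(1) f(2)] integrable_ekern[OF fc(2) csupp_partial[OF f(2)]] by simp
  then show ?thesis by (simp add: fourier_def)
qed

lemma fourier_add:
  assumes "smooth f" "csupp f" "smooth g" "csupp g"
  shows "fourier (\<lambda>x. f x + g x) \<xi> = fourier f \<xi> + fourier g \<xi>"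
  unfolding fourier_def using assms
  by (simp add: ring_distribs integrable_ekern smooth_continuous)

lemma fourier_cmult: "fourier (\<lambda>x. c * f x) \<xi> = c * fourier f \<xi>"
proof -
  have "(LINT x|lborel. ekern \<xi> x * (c * f x)) = (LINT x|lborel. c * (ekern \<xi> x * f x))"
    by (simp add: mult.left_commute)
  then show ?thesis by (simp add: fourier_def)
qed

lemma fourier_sum:
  assumes "finite I" "\<And>i. i \<in> I \<Longrightarrow> smooth (f i)" "\<And>i. i \<in> I \<Longrightarrow> csupp (f i)"
  shows "fourier (\<lambda>x. \<Sum>i\<in>I. f i x) \<xi> = (\<Sum>i\<in>I. fourier (f i) \<xi>)"
  using assms
proof (induction I rule: finite_induct)
  case (insert i I)
  have "smooth (\<lambda>x. \<Sum>i\<in>I. f i x)" "csupp (\<lambda>x. \<Sum>i\<in>I. f i x)"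
    using insert by (intro smooth_sum csupp_sum; simp)+
  then show ?case using insert by (simp add: fourier_add)
qed (simp add: fourier_def)

lemma fourier_Laplacian:
  assumes f: "smooth f" "csupp f"
  shows "fourier (Laplacian f) \<xi> = - of_real ((norm \<xi>)\<^sup>2) * fourier f \<xi>"
proof -
  have "fourier (Laplacian f) \<xi> = (\<Sum>i\<in>UNIV. fourier (partial i (partial i f)) \<xi>)"
    unfolding Laplacian_def by (intro fourier_sum smooth_partial csupp_partial f) auto
  also have "\<dots> = (\<Sum>i\<in>UNIV. - of_real ((\<xi> $ i)\<^sup>2) * fourier f \<xi>)"
    by (intro sum.cong refl)
       (simp add: fourier_partial smooth_partial csupp_partial f power2_eq_square mult_ac)
  also have "\<dots> = - of_real (\<Sum>i\<in>UNIV. (\<xi> $ i)\<^sup>2) * fourier f \<xi>"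
    by (simp add: sum_distrib_right sum_negf)
  also have "(\<Sum>i\<in>UNIV. (\<xi> $ i)\<^sup>2) = (norm \<xi>)\<^sup>2"
    by (simp add: norm_vec_def L2_set_def sum_nonneg)
  finally show ?thesis .
qed

lemma fourier_scale_arg:
  fixes f :: "real^'n::finite \<Rightarrow> complex"
  assumes "f \<in> borel_measurable borel" "0 < a"
  shows "fourier (\<lambda>x. f (a *\<^sub>R x)) \<xi> = fourier f (\<xi> /\<^sub>R a) / of_real (a ^ CARD('n))"
proof -
  define I where "I = (LINT x|lborel. ekern (\<xi> /\<^sub>R a) x * f x)"
  have "(LINT x|lborel. ekern \<xi> x * f (a *\<^sub>R x)) = (LINT x|lborel. ekern (\<xi> /\<^sub>R a) (a *\<^sub>R x) * f (a *\<^sub>R x))"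
  proof (rule Bochner_Integration.integral_cong[OF refl])
    fix x :: "real^'n"
    have "(\<xi> /\<^sub>R a) \<bullet> (a *\<^sub>R x) = \<xi> \<bullet> x" using assms(2) by simp
    then show "ekern \<xi> x * f (a *\<^sub>R x) = ekern (\<xi> /\<^sub>R a) (a *\<^sub>R x) * f (a *\<^sub>R x)" by (simp only:)
  qed
  also have "\<dots> = I /\<^sub>R a ^ CARD('n)"
    unfolding I_def by (subst integral_lborel_scaleR[of "\<lambda>x. ekern (\<xi> /\<^sub>R a) x * f x" a]) (use assms in simp_all)
  finally have eq: "(LINT x|lborel. ekern \<xi> x * f (a *\<^sub>R x)) = I /\<^sub>R a ^ CARD('n)" .
  show ?thesis unfolding fourier_def eq I_def[symmetric]
    by (simp only: scaleR_conv_of_real of_real_inverse divide_inverse mult_ac)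
qed

text \<open>On the Fourier side \<Lambda> is minus the logarithmic radial derivative minus the
  dimension. The curve \<open>exp \<sigma> *\<^sub>R \<xi>\<close> turns that derivative into an
  ordinary one.\<close>

lemma fourier_exp_ray:
  fixes u :: "real^'n::finite \<Rightarrow> complex"
  assumes u: "smooth u" "csupp u"
  shows "((\<lambda>\<sigma>. fourier u (exp \<sigma> *\<^sub>R \<xi>)) has_vector_derivative
     (- fourier (Lam u) (exp \<sigma> *\<^sub>R \<xi>) - of_nat CARD('n) * fourier u (exp \<sigma> *\<^sub>R \<xi>))) (at \<sigma>)"
proof -
  have uc: "continuous_on UNIV u" using u smooth_continuous by blast
  have um[measurable]: "u \<in> borel_measurable borel" by (rule borel_measurable_continuous_onI[OF uc])
  obtain R where R: "\<forall>x. R < norm x \<longrightarrow> u x = 0" using u(2) by (auto simp: csupp_def)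
  define \<eta> where "\<eta> = exp \<sigma> *\<^sub>R \<xi>"
  define c where "c = complex_of_real ((2 * pi) powr (- real CARD('n) / 2))"
  have nu: "integrable lborel (\<lambda>x. norm \<xi> * (\<bar>R\<bar> * norm (u x)))"
    using integrable_csupp[OF uc u(2)] by simp
  have D: "((\<lambda>s. LINT x|lborel. ekern (s *\<^sub>R \<xi>) x * u x) has_derivative
      (\<lambda>h. LINT x|lborel. of_real h * (- (\<i> * of_real (\<xi> \<bullet> x)) * ekern (exp \<sigma> *\<^sub>R \<xi>) x * u x))) (at (exp \<sigma>))"
  proof (rule has_derivative_integral_dominated[where U = UNIV and b = "\<lambda>x. norm \<xi> * (\<bar>R\<bar> * norm (u x))"
         and f' = "\<lambda>s x h. of_real h * (- (\<i> * of_real (\<xi> \<bullet> x)) * ekern (s *\<^sub>R \<xi>) x * u x)"])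
    show "integrable lborel (\<lambda>x. ekern (s *\<^sub>R \<xi>) x * u x)" for s by (rule integrable_ekern[OF uc u(2)])
    show "((\<lambda>s. ekern (s *\<^sub>R \<xi>) x * u x) has_derivative (\<lambda>h. of_real h * (- (\<i> * of_real (\<xi> \<bullet> x)) * ekern (s *\<^sub>R \<xi>) x * u x))) (at s)" for s x
    proof -
      have "((\<lambda>s. (s *\<^sub>R \<xi>) \<bullet> x) has_derivative (\<lambda>h. h * (\<xi> \<bullet> x))) (at s)"
        by (auto intro!: derivative_eq_intros)
      from has_derivative_mult_left[OF has_derivative_exp_i[OF this], of "u x"]
      show ?thesis by (simp add: mult_ac)
    qed
    show "norm (of_real h * (- (\<i> * of_real (\<xi> \<bullet> x)) * ekern (s *\<^sub>R \<xi>) x * u x)) \<le> norm \<xi> * (\<bar>R\<bar> * norm (u x)) * norm h" for s x h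
    proof (cases "norm x \<le> R")
      case True
      have "\<bar>\<xi> \<bullet> x\<bar> \<le> norm \<xi> * norm x" by (rule Cauchy_Schwarz_ineq2)
      also have "\<dots> \<le> norm \<xi> * \<bar>R\<bar>" using True by (intro mult_left_mono) auto
      finally have "\<bar>\<xi> \<bullet> x\<bar> * (norm (u x) * \<bar>h\<bar>) \<le> norm \<xi> * \<bar>R\<bar> * (norm (u x) * \<bar>h\<bar>)" by (intro mult_right_mono) auto
      then show ?thesis by (simp add: norm_mult mult_ac)
    qed (use R in simp)
  qed (use nu in auto)
  have E: "(exp has_real_derivative exp \<sigma>) (at \<sigma>)" by (rule DERIV_exp)
  have DD: "((\<lambda>\<sigma>. c * (LINT x|lborel. ekern (exp \<sigma> *\<^sub>R \<xi>) x * u x)) has_derivative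
      (\<lambda>h. c * (LINT x|lborel. of_real (exp \<sigma> * h) * (- (\<i> * of_real (\<xi> \<bullet> x)) * ekern (exp \<sigma> *\<^sub>R \<xi>) x * u x)))) (at \<sigma>)"
    by (intro has_derivative_mult_right has_derivative_compose[OF E[unfolded has_field_derivative_def] D])
  have eq: "(LINT x|lborel. of_real (exp \<sigma> * h) * (- (\<i> * of_real (\<xi> \<bullet> x)) * ekern (exp \<sigma> *\<^sub>R \<xi>) x * u x))
      = h *\<^sub>R - (LINT x|lborel. \<i> * of_real (\<eta> \<bullet> x) * (ekern \<eta> x * u x))" for h
  proof -
    have "(LINT x|lborel. of_real (exp \<sigma> * h) * (- (\<i> * of_real (\<xi> \<bullet> x)) * ekern (exp \<sigma> *\<^sub>R \<xi>) x * u x))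
       = (LINT x|lborel. (- of_real h) * (\<i> * of_real (\<eta> \<bullet> x) * (ekern \<eta> x * u x)))"
      by (rule Bochner_Integration.integral_cong) (simp_all add: \<eta>_def mult_ac)
    also have "\<dots> = - of_real h * (LINT x|lborel. \<i> * of_real (\<eta> \<bullet> x) * (ekern \<eta> x * u x))"
      by (rule integral_mult_right_zero)
    finally show ?thesis by (simp only: scaleR_conv_of_real) simp
  qed
  have V: "((\<lambda>\<sigma>. fourier u (exp \<sigma> *\<^sub>R \<xi>)) has_vector_derivative
      - (c * (LINT x|lborel. \<i> * of_real (\<eta> \<bullet> x) * (ekern \<eta> x * u x)))) (at \<sigma>)"
    unfolding has_vector_derivative_def fourier_def c_def[symmetric]
    by (rule has_derivative_eq_rhs[OF DD], rule ext, subst eq) simp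
  \<comment> \<open>\<open>Lam u\<close> plus the dimension times \<open>u\<close> is the divergence
    of the vector field \<open>x u\<close>, whose transform is known from
    \<open>fourier_partial\<close>.\<close>
  let ?xu = "\<lambda>i x. of_real (x $ i) * u x"
  have xu: "smooth (?xu i)" "csupp (?xu i)" for i
    by (intro smooth_mult smooth_coord csupp_mult u)+
  have p: "partial i (?xu i) x = of_real (x $ i) * partial i u x + u x" for i x
    using partial_mult[OF smooth_differentiable[OF smooth_coord] smooth_differentiable[OF u(1)], of i i x] by (simp add: partial_coord)
  have "(\<lambda>x. \<Sum>i\<in>UNIV. partial i (?xu i) x) = (\<lambda>x. Lam u x + of_nat CARD('n) * u x)"
    unfolding p by (simp add: Lam_def sum.distrib)
  then have "fourier (Lam u) \<eta> + of_nat CARD('n) * fourier u \<eta> = fourier (\<lambda>x. \<Sum>i\<in>UNIV. partial i (?xu i) x) \<eta>"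
    by (simp add: fourier_add fourier_cmult Lam_smooth Lam_csupp u smooth_mult smooth_const csupp_mult)
  also have "\<dots> = (\<Sum>i\<in>UNIV. \<i> * of_real (\<eta> $ i) * fourier (?xu i) \<eta>)"
    using xu by (subst fourier_sum) (auto intro: smooth_partial csupp_partial simp: fourier_partial)
  also have "\<dots> = c * (\<Sum>i\<in>UNIV. (LINT x|lborel. \<i> * of_real (\<eta> $ i) * (ekern \<eta> x * ?xu i x)))"
    by (simp only: integral_mult_right_zero) (simp add: fourier_def c_def sum_distrib_left mult.left_commute)
  also have "(\<Sum>i\<in>UNIV. (LINT x|lborel. \<i> * of_real (\<eta> $ i) * (ekern \<eta> x * ?xu i x)))
     = (LINT x|lborel. (\<Sum>i\<in>UNIV. \<i> * of_real (\<eta> $ i) * (ekern \<eta> x * ?xu i x)))"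
    by (rule Bochner_Integration.integral_sum[symmetric]) (intro integrable_mult_right integrable_ekern smooth_continuous xu)
  also have "\<dots> = (LINT x|lborel. \<i> * of_real (\<eta> \<bullet> x) * (ekern \<eta> x * u x))"
    by (rule Bochner_Integration.integral_cong) (simp_all add: inner_vec_def sum_distrib_left sum_distrib_right mult_ac)
  finally have sum: "fourier (Lam u) \<eta> + of_nat CARD('n) * fourier u \<eta> = c * (LINT x|lborel. \<i> * of_real (\<eta> \<bullet> x) * (ekern \<eta> x * u x))" .
  have "- (c * (LINT x|lborel. \<i> * of_real (\<eta> \<bullet> x) * (ekern \<eta> x * u x))) = - fourier (Lam u) \<eta> - of_nat CARD('n) * fourier u \<eta>"
    unfolding sum[symmetric] by simp
  then show ?thesis using V unfolding \<eta>_def[symmetric] by (simp only:)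
qed

lemma fourier_bounded:
  assumes "smooth f" "csupp f"
  obtains B where "\<And>\<xi>. norm (fourier f \<xi>) \<le> B"
proof -
  have "norm (fourier f \<xi>) \<le> \<bar>(2 * pi) powr (- real CARD('a) / 2)\<bar> * (LINT x|lborel. norm (f x))" for \<xi>
  proof -
    have "norm (LINT x|lborel. ekern \<xi> x * f x) \<le> (LINT x|lborel. norm (ekern \<xi> x * f x))" by (rule integral_norm_bound)
    then show ?thesis unfolding fourier_def norm_mult norm_of_real by (intro mult_left_mono) (auto simp: norm_mult)
  qed
  then show ?thesis using that by blast
qed

lemma fourier_measurable [measurable]:
  assumes "smooth f"
  shows "fourier f \<in> borel_measurable borel"
proof -
  have [measurable]: "f \<in> borel_measurable borel" using assms by (rule smooth_measurable)
  have "(\<lambda>\<xi>. LINT x|lborel. ekern \<xi> x * f x) \<in> borel_measurable borel"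
    by (rule lborel.borel_measurable_lebesgue_integral) measurable
  then show ?thesis unfolding fourier_def by measurable
qed

text \<open>Decay faster than any power, uniformly in the index: one majorant then serves a whole
  sequence in dominated convergence. A single function is treated as a constant family.\<close>

definition rapid :: "('i \<Rightarrow> real^'n::finite \<Rightarrow> complex) \<Rightarrow> bool" where
  "rapid F \<longleftrightarrow> (\<forall>m::nat. \<exists>C. \<forall>i \<xi>. (1 + norm \<xi>) ^ m * norm (F i \<xi>) \<le> C)"

text \<open>Each application of the Laplacian gains a factor \<open>(norm \<xi>)^2\<close>, while
  the resulting transform is still bounded.\<close>

lemma rapid_fourier:
  assumes "smooth f" "csupp f"
  shows "rapid (\<lambda>_::'i. fourier f)"
  unfolding rapid_def
proof
  fix m
  have iter: "\<exists>B. \<forall>\<xi>. norm \<xi> ^ (2 * m) * norm (fourier f \<xi>) \<le> B" if "smooth f" "csupp f" for f :: "real^'a \<Rightarrow> complex"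
    using that
  proof (induction m arbitrary: f)
    case 0 then show ?case using fourier_bounded[OF 0] by (metis mult_1 mult_0_right power_0)
  next
    case (Suc m)
    from Suc.IH[OF Laplacian_smooth[OF Suc.prems(1)] Laplacian_csupp[OF Suc.prems(2)]]
    show ?case by (simp add: fourier_Laplacian Suc.prems norm_mult norm_power power2_eq_square mult_ac)
  qed
  obtain A where A: "\<And>\<xi>. norm (fourier f \<xi>) \<le> A" using fourier_bounded[OF assms] by blast
  obtain B where B: "\<And>\<xi>. norm \<xi> ^ (2 * m) * norm (fourier f \<xi>) \<le> B" using iter[OF assms] by blast
  have "(1 + norm \<xi>) ^ m * norm (fourier f \<xi>) \<le> 2 ^ (2 * m) * (A + B)" for \<xi>
  proof -
    \<comment> \<open>\<open>1 + r\<close> is at most twice \<open>max 1 r\<close>, and a power of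
      that maximum is at most 1 plus the power of \<open>r\<close>.\<close>
    have "(1 + norm \<xi>) ^ m \<le> (1 + norm \<xi>) ^ (2 * m)" by (rule power_increasing) auto
    also have "\<dots> \<le> (2 * max 1 (norm \<xi>)) ^ (2 * m)" by (rule power_mono) auto
    also have "\<dots> = 2 ^ (2 * m) * max 1 (norm \<xi>) ^ (2 * m)" by (rule power_mult_distrib)
    also have "\<dots> \<le> 2 ^ (2 * m) * (1 + norm \<xi> ^ (2 * m))"
      by (intro mult_left_mono) (auto simp: max_def)
    finally have "(1 + norm \<xi>) ^ m * norm (fourier f \<xi>) \<le> 2 ^ (2 * m) * (1 + norm \<xi> ^ (2 * m)) * norm (fourier f \<xi>)"
      by (intro mult_right_mono) auto
    also have "\<dots> = 2 ^ (2 * m) * (norm (fourier f \<xi>) + norm \<xi> ^ (2 * m) * norm (fourier f \<xi>))" by (simp add: algebra_simps)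
    also have "\<dots> \<le> 2 ^ (2 * m) * (A + B)" using A B by (intro mult_left_mono add_mono) auto
    finally show ?thesis .
  qed
  then show "\<exists>C. \<forall>i \<xi>. (1 + norm \<xi>) ^ m * norm (fourier f \<xi>) \<le> C" by blast
qed

section \<open>Averaging over balls\<close>

text \<open>A probability measure. The radius of averaging enters through the factor
  \<open>\<epsilon>\<close> in \<open>avg\<close>, so limits in \<open>\<epsilon>\<close> are taken
  against one fixed measure.\<close>

definition ballm :: "(real^'n::finite) measure" where
  "ballm = uniform_measure lborel (ball 0 1)"

lemma space_ballm [simp]: "space ballm = UNIV" and sets_ballm [simp, measurable_cong]: "sets ballm = sets borel"
  by (simp_all add: ballm_def)

lemma emeasure_ball_pos: "emeasure lborel (ball (0::'a::euclidean_space) 1) \<noteq> 0" "emeasure lborel (ball (0::'a) 1) \<noteq> \<infinity>"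
proof -
  show "emeasure lborel (ball (0::'a) 1) \<noteq> 0"
    using content_ball_pos[of 1 "0::'a"] by (auto simp: measure_def)
  show "emeasure lborel (ball (0::'a) 1) \<noteq> \<infinity>"
    using emeasure_bounded_finite[OF bounded_ball, of "0::'a" 1] by simp
qed

lemma emeasure_ballm:
  fixes A :: "(real^'n::finite) set"
  assumes "A \<in> sets borel"
  shows "emeasure ballm A = emeasure lborel (ball 0 1 \<inter> A) / emeasure lborel (ball (0::real^'n) 1)"
  unfolding ballm_def using assms by (subst emeasure_uniform_measure) auto

lemma emeasure_ballm_UNIV: "emeasure ballm (UNIV :: (real^'n::finite) set) = 1"
  using emeasure_ball_pos[where 'a = "real^'n"] by (simp add: emeasure_ballm ennreal_divide_self less_top)

lemma finite_measure_ballm: "finite_measure ballm"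
  by standard (simp add: emeasure_ballm_UNIV)

lemma measure_ballm_UNIV [simp]: "measure ballm UNIV = 1"
  by (simp add: measure_def emeasure_ballm_UNIV)

lemma AE_ballm: "AE y in ballm. norm y < 1"
  unfolding ballm_def by (rule AE_uniform_measureI) (auto simp: dist_norm)

lemma integrable_ballm:
  fixes f :: "real^'n::finite \<Rightarrow> 'b::{banach, second_countable_topology}"
  assumes "f \<in> borel_measurable borel" "\<And>y. norm y < 1 \<Longrightarrow> norm (f y) \<le> B"
  shows "integrable ballm f"
proof (rule finite_measure.integrable_const_bound[OF finite_measure_ballm])
  show "AE y in ballm. norm (f y) \<le> B" using AE_ballm by eventually_elim (rule assms)
qed (use assms in measurable)

lemma norm_integral_ballm_le:
  fixes f :: "real^'n::finite \<Rightarrow> 'b::{banach, second_countable_topology}"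
  assumes "f \<in> borel_measurable borel" "\<And>y. norm y < 1 \<Longrightarrow> norm (f y) \<le> B"
  shows "norm (LINT y|ballm. f y) \<le> B"
proof -
  have "norm (LINT y|ballm. f y) \<le> (LINT y|ballm. norm (f y))" by (rule integral_norm_bound)
  also have "\<dots> \<le> (LINT (y::real^'n)|ballm. B)"
  proof (rule integral_mono_AE)
    show "integrable ballm (\<lambda>y. norm (f y))" using integrable_ballm[OF assms] by simp
    show "integrable ballm (\<lambda>y. B)" by (rule integrable_ballm[of _ "\<bar>B\<bar>"]) auto
    show "AE y in ballm. norm (f y) \<le> B" using AE_ballm by eventually_elim (rule assms)
  qed
  finally show ?thesis by simp
qed

lemma ballm_distr_orthogonal:
  fixes R :: "real^'n::finite \<Rightarrow> real^'n"
  assumes R: "orthogonal_transformation R"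
  shows "distr ballm borel R = ballm"
proof (rule measure_eqI)
  have Rm[measurable]: "R \<in> borel_measurable borel"
    using R orthogonal_transformation_linear
    by (intro borel_measurable_continuous_onI linear_continuous_on linear_conv_bounded_linear[THEN iffD1]) auto
  fix A assume "A \<in> sets (distr ballm borel R)"
  then have A[measurable]: "A \<in> sets borel" by simp
  have V: "R -` A \<in> sets borel" "R -` (ball 0 1 \<inter> A) \<in> sets borel"
    using measurable_sets[OF Rm] A by (auto simp: vimage_Int)
  have "ball 0 1 \<inter> R -` A = R -` (ball 0 1 \<inter> A)"
    using orthogonal_transformation_norm[OF R] by auto
  moreover have "emeasure lborel (R -` (ball 0 1 \<inter> A)) = emeasure (distr lborel borel R) (ball 0 1 \<inter> A)"
    by (subst emeasure_distr) auto
  ultimately show "emeasure (distr ballm borel R) A = emeasure ballm A"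
    using V by (simp add: emeasure_distr emeasure_ballm lborel_distr_orthogonal[OF R])
qed simp

lemma integral_ballm_orthogonal:
  fixes R :: "real^'n::finite \<Rightarrow> real^'n" and f :: "real^'n::finite \<Rightarrow> 'b::{banach, second_countable_topology}"
  assumes R: "orthogonal_transformation R" and f: "f \<in> borel_measurable borel"
  shows "(LINT y|ballm. f (R y)) = (LINT y|ballm. f y)"
proof -
  have Rm[measurable]: "R \<in> borel_measurable borel"
    using R orthogonal_transformation_linear
    by (intro borel_measurable_continuous_onI linear_continuous_on linear_conv_bounded_linear[THEN iffD1]) auto
  have "(LINT y|ballm. f y) = (LINT y|distr ballm borel R. f y)" by (simp add: ballm_distr_orthogonal[OF R])
  also have "\<dots> = (LINT y|ballm. f (R y))" using f by (subst integral_distr) auto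
  finally show ?thesis by simp
qed

definition avg :: "real \<Rightarrow> (real^'n::finite \<Rightarrow> complex) \<Rightarrow> real^'n \<Rightarrow> complex" where
  "avg \<epsilon> u x = (LINT y|ballm. u (x - \<epsilon> *\<^sub>R y))"

text \<open>Averaging is a convolution, so derivatives fall on \<open>u\<close>; the partial
  derivatives of a test function are bounded, which gives a constant majorant.\<close>

lemma avg_has_derivative:
  assumes u: "smooth u" "csupp u"
  shows "(avg \<epsilon> u has_derivative (\<lambda>h. \<Sum>i\<in>UNIV. of_real (h $ i) * avg \<epsilon> (partial i u) x)) (at x)"
proof -
  have [measurable]: "u \<in> borel_measurable borel" "partial i u \<in> borel_measurable borel" for i
    using u smooth_measurable smooth_partial by blast+
  obtain B0 where B0: "\<And>x. norm (u x) \<le> B0" using bounded_csupp[OF smooth_continuous[OF u(1)] u(2)] by blast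
  have "\<exists>B\<ge>0. \<forall>x. norm (partial i u x) \<le> B" for i
    using bounded_csupp[OF smooth_continuous[OF smooth_partial[OF u(1)]] csupp_partial[OF u(2)]] by metis
  then obtain B where B: "\<And>i. 0 \<le> B i" "\<And>i x. norm (partial i u x) \<le> B i" by metis
  have D: "((\<lambda>x. LINT y|ballm. u (x - \<epsilon> *\<^sub>R y)) has_derivative
     (\<lambda>h. LINT y|ballm. (\<Sum>i\<in>UNIV. of_real (h $ i) * partial i u (x - \<epsilon> *\<^sub>R y)))) (at x)"
  proof (rule has_derivative_integral_dominated[where U = UNIV and b = "\<lambda>y. \<Sum>i\<in>UNIV. B i"
      and f' = "\<lambda>x y h. \<Sum>i\<in>UNIV. of_real (h $ i) * partial i u (x - \<epsilon> *\<^sub>R y)"])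
    show "integrable ballm (\<lambda>y. u (x - \<epsilon> *\<^sub>R y))" for x by (rule integrable_ballm[of _ B0]) (use B0 in auto)
    show "((\<lambda>x. u (x - \<epsilon> *\<^sub>R y)) has_derivative (\<lambda>h. \<Sum>i\<in>UNIV. of_real (h $ i) * partial i u (x - \<epsilon> *\<^sub>R y))) (at x)" for x y
      by (rule has_derivative_compose[of "\<lambda>x. x - \<epsilon> *\<^sub>R y" "\<lambda>h. h" _ _ u, OF _ has_derivative_partials[OF smooth_differentiable[OF u(1)]]])
         (auto intro!: derivative_eq_intros)
    show "norm (\<Sum>i\<in>UNIV. of_real (h $ i) * partial i u (x - \<epsilon> *\<^sub>R y)) \<le> (\<Sum>i\<in>UNIV. B i) * norm h" for x y h
    proof -
      have "norm (\<Sum>i\<in>UNIV. of_real (h $ i) * partial i u (x - \<epsilon> *\<^sub>R y)) \<le> (\<Sum>i\<in>UNIV. \<bar>h $ i\<bar> * norm (partial i u (x - \<epsilon> *\<^sub>R y)))"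
        by (rule order_trans[OF norm_sum]) (simp add: norm_mult)
      also have "\<dots> \<le> (\<Sum>i\<in>UNIV. norm h * B i)"
        by (intro sum_mono mult_mono B component_le_norm_cart) auto
      finally show ?thesis by (simp add: sum_distrib_left mult.commute)
    qed
    show "integrable ballm (\<lambda>y::real^'a. \<Sum>i\<in>UNIV. B i)" by (rule integrable_ballm[of _ "\<bar>\<Sum>i\<in>UNIV. B i\<bar>"]) auto
  qed auto
  have pint: "integrable ballm (\<lambda>y. partial i u (x - \<epsilon> *\<^sub>R y))" for i
    by (rule integrable_ballm[of _ "B i"]) (auto simp: B)
  have "(LINT y|ballm. (\<Sum>i\<in>UNIV. of_real (h $ i) * partial i u (x - \<epsilon> *\<^sub>R y))) = (\<Sum>i\<in>UNIV. of_real (h $ i) * avg \<epsilon> (partial i u) x)" for h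
    unfolding avg_def
    by (subst Bochner_Integration.integral_sum)
       (auto intro!: integrable_mult_right pint)
  then show ?thesis using D unfolding avg_def[abs_def] by simp
qed

lemma partial_avg: "smooth u \<Longrightarrow> csupp u \<Longrightarrow> partial i (avg \<epsilon> u) = avg \<epsilon> (partial i u)"
  by (rule ext, subst partial_eq[OF avg_has_derivative]) (auto simp: sum_axis)

lemma smooth_avg: "smooth u \<Longrightarrow> csupp u \<Longrightarrow> smooth (avg \<epsilon> u)"
proof -
  have "C_k k (avg \<epsilon> u)" if "smooth u" "csupp u" for k and u :: "real^'a \<Rightarrow> complex"
    using that
  proof (induction k arbitrary: u)
    case 0
    then show ?case
      by (auto simp: continuous_on_eq_continuous_at intro: has_derivative_continuous[OF avg_has_derivative])
  next
    case (Suc k)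
    then show ?case
      using differentiableI[OF avg_has_derivative] by (auto simp: partial_avg intro: smooth_partial csupp_partial)
  qed
  then show "smooth u \<Longrightarrow> csupp u \<Longrightarrow> smooth (avg \<epsilon> u)" by (simp add: smooth_def[of "avg \<epsilon> u"])
qed

lemma csupp_avg: "csupp u \<Longrightarrow> csupp (avg \<epsilon> u)"
proof -
  assume "csupp u"
  then obtain R where R: "\<forall>x. R < norm x \<longrightarrow> u x = 0" by (auto simp: csupp_def)
  have "avg \<epsilon> u x = 0" if "R + \<bar>\<epsilon>\<bar> < norm x" for x
  proof -
    have "AE y in ballm. u (x - \<epsilon> *\<^sub>R y) = 0"
      using AE_ballm
    proof eventually_elim
      fix y :: "real^'a" assume "norm y < 1"
      then have "norm (\<epsilon> *\<^sub>R y) \<le> \<bar>\<epsilon>\<bar>" by (simp add: mult_left_le)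
      then show "u (x - \<epsilon> *\<^sub>R y) = 0" using R norm_triangle_ineq2[of x "\<epsilon> *\<^sub>R y"] that by auto
    qed
    then show ?thesis unfolding avg_def by (rule integral_eq_zero_AE)
  qed
  then show ?thesis unfolding csupp_def by blast
qed

text \<open>A rotation taking \<open>x\<close> to \<open>y\<close> can be absorbed into the
  integration variable, because the uniform measure on the ball is rotation invariant.\<close>

lemma radial_avg:
  assumes "u \<in> borel_measurable borel" "radial u"
  shows "radial (avg \<epsilon> u)"
  unfolding radial_def
proof (intro allI impI)
  fix x y :: "real^'a" assume "norm x = norm y"
  then obtain R where R: "orthogonal_transformation R" "R x = y"
    using orthogonal_transformation_exists by blast
  have lin: "linear R" using R orthogonal_transformation_linear by blast
  have "avg \<epsilon> u y = (LINT z|ballm. u (y - \<epsilon> *\<^sub>R R z))"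
    unfolding avg_def using integral_ballm_orthogonal[OF R(1), of "\<lambda>z. u (y - \<epsilon> *\<^sub>R z)"] assms by simp
  also have "\<dots> = avg \<epsilon> u x"
    unfolding avg_def
  proof (rule Bochner_Integration.integral_cong[OF refl])
    fix z
    have "y - \<epsilon> *\<^sub>R R z = R (x - \<epsilon> *\<^sub>R z)" using R(2) by (simp add: linear_diff[OF lin] linear_scale[OF lin])
    then have "norm (y - \<epsilon> *\<^sub>R R z) = norm (x - \<epsilon> *\<^sub>R z)" using orthogonal_transformation_norm[OF R(1)] by simp
    then show "u (y - \<epsilon> *\<^sub>R R z) = u (x - \<epsilon> *\<^sub>R z)" using assms(2) unfolding radial_def by blast
  qed
  finally show "avg \<epsilon> u x = avg \<epsilon> u y" by simp
qed

lemma rt_avg: "u \<in> radial_test_functions \<Longrightarrow> avg \<epsilon> u \<in> radial_test_functions"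
  by (simp add: radial_test_functions_iff smooth_avg csupp_avg radial_avg smooth_measurable)

section \<open>The Fourier multiplier of the ball average\<close>

definition bmul :: "real^'n::finite \<Rightarrow> real" where
  "bmul \<xi> = (LINT y|ballm. cos (\<xi> \<bullet> y))"

text \<open>The negative of \<open>\<xi> . grad bmul\<close>; it appears whenever \<Lambda> meets
  the multiplier.\<close>

definition bgrad :: "real^'n::finite \<Rightarrow> real" where
  "bgrad \<xi> = (LINT y|ballm. (\<xi> \<bullet> y) * sin (\<xi> \<bullet> y))"

text \<open>The ball is symmetric under reflection at the origin, so the sine part cancels and the
  multiplier is real.\<close>

lemma integral_ballm_ekern: "(LINT y|ballm. ekern \<xi> y) = of_real (bmul \<xi>)"
proof -
  have sin0: "(LINT y|ballm. sin (\<xi> \<bullet> y)) = 0"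
  proof -
    have "orthogonal_transformation (uminus :: real^'a \<Rightarrow> real^'a)"
      by (simp add: orthogonal_transformation_def linear_uminus)
    from integral_ballm_orthogonal[OF this, of "\<lambda>y. sin (\<xi> \<bullet> y)"]
    have "(LINT y|ballm. sin (\<xi> \<bullet> - y)) = (LINT y|ballm. sin (\<xi> \<bullet> y))" by simp
    then show ?thesis by simp
  qed
  have "ekern \<xi> y = of_real (cos (\<xi> \<bullet> y)) - \<i> * of_real (sin (\<xi> \<bullet> y))" for y
    using cis_conv_exp[of "- (\<xi> \<bullet> y)"] by (simp add: complex_eq_iff)
  then have "(LINT y|ballm. ekern \<xi> y) = (LINT y|ballm. of_real (cos (\<xi> \<bullet> y)) - \<i> * of_real (sin (\<xi> \<bullet> y)))" by simp
  also have "\<dots> = (LINT y|ballm. complex_of_real (cos (\<xi> \<bullet> y))) - (LINT y|ballm. \<i> * of_real (sin (\<xi> \<bullet> y)))"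
    by (intro Bochner_Integration.integral_diff integrable_ballm[of _ 1]) (auto simp: norm_mult)
  also have "\<dots> = of_real (bmul \<xi>)" by (simp add: bmul_def sin0)
  finally show ?thesis .
qed

text \<open>Fubini: shifting \<open>u\<close> by \<open>\<epsilon> *\<^sub>R y\<close> multiplies
  its transform by a phase, and averaging the phases over \<open>y\<close> gives the
  multiplier.\<close>

lemma fourier_avg:
  assumes u: "smooth u" "csupp u"
  shows "fourier (avg \<epsilon> u) \<xi> = of_real (bmul (\<epsilon> *\<^sub>R \<xi>)) * fourier u \<xi>"
proof -
  have um[measurable]: "u \<in> borel_measurable borel" using u smooth_measurable by blast
  interpret finite_measure "ballm :: (real^'a) measure" by (rule finite_measure_ballm)
  interpret P: pair_sigma_finite "ballm :: (real^'a) measure" "lborel :: (real^'a) measure" ..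
  have inner: "(LINT x|lborel. ekern \<xi> x * u (x - \<epsilon> *\<^sub>R y)) = ekern (\<epsilon> *\<^sub>R \<xi>) y * (LINT x|lborel. ekern \<xi> x * u x)" for y
  proof -
    have "(LINT x|lborel. ekern \<xi> x * u (x - \<epsilon> *\<^sub>R y)) = (LINT x|lborel. ekern \<xi> (x + \<epsilon> *\<^sub>R y) * u x)"
      using integral_lborel_translation[of "\<lambda>x. ekern \<xi> x * u (x - \<epsilon> *\<^sub>R y)" "\<epsilon> *\<^sub>R y"] by simp
    also have "\<dots> = (LINT x|lborel. ekern (\<epsilon> *\<^sub>R \<xi>) y * (ekern \<xi> x * u x))"
    proof (rule Bochner_Integration.integral_cong[OF refl])
      fix x :: "real^'a"
      have "- (\<i> * complex_of_real (\<xi> \<bullet> (x + \<epsilon> *\<^sub>R y))) = - (\<i> * of_real ((\<epsilon> *\<^sub>R \<xi>) \<bullet> y)) + - (\<i> * of_real (\<xi> \<bullet> x))"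
        by (simp add: inner_add_right algebra_simps)
      then show "ekern \<xi> (x + \<epsilon> *\<^sub>R y) * u x = ekern (\<epsilon> *\<^sub>R \<xi>) y * (ekern \<xi> x * u x)"
        by (simp only: exp_add mult.assoc)
    qed
    finally show ?thesis by simp
  qed
  have int: "integrable (ballm \<Otimes>\<^sub>M lborel) (\<lambda>(y, x). ekern \<xi> x * u (x - \<epsilon> *\<^sub>R y))"
  proof (rule P.Fubini_integrable)
    show "(\<lambda>(y, x). ekern \<xi> x * u (x - \<epsilon> *\<^sub>R y)) \<in> borel_measurable (ballm \<Otimes>\<^sub>M lborel)" by measurable
    have "(LINT x|lborel. norm (ekern \<xi> x * u (x - \<epsilon> *\<^sub>R y))) = (LINT x|lborel. norm (u x))" for y
      using integral_lborel_translation[of "\<lambda>x. norm (u x)" "- (\<epsilon> *\<^sub>R y)"] by (simp add: norm_mult)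
    then show "integrable ballm (\<lambda>y. LINT x|lborel. norm (case (y, x) of (y, x) \<Rightarrow> ekern \<xi> x * u (x - \<epsilon> *\<^sub>R y)))" by simp
    have "integrable lborel (\<lambda>x. ekern \<xi> x * u (x - \<epsilon> *\<^sub>R y))" for y
    proof (rule integrable_ekern)
      show "continuous_on UNIV (\<lambda>x. u (x - \<epsilon> *\<^sub>R y))"
        by (intro continuous_on_compose2[OF smooth_continuous[OF u(1), of UNIV]] continuous_intros) auto
      obtain R where R: "\<forall>x. R < norm x \<longrightarrow> u x = 0" using u(2) by (auto simp: csupp_def)
      have "u (x - \<epsilon> *\<^sub>R y) = 0" if "R + norm (\<epsilon> *\<^sub>R y) < norm x" for x
        using R norm_triangle_ineq2[of x "\<epsilon> *\<^sub>R y"] that by auto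
      then show "csupp (\<lambda>x. u (x - \<epsilon> *\<^sub>R y))" unfolding csupp_def by blast
    qed
    then show "AE y in ballm. integrable lborel (\<lambda>x. case (y, x) of (y, x) \<Rightarrow> ekern \<xi> x * u (x - \<epsilon> *\<^sub>R y))" by simp
  qed
  have "(LINT x|lborel. ekern \<xi> x * avg \<epsilon> u x) = (LINT x|lborel. LINT y|ballm. ekern \<xi> x * u (x - \<epsilon> *\<^sub>R y))"
    by (simp add: avg_def)
  also have "\<dots> = (LINT y|ballm. LINT x|lborel. ekern \<xi> x * u (x - \<epsilon> *\<^sub>R y))"
    using P.Fubini_integral[of "\<lambda>y x. ekern \<xi> x * u (x - \<epsilon> *\<^sub>R y)"] int by simp
  also have "\<dots> = (LINT y|ballm. ekern (\<epsilon> *\<^sub>R \<xi>) y) * (LINT x|lborel. ekern \<xi> x * u x)"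
    unfolding inner by (rule integral_mult_left_zero)
  finally show ?thesis by (simp only: fourier_def integral_ballm_ekern mult_ac)
qed

lemma abs_bmul_le: "\<bar>bmul \<xi>\<bar> \<le> 1"
  unfolding bmul_def real_norm_def[symmetric] by (rule norm_integral_ballm_le) auto

lemma bmul_exp_ray: "((\<lambda>\<sigma>. bmul (exp \<sigma> *\<^sub>R \<xi>)) has_real_derivative - bgrad (exp \<sigma> *\<^sub>R \<xi>)) (at \<sigma>)"
proof -
  have D: "((\<lambda>s. LINT y|ballm. cos ((s *\<^sub>R \<xi>) \<bullet> y)) has_derivative
      (\<lambda>h. LINT y|ballm. - (h * ((\<xi> \<bullet> y) * sin ((exp \<sigma> *\<^sub>R \<xi>) \<bullet> y))))) (at (exp \<sigma>))"
  proof (rule has_derivative_integral_dominated[where U = UNIV and b = "\<lambda>y. norm \<xi> * norm y"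
      and f' = "\<lambda>s y h. - (h * ((\<xi> \<bullet> y) * sin ((s *\<^sub>R \<xi>) \<bullet> y)))"])
    show "integrable ballm (\<lambda>y. cos ((s *\<^sub>R \<xi>) \<bullet> y))" for s by (rule integrable_ballm[of _ 1]) auto
    show "((\<lambda>s. cos ((s *\<^sub>R \<xi>) \<bullet> y)) has_derivative (\<lambda>h. - (h * ((\<xi> \<bullet> y) * sin ((s *\<^sub>R \<xi>) \<bullet> y))))) (at s)" for s y
      by (auto intro!: derivative_eq_intros)
    show "norm (- (h * ((\<xi> \<bullet> y) * sin ((s *\<^sub>R \<xi>) \<bullet> y)))) \<le> norm \<xi> * norm y * norm h" for s y h
    proof -
      have "\<bar>h\<bar> * (\<bar>\<xi> \<bullet> y\<bar> * \<bar>sin ((s *\<^sub>R \<xi>) \<bullet> y)\<bar>) \<le> \<bar>h\<bar> * ((norm \<xi> * norm y) * 1)"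
        by (intro mult_left_mono mult_mono Cauchy_Schwarz_ineq2) auto
      then show ?thesis by (simp add: abs_mult mult_ac)
    qed
    show "integrable ballm (\<lambda>y. norm \<xi> * norm y)"
      by (rule integrable_ballm[of _ "norm \<xi>"]) (auto intro: mult_left_le)
  qed auto
  have E: "(exp has_real_derivative exp \<sigma>) (at \<sigma>)" by (rule DERIV_exp)
  have A: "((\<lambda>\<sigma>. bmul (exp \<sigma> *\<^sub>R \<xi>)) has_derivative
      (\<lambda>h. LINT y|ballm. - (exp \<sigma> * h * ((\<xi> \<bullet> y) * sin ((exp \<sigma> *\<^sub>R \<xi>) \<bullet> y))))) (at \<sigma>)"
    unfolding bmul_def by (rule has_derivative_compose[OF E[unfolded has_field_derivative_def] D])
  have B: "(LINT y|ballm. - (exp \<sigma> * h * ((\<xi> \<bullet> y) * sin ((exp \<sigma> *\<^sub>R \<xi>) \<bullet> y)))) = - bgrad (exp \<sigma> *\<^sub>R \<xi>) * h" for h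
  proof -
    have "(LINT y|ballm. - (exp \<sigma> * h * ((\<xi> \<bullet> y) * sin ((exp \<sigma> *\<^sub>R \<xi>) \<bullet> y))))
        = (LINT y|ballm. (- h) * (((exp \<sigma> *\<^sub>R \<xi>) \<bullet> y) * sin ((exp \<sigma> *\<^sub>R \<xi>) \<bullet> y)))"
      by (rule Bochner_Integration.integral_cong) auto
    also have "\<dots> = - h * bgrad (exp \<sigma> *\<^sub>R \<xi>)" unfolding bgrad_def by (rule integral_mult_right_zero)
    finally show ?thesis by simp
  qed
  show ?thesis unfolding has_field_derivative_def by (rule has_derivative_eq_rhs[OF A], rule ext, rule B)
qed

text \<open>The second moment of one coordinate on the unit ball. By rotation invariance any
  coordinate will do, hence the arbitrary index \<open>undefined\<close>. Near the origin
  \<open>bmul \<xi>\<close> is 1 minus half of \<open>bmom\<close> times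
  \<open>(norm \<xi>)^2\<close>, up to higher order.\<close>

definition bmom :: "'n::finite itself \<Rightarrow> real" where
  "bmom _ = (LINT y|ballm. ((axis undefined 1 :: real^'n) \<bullet> y)\<^sup>2)"

text \<open>A rotation takes the axis used in \<open>bmom\<close> to the direction of
  \<open>\<xi>\<close>.\<close>

lemma integral_ballm_square: "(LINT y|ballm. ((\<xi>::real^'n::finite) \<bullet> y)\<^sup>2) = bmom TYPE('n) * (norm \<xi>)\<^sup>2"
proof -
  define e :: "real^'n" where "e = axis undefined 1"
  have "norm (norm \<xi> *\<^sub>R e) = norm \<xi>" by (simp add: e_def)
  then obtain R where R: "orthogonal_transformation R" "R (norm \<xi> *\<^sub>R e) = \<xi>"
    using orthogonal_transformation_exists by blast
  have "(LINT y|ballm. (\<xi> \<bullet> y)\<^sup>2) = (LINT y|ballm. (\<xi> \<bullet> R y)\<^sup>2)"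
    using integral_ballm_orthogonal[OF R(1), of "\<lambda>y. (\<xi> \<bullet> y)\<^sup>2"] by simp
  also have "(\<lambda>y. (\<xi> \<bullet> R y)\<^sup>2) = (\<lambda>y. ((norm \<xi> *\<^sub>R e) \<bullet> y)\<^sup>2)"
    using R by (metis orthogonal_transformation_def)
  also have "(LINT y|ballm. ((norm \<xi> *\<^sub>R e) \<bullet> y)\<^sup>2) = (norm \<xi>)\<^sup>2 * bmom TYPE('n)"
    by (simp add: bmom_def e_def power_mult_distrib)
  finally show ?thesis by (simp add: mult.commute)
qed

lemma inner_power2_le: "norm y < 1 \<Longrightarrow> (\<xi> \<bullet> y)\<^sup>2 \<le> (norm \<xi>)\<^sup>2"
proof -
  assume "norm y < 1"
  have "\<bar>\<xi> \<bullet> y\<bar> \<le> norm \<xi> * norm y" by (rule Cauchy_Schwarz_ineq2)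
  also have "\<dots> \<le> norm \<xi>" using \<open>norm y < 1\<close> by (simp add: mult_left_le)
  finally show ?thesis using abs_le_square_iff[of "\<xi> \<bullet> y" "norm \<xi>"] by simp
qed

lemma integrable_ballm_square: "integrable ballm (\<lambda>y. (\<xi> \<bullet> y)\<^sup>2)"
  by (rule integrable_ballm[of _ "(norm \<xi>)\<^sup>2"]) (auto simp: inner_power2_le)

text \<open>If the moment vanished, the mass of the ball would be carried by a hyperplane, which is
  a null set.\<close>

lemma bmom_pos: "bmom TYPE('n::finite) > 0"
proof -
  define e :: "real^'n" where "e = axis undefined 1"
  have "bmom TYPE('n) \<ge> 0" by (simp add: bmom_def)
  moreover have "bmom TYPE('n) \<noteq> 0"
  proof
    assume "bmom TYPE('n) = 0"
    then have "AE y in ballm. (e \<bullet> y)\<^sup>2 = 0"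
      using integrable_ballm_square[of e] by (subst integral_nonneg_eq_0_iff_AE[symmetric]) (auto simp: bmom_def e_def)
    then have AEz: "AE y in ballm. e \<bullet> y = 0" by simp
    have "{y. e \<bullet> y = 0} \<in> sets borel" by (intro borel_closed closed_hyperplane)
    have "emeasure ballm {y. e \<bullet> y = 0} = emeasure ballm (UNIV :: (real^'n) set)"
    proof (rule emeasure_eq_AE)
      show "AE y in ballm. (y \<in> {y. e \<bullet> y = 0}) = (y \<in> UNIV)" using AEz by eventually_elim simp
    qed (use \<open>{y. e \<bullet> y = 0} \<in> sets borel\<close> in auto)
    then have "emeasure ballm {y. e \<bullet> y = 0} = 1" by (simp add: emeasure_ballm_UNIV)
    moreover have "negligible {y. e \<bullet> y = 0}" by (rule negligible_hyperplane) (simp add: e_def axis_eq_0_iff)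
    then have "emeasure lborel {y. e \<bullet> y = 0} = 0"
      using \<open>{y. e \<bullet> y = 0} \<in> sets borel\<close> by (simp add: negligible_iff_null_sets null_sets_completion_iff null_sets_def)
    then have "emeasure lborel (ball 0 1 \<inter> {y. e \<bullet> y = 0}) = 0"
      using emeasure_mono[of "ball 0 1 \<inter> {y. e \<bullet> y = 0}" "{y. e \<bullet> y = 0}" lborel] \<open>{y. e \<bullet> y = 0} \<in> sets borel\<close> by simp
    then have "emeasure ballm {y. e \<bullet> y = 0} = 0"
      using \<open>{y. e \<bullet> y = 0} \<in> sets borel\<close> by (simp add: emeasure_ballm)
    ultimately show False by simp
  qed
  ultimately show ?thesis by simp
qed

text \<open>From \<open>\<bar>sin a\<bar> \<le> \<bar>a\<bar>\<close>. This quadratic smallness is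
  what absorbs the growth of the derivatives of Chebyshev polynomials in
  \<open>mul_bounds\<close>.\<close>

lemma abs_bgrad_le: "\<bar>bgrad (\<xi>::real^'n::finite)\<bar> \<le> bmom TYPE('n) * (norm \<xi>)\<^sup>2"
proof -
  have le: "\<bar>(\<xi> \<bullet> y) * sin (\<xi> \<bullet> y)\<bar> \<le> (\<xi> \<bullet> y)\<^sup>2" for y
    using mult_left_mono[OF abs_sin_x_le_abs_x[of "\<xi> \<bullet> y"], of "\<bar>\<xi> \<bullet> y\<bar>"] by (simp add: abs_mult power2_eq_square)
  have "integrable ballm (\<lambda>y. (\<xi> \<bullet> y) * sin (\<xi> \<bullet> y))"
    by (rule integrable_ballm[of _ "(norm \<xi>)\<^sup>2"]) (use order_trans[OF le inner_power2_le] in auto)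
  then have "norm (bgrad \<xi>) \<le> (LINT y|ballm. (\<xi> \<bullet> y)\<^sup>2)"
    unfolding bgrad_def by (intro order_trans[OF integral_norm_bound] integral_mono integrable_ballm_square) (auto simp: le)
  then show ?thesis by (simp add: integral_ballm_square)
qed

lemma sin_over_x_tendsto: "((\<lambda>x. sin x / x) \<longlongrightarrow> (1::real)) (at 0)"
  using DERIV_sin[of 0] by (simp add: DERIV_def)

text \<open>Dominated convergence with the limit itself as majorant, since \<open>a * sin a\<close>
  is at most the square of \<open>a\<close>.\<close>

lemma bgrad_tendsto:
  fixes \<xi> :: "real^'n::finite"
  assumes e: "\<epsilon> \<longlonglongrightarrow> 0" "\<And>k. \<epsilon> k \<noteq> (0::real)"
  shows "(\<lambda>k. bgrad (\<epsilon> k *\<^sub>R \<xi>) / (\<epsilon> k)\<^sup>2) \<longlonglongrightarrow> bmom TYPE('n) * (norm \<xi>)\<^sup>2"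
proof -
  have "(\<lambda>k. LINT y|ballm. ((\<epsilon> k *\<^sub>R \<xi>) \<bullet> y) * sin ((\<epsilon> k *\<^sub>R \<xi>) \<bullet> y) / (\<epsilon> k)\<^sup>2) \<longlonglongrightarrow> (LINT y|ballm. (\<xi> \<bullet> y)\<^sup>2)"
  proof (rule integral_dominated_convergence[where w = "\<lambda>y. (\<xi> \<bullet> y)\<^sup>2"])
    show "AE y in ballm. (\<lambda>k. ((\<epsilon> k *\<^sub>R \<xi>) \<bullet> y) * sin ((\<epsilon> k *\<^sub>R \<xi>) \<bullet> y) / (\<epsilon> k)\<^sup>2) \<longlonglongrightarrow> (\<xi> \<bullet> y)\<^sup>2"
    proof (rule AE_I2)
      fix y :: "real^'n"
      define a where "a = \<xi> \<bullet> y"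
      have "(\<lambda>k. a\<^sup>2 * (sin (\<epsilon> k * a) / (\<epsilon> k * a))) \<longlonglongrightarrow> a\<^sup>2 * 1" if "a \<noteq> 0"
      proof (intro tendsto_mult tendsto_const)
        have "filterlim (\<lambda>k. \<epsilon> k * a) (at 0) sequentially"
          using e that by (auto simp: filterlim_at intro: tendsto_mult_left_zero)
        then show "(\<lambda>k. sin (\<epsilon> k * a) / (\<epsilon> k * a)) \<longlonglongrightarrow> 1"
          by (rule filterlim_compose[OF sin_over_x_tendsto])
      qed
      moreover have "(\<lambda>k. ((\<epsilon> k *\<^sub>R \<xi>) \<bullet> y) * sin ((\<epsilon> k *\<^sub>R \<xi>) \<bullet> y) / (\<epsilon> k)\<^sup>2) = (\<lambda>k. a\<^sup>2 * (sin (\<epsilon> k * a) / (\<epsilon> k * a)))"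
        using e(2) by (auto simp: a_def power2_eq_square)
      ultimately show "(\<lambda>k. ((\<epsilon> k *\<^sub>R \<xi>) \<bullet> y) * sin ((\<epsilon> k *\<^sub>R \<xi>) \<bullet> y) / (\<epsilon> k)\<^sup>2) \<longlonglongrightarrow> (\<xi> \<bullet> y)\<^sup>2"
        by (cases "a = 0") (auto simp: a_def)
    qed
    show "AE y in ballm. norm (((\<epsilon> k *\<^sub>R \<xi>) \<bullet> y) * sin ((\<epsilon> k *\<^sub>R \<xi>) \<bullet> y) / (\<epsilon> k)\<^sup>2) \<le> (\<xi> \<bullet> y)\<^sup>2" for k
    proof (rule AE_I2)
      fix y :: "real^'n"
      define a where "a = \<epsilon> k * (\<xi> \<bullet> y)"
      have "\<bar>a * sin a\<bar> \<le> a\<^sup>2"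
        using mult_left_mono[OF abs_sin_x_le_abs_x[of a], of "\<bar>a\<bar>"] by (simp add: abs_mult power2_eq_square)
      then have "\<bar>a * sin a\<bar> / (\<epsilon> k)\<^sup>2 \<le> a\<^sup>2 / (\<epsilon> k)\<^sup>2" by (intro divide_right_mono) auto
      also have "a\<^sup>2 / (\<epsilon> k)\<^sup>2 = (\<xi> \<bullet> y)\<^sup>2" using e(2) by (simp add: a_def power_mult_distrib)
      finally show "norm (((\<epsilon> k *\<^sub>R \<xi>) \<bullet> y) * sin ((\<epsilon> k *\<^sub>R \<xi>) \<bullet> y) / (\<epsilon> k)\<^sup>2) \<le> (\<xi> \<bullet> y)\<^sup>2"
        by (simp add: a_def abs_divide)
    qed
  qed (auto intro: integrable_ballm_square)
  then show ?thesis by (simp add: bgrad_def integral_ballm_square)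
qed

lemma bmul_tendsto:
  fixes \<xi> :: "real^'n::finite"
  assumes e: "\<epsilon> \<longlonglongrightarrow> 0" "\<And>k. \<epsilon> k \<noteq> (0::real)"
  shows "(\<lambda>k. (1 - bmul (\<epsilon> k *\<^sub>R \<xi>)) / (\<epsilon> k)\<^sup>2) \<longlonglongrightarrow> bmom TYPE('n) * (norm \<xi>)\<^sup>2 / 2"
proof -
  \<comment> \<open>The half-angle form turns \<open>1 - cos\<close> into the square of a sine, to
    which both the limit of \<open>sin x / x\<close> and the bound by \<open>\<bar>x\<bar>\<close>
    apply.\<close>
  have cos: "1 - cos a = 2 * (sin (a / 2))\<^sup>2" for a :: real
    using cos_double_sin[of "a / 2"] by simp
  have lim: "(\<lambda>k. LINT y|ballm. (1 - cos ((\<epsilon> k *\<^sub>R \<xi>) \<bullet> y)) / (\<epsilon> k)\<^sup>2) \<longlonglongrightarrow> (LINT y|ballm. (\<xi> \<bullet> y)\<^sup>2 / 2)"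
  proof (rule integral_dominated_convergence[where w = "\<lambda>y. (\<xi> \<bullet> y)\<^sup>2 / 2"])
    show "AE y in ballm. (\<lambda>k. (1 - cos ((\<epsilon> k *\<^sub>R \<xi>) \<bullet> y)) / (\<epsilon> k)\<^sup>2) \<longlonglongrightarrow> (\<xi> \<bullet> y)\<^sup>2 / 2"
    proof (rule AE_I2)
      fix y :: "real^'n"
      define a where "a = \<xi> \<bullet> y"
      have "(\<lambda>k. a\<^sup>2 / 2 * (sin (\<epsilon> k * a / 2) / (\<epsilon> k * a / 2))\<^sup>2) \<longlonglongrightarrow> a\<^sup>2 / 2 * 1\<^sup>2" if "a \<noteq> 0"
      proof (intro tendsto_mult tendsto_const tendsto_power)
        have "filterlim (\<lambda>k. \<epsilon> k * a / 2) (at 0) sequentially"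
          using e that by (auto simp: filterlim_at intro: tendsto_mult_left_zero tendsto_divide_zero)
        then show "(\<lambda>k. sin (\<epsilon> k * a / 2) / (\<epsilon> k * a / 2)) \<longlonglongrightarrow> 1"
          by (rule filterlim_compose[OF sin_over_x_tendsto])
      qed
      moreover have "(1 - cos ((\<epsilon> k *\<^sub>R \<xi>) \<bullet> y)) / (\<epsilon> k)\<^sup>2 = a\<^sup>2 / 2 * (sin (\<epsilon> k * a / 2) / (\<epsilon> k * a / 2))\<^sup>2" if "a \<noteq> 0" for k
        unfolding cos using e(2) that by (simp add: a_def power2_eq_square)
      ultimately have "a \<noteq> 0 \<Longrightarrow> (\<lambda>k. (1 - cos ((\<epsilon> k *\<^sub>R \<xi>) \<bullet> y)) / (\<epsilon> k)\<^sup>2) \<longlonglongrightarrow> a\<^sup>2 / 2 * 1\<^sup>2" by presburger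
      then show "(\<lambda>k. (1 - cos ((\<epsilon> k *\<^sub>R \<xi>) \<bullet> y)) / (\<epsilon> k)\<^sup>2) \<longlonglongrightarrow> (\<xi> \<bullet> y)\<^sup>2 / 2"
        by (cases "a = 0") (auto simp: a_def)
    qed
    show "AE y in ballm. norm ((1 - cos ((\<epsilon> k *\<^sub>R \<xi>) \<bullet> y)) / (\<epsilon> k)\<^sup>2) \<le> (\<xi> \<bullet> y)\<^sup>2 / 2" for k
    proof (rule AE_I2)
      fix y :: "real^'n"
      define a where "a = \<epsilon> k * (\<xi> \<bullet> y)"
      have "\<bar>sin (a / 2)\<bar> \<le> \<bar>a / 2\<bar>" by (rule abs_sin_x_le_abs_x)
      then have "(sin (a / 2))\<^sup>2 \<le> (a / 2)\<^sup>2" by (simp only: abs_le_square_iff)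
      then have "1 - cos a \<le> a\<^sup>2 / 2" unfolding cos by (simp add: power_divide)
      then have "(1 - cos a) / (\<epsilon> k)\<^sup>2 \<le> a\<^sup>2 / 2 / (\<epsilon> k)\<^sup>2" by (intro divide_right_mono) auto
      also have "a\<^sup>2 / 2 / (\<epsilon> k)\<^sup>2 = (\<xi> \<bullet> y)\<^sup>2 / 2" using e(2) by (simp add: a_def power_mult_distrib)
      finally show "norm ((1 - cos ((\<epsilon> k *\<^sub>R \<xi>) \<bullet> y)) / (\<epsilon> k)\<^sup>2) \<le> (\<xi> \<bullet> y)\<^sup>2 / 2"
        by (simp add: a_def abs_divide)
    qed
  qed (auto intro: integrable_ballm_square)
  have eq: "(LINT y|ballm. (1 - cos (\<eta> \<bullet> y)) / c) = (1 - bmul \<eta>) / c" for \<eta> :: "real^'n" and c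
  proof -
    have "(LINT y|ballm. (1 - cos (\<eta> \<bullet> y))) = (LINT (y::real^'n)|ballm. 1) - (LINT y|ballm. cos (\<eta> \<bullet> y))"
      by (intro Bochner_Integration.integral_diff integrable_ballm[of _ 1]) auto
    then show ?thesis by (simp add: bmul_def)
  qed
  show ?thesis using lim unfolding eq by (simp add: integral_ballm_square)
qed

text \<open>Horner's scheme: \<open>pCons a p\<close> multiplies \<open>u\<close> by
  \<open>a\<close> and adds one more average of what \<open>p\<close> has produced, so polynomials
  in the averaging operator never leave the radial test functions.\<close>

lemma rt_poly:
  assumes "u \<in> radial_test_functions"
  shows "\<exists>v\<in>radial_test_functions. \<forall>\<xi>. fourier v \<xi> = of_real (poly p (bmul (\<epsilon> *\<^sub>R \<xi>))) * fourier u \<xi>"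
proof (induction p)
  case 0
  show ?case using rt_cmult[OF assms, of 0] fourier_cmult[of 0 u] by (intro bexI[of _ "\<lambda>x. 0 * u x"]) auto
next
  case (pCons a p)
  then obtain v where v: "v \<in> radial_test_functions" "\<And>\<xi>. fourier v \<xi> = of_real (poly p (bmul (\<epsilon> *\<^sub>R \<xi>))) * fourier u \<xi>" by blast
  have s: "smooth u" "csupp u" "smooth v" "csupp v" using v assms by (auto simp: radial_test_functions_iff)
  show ?case
  proof (intro bexI[of _ "\<lambda>x. of_real a * u x + avg \<epsilon> v x"] allI)
    show "(\<lambda>x. of_real a * u x + avg \<epsilon> v x) \<in> radial_test_functions" by (intro rt_add rt_cmult rt_avg v assms)
    show "fourier (\<lambda>x. of_real a * u x + avg \<epsilon> v x) \<xi> = of_real (poly (pCons a p) (bmul (\<epsilon> *\<^sub>R \<xi>))) * fourier u \<xi>" for \<xi>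
      using s by (simp add: fourier_add fourier_cmult smooth_mult smooth_const csupp_mult smooth_avg csupp_avg fourier_avg v(2) ring_distribs)
  qed
qed

text \<open>Product rule along \<open>exp \<sigma> *\<^sub>R \<xi>\<close>; the terms with the
  dimension cancel. The last summand is the commutator of \<Lambda> with the multiplier.\<close>

lemma fourier_Lam_poly:
  assumes u: "smooth u" "csupp u" and v: "smooth v" "csupp v"
    and eq: "\<And>\<xi>. fourier v \<xi> = of_real (poly p (bmul (\<epsilon> *\<^sub>R \<xi>))) * fourier u \<xi>"
  shows "fourier (Lam v) \<xi> = of_real (poly p (bmul (\<epsilon> *\<^sub>R \<xi>))) * fourier (Lam u) \<xi>
     + of_real (poly (pderiv p) (bmul (\<epsilon> *\<^sub>R \<xi>)) * bgrad (\<epsilon> *\<^sub>R \<xi>)) * fourier u \<xi>"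
proof -
  let ?n = "of_nat CARD('a) :: complex"
  have "((\<lambda>\<sigma>. bmul (exp \<sigma> *\<^sub>R (\<epsilon> *\<^sub>R \<xi>))) has_real_derivative - bgrad (\<epsilon> *\<^sub>R \<xi>)) (at 0)"
    using bmul_exp_ray[of "\<epsilon> *\<^sub>R \<xi>" 0] by simp
  from DERIV_chain2[OF poly_DERIV[of p] this]
  have "((\<lambda>\<sigma>. poly p (bmul (exp \<sigma> *\<^sub>R (\<epsilon> *\<^sub>R \<xi>)))) has_real_derivative poly (pderiv p) (bmul (\<epsilon> *\<^sub>R \<xi>)) * - bgrad (\<epsilon> *\<^sub>R \<xi>)) (at 0)"
    by simp
  then have "((\<lambda>\<sigma>. complex_of_real (poly p (bmul (exp \<sigma> *\<^sub>R (\<epsilon> *\<^sub>R \<xi>))))) has_vector_derivative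
      of_real (poly (pderiv p) (bmul (\<epsilon> *\<^sub>R \<xi>)) * - bgrad (\<epsilon> *\<^sub>R \<xi>))) (at 0)"
    by (intro has_vector_derivative_of_real) (simp add: has_real_derivative_iff_has_vector_derivative)
  from has_vector_derivative_mult[OF this fourier_exp_ray[OF u, of \<xi> 0]]
  have "((\<lambda>\<sigma>. of_real (poly p (bmul (exp \<sigma> *\<^sub>R (\<epsilon> *\<^sub>R \<xi>)))) * fourier u (exp \<sigma> *\<^sub>R \<xi>)) has_vector_derivative
      of_real (poly p (bmul (\<epsilon> *\<^sub>R \<xi>))) * (- fourier (Lam u) \<xi> - ?n * fourier u \<xi>)
      + of_real (poly (pderiv p) (bmul (\<epsilon> *\<^sub>R \<xi>)) * - bgrad (\<epsilon> *\<^sub>R \<xi>)) * fourier u \<xi>) (at 0)"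
    by simp
  moreover have "(\<lambda>\<sigma>. of_real (poly p (bmul (exp \<sigma> *\<^sub>R (\<epsilon> *\<^sub>R \<xi>)))) * fourier u (exp \<sigma> *\<^sub>R \<xi>)) = (\<lambda>\<sigma>. fourier v (exp \<sigma> *\<^sub>R \<xi>))"
    by (simp add: eq mult.commute)
  ultimately have "of_real (poly p (bmul (\<epsilon> *\<^sub>R \<xi>))) * (- fourier (Lam u) \<xi> - ?n * fourier u \<xi>)
      + of_real (poly (pderiv p) (bmul (\<epsilon> *\<^sub>R \<xi>)) * - bgrad (\<epsilon> *\<^sub>R \<xi>)) * fourier u \<xi> = - fourier (Lam v) \<xi> - ?n * fourier v \<xi>"
    using fourier_exp_ray[OF v, of \<xi> 0] vector_derivative_unique_at by fastforce
  then show ?thesis unfolding eq by (simp add: algebra_simps)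
qed

section \<open>Chebyshev polynomials\<close>

text \<open>\<open>chebV n\<close> is the polynomial of the second kind \<open>U\<^bsub>n-1\<^esub>\<close>.\<close>

fun chebT :: "nat \<Rightarrow> real poly" where
  "chebT 0 = 1"
| "chebT (Suc 0) = [:0, 1:]"
| "chebT (Suc (Suc n)) = [:0, 2:] * chebT (Suc n) - chebT n"

fun chebV :: "nat \<Rightarrow> real poly" where
  "chebV 0 = 0"
| "chebV (Suc 0) = 1"
| "chebV (Suc (Suc n)) = [:0, 2:] * chebV (Suc n) - chebV n"

lemma chebT_cos: "poly (chebT n) (cos \<theta>) = cos (real n * \<theta>)"
proof (induction n rule: chebT.induct)
  case (3 n)
  have "real (Suc (Suc n)) * \<theta> = real (Suc n) * \<theta> + \<theta>" "real n * \<theta> = real (Suc n) * \<theta> - \<theta>" by (simp_all add: algebra_simps)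
  with 3 show ?case by (simp only: chebT.simps poly_diff poly_mult cos_add cos_diff) simp
qed auto

lemma chebV_sin: "poly (chebV n) (cos \<theta>) * sin \<theta> = sin (real n * \<theta>)"
proof (induction n rule: chebV.induct)
  case (3 n)
  have *: "real (Suc (Suc n)) * \<theta> = real (Suc n) * \<theta> + \<theta>" "real n * \<theta> = real (Suc n) * \<theta> - \<theta>" by (simp_all add: algebra_simps)
  have "poly (chebV (Suc (Suc n))) (cos \<theta>) * sin \<theta> = 2 * cos \<theta> * (poly (chebV (Suc n)) (cos \<theta>) * sin \<theta>) - poly (chebV n) (cos \<theta>) * sin \<theta>"
    by (simp add: algebra_simps)
  also have "\<dots> = sin (real (Suc (Suc n)) * \<theta>)" unfolding 3 * by (simp add: sin_add sin_diff)
  finally show ?case .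
qed auto

text \<open>The identity U(n+1) = U(n-1) + 2 T(n+1). In contrast to the defining recurrence it only
  adds terms that are bounded on \<open>[-1, 1]\<close>, so inductive estimates grow
  polynomially.\<close>

lemma chebV_rec: "chebV (Suc (Suc n)) = chebV n + smult 2 (chebT (Suc n))"
proof (induction n rule: chebT.induct)
  case (3 n)
  have "chebV (Suc (Suc (Suc (Suc n)))) = [:0, 2:] * chebV (Suc (Suc (Suc n))) - chebV (Suc (Suc n))" by simp
  also have "\<dots> = [:0, 2:] * (chebV (Suc n) + smult 2 (chebT (Suc (Suc n)))) - (chebV n + smult 2 (chebT (Suc n)))"
    by (simp only: 3)
  also have "\<dots> = chebV (Suc (Suc n)) + smult 2 (chebT (Suc (Suc (Suc n))))"
    by (simp add: algebra_simps smult_diff_right smult_add_right)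
  finally show ?case .
qed (simp_all add: one_pCons)

lemma pderiv_chebT: "pderiv (chebT n) = smult (real n) (chebV n)"
proof (induction n rule: chebT.induct)
  case (3 n)
  have "pderiv (chebT (Suc (Suc n))) = smult 2 (chebT (Suc n)) + smult (real (Suc n)) ([:0, 2:] * chebV (Suc n)) - smult (real n) (chebV n)"
    using 3 by (simp add: pderiv_mult pderiv_diff pderiv_pCons pderiv_smult algebra_simps)
  also have "[:0, 2:] * chebV (Suc n) = chebV (Suc (Suc n)) + chebV n" by simp
  also have "smult 2 (chebT (Suc n)) = chebV (Suc (Suc n)) - chebV n" by (simp only: chebV_rec add_diff_cancel_left')
  finally have eq: "pderiv (chebT (Suc (Suc n))) = chebV (Suc (Suc n)) - chebV n
      + smult (real (Suc n)) (chebV (Suc (Suc n)) + chebV n) - smult (real n) (chebV n)" .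
  have "poly (pderiv (chebT (Suc (Suc n)))) x = poly (smult (real (Suc (Suc n))) (chebV (Suc (Suc n)))) x" for x
    unfolding eq by (simp add: algebra_simps del: chebT.simps chebV.simps)
  then show ?case by (subst poly_eq_poly_eq_iff[symmetric]) (rule ext)
qed (simp_all add: pderiv_pCons one_pCons)

lemma abs_chebT_le: "\<bar>x\<bar> \<le> 1 \<Longrightarrow> \<bar>poly (chebT n) x\<bar> \<le> 1"
  using chebT_cos[of n "arccos x"] by (simp add: abs_le_iff)

lemma abs_chebV_le: "\<bar>x\<bar> \<le> 1 \<Longrightarrow> \<bar>poly (chebV n) x\<bar> \<le> real n"
proof (induction n rule: chebV.induct)
  case (3 n)
  have "poly (chebV (Suc (Suc n))) x = poly (chebV n) x + 2 * poly (chebT (Suc n)) x" by (simp only: chebV_rec poly_add poly_smult)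
  with 3(2)[OF 3(3)] abs_chebT_le[OF 3(3), of "Suc n"] show ?case by linarith
qed auto

text \<open>By \<open>chebV_rec\<close> the derivative increases, in steps of two in the index, by
  at most \<open>2 (n + 1)^2\<close>. Of the three powers in the bound, one is cancelled by the
  factor in \<open>mulV\<close> and two by \<open>bgrad\<close>.\<close>

lemma abs_pderiv_chebV_le: "\<bar>x\<bar> \<le> 1 \<Longrightarrow> \<bar>poly (pderiv (chebV n)) x\<bar> \<le> real n ^ 3"
proof (induction n rule: chebV.induct)
  case (3 n)
  have "poly (pderiv (chebV (Suc (Suc n)))) x = poly (pderiv (chebV n)) x + 2 * (real (Suc n) * poly (chebV (Suc n)) x)"
    by (simp only: chebV_rec pderiv_add pderiv_smult pderiv_chebT poly_add poly_smult)
  moreover have "\<bar>real (Suc n) * poly (chebV (Suc n)) x\<bar> \<le> real (Suc n) * real (Suc n)"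
    unfolding abs_mult using abs_chebV_le[OF 3(3), of "Suc n"] by (intro mult_mono) auto
  ultimately have "\<bar>poly (pderiv (chebV (Suc (Suc n)))) x\<bar> \<le> real n ^ 3 + 2 * (real (Suc n) * real (Suc n))"
    using 3(2)[OF 3(3)] by linarith
  also have "\<dots> \<le> real (Suc (Suc n)) ^ 3" by (simp add: power3_eq_cube algebra_simps)
  finally show ?case .
qed auto

text \<open>Differentiate \<open>chebV_sin\<close> in the angle and solve for the derivative of the
  polynomial.\<close>

lemma pderiv_chebV_cos:
  assumes "sin \<theta> \<noteq> 0"
  shows "poly (pderiv (chebV n)) (cos \<theta>)
     = (sin (real n * \<theta>) * cos \<theta> / sin \<theta> - real n * cos (real n * \<theta>)) / (sin \<theta>)\<^sup>2"
proof -
  have "((\<lambda>\<theta>. poly (chebV n) (cos \<theta>) * sin \<theta>) has_real_derivative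
     poly (chebV n) (cos \<theta>) * cos \<theta> + poly (pderiv (chebV n)) (cos \<theta>) * (- sin \<theta>) * sin \<theta>) (at \<theta>)"
    by (auto intro!: derivative_eq_intros DERIV_chain2[OF poly_DERIV])
  moreover have "((\<lambda>\<theta>. sin (real n * \<theta>)) has_real_derivative real n * cos (real n * \<theta>)) (at \<theta>)"
    by (auto intro!: derivative_eq_intros)
  ultimately have "poly (chebV n) (cos \<theta>) * cos \<theta> + poly (pderiv (chebV n)) (cos \<theta>) * (- sin \<theta>) * sin \<theta> = real n * cos (real n * \<theta>)"
    unfolding chebV_sin using DERIV_unique by blast
  moreover have "poly (chebV n) (cos \<theta>) = sin (real n * \<theta>) / sin \<theta>" using chebV_sin[of n \<theta>] assms by (simp add: field_simps)
  ultimately show ?thesis using assms by (simp add: field_simps power2_eq_square)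
qed

section \<open>Chebyshev approximation of the wave multipliers\<close>

text \<open>As \<open>1 - bmul (\<epsilon> \<xi>)\<close> is asymptotically \<open>bmom \<epsilon>\<^sup>2 |\<xi>|\<^sup>2 / 2\<close>, the angle \<open>arccos (bmul (\<epsilon> \<xi>))\<close>
  is about \<open>sqrt bmom \<epsilon> |\<xi>|\<close>; with this step, \<open>Suc k\<close> such angles add up to \<open>t |\<xi>|\<close> in the limit.\<close>

definition step :: "'n::finite itself \<Rightarrow> real \<Rightarrow> nat \<Rightarrow> real" where
  "step T t k = t / (real (Suc k) * sqrt (bmom T))"

definition mulT :: "nat \<Rightarrow> real poly" where
  "mulT k = chebT (Suc k)"

definition mulV :: "real \<Rightarrow> nat \<Rightarrow> real poly" where
  "mulV t k = smult (t / real (Suc k)) (chebV (Suc k))"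

text \<open>With \<open>x = cos \<theta>\<close>, everything is expressed through
  \<open>K \<theta>\<close>, \<open>K sin \<theta>\<close> and \<open>K^2 e\<close>, which tend to
  \<open>t \<rho>\<close>, \<open>t \<rho>\<close> and \<open>(t \<rho>)^2\<close>. The last two
  limits are minus the derivatives of the first two in \<open>log \<rho>\<close>.\<close>

lemma mul_limits:
  fixes \<xi> :: "real^'n::finite"
  assumes t: "0 < t" and \<xi>: "\<xi> \<noteq> 0"
  defines "\<epsilon> \<equiv> step TYPE('n) t" and "\<rho> \<equiv> norm \<xi>"
  shows "(\<lambda>k. poly (mulT k) (bmul (\<epsilon> k *\<^sub>R \<xi>))) \<longlonglongrightarrow> cos (t * \<rho>)"
    and "(\<lambda>k. poly (mulV t k) (bmul (\<epsilon> k *\<^sub>R \<xi>))) \<longlonglongrightarrow> sin (t * \<rho>) / \<rho>"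
    and "(\<lambda>k. poly (pderiv (mulT k)) (bmul (\<epsilon> k *\<^sub>R \<xi>)) * bgrad (\<epsilon> k *\<^sub>R \<xi>)) \<longlonglongrightarrow> t * \<rho> * sin (t * \<rho>)"
    and "(\<lambda>k. poly (pderiv (mulV t k)) (bmul (\<epsilon> k *\<^sub>R \<xi>)) * bgrad (\<epsilon> k *\<^sub>R \<xi>)) \<longlonglongrightarrow> sin (t * \<rho>) / \<rho> - t * cos (t * \<rho>)"
proof -
  define m where "m = bmom TYPE('n)"
  define K where "K k = real (Suc k)" for k
  define x where "x k = bmul (\<epsilon> k *\<^sub>R \<xi>)" for k
  define e where "e k = bgrad (\<epsilon> k *\<^sub>R \<xi>)" for k
  define \<theta> where "\<theta> k = arccos (x k)" for k
  have m: "0 < m" unfolding m_def by (rule bmom_pos)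
  have \<rho>: "0 < \<rho>" using \<xi> by (simp add: \<rho>_def)
  have K: "0 < K k" for k by (simp add: K_def)
  have KS: "1 + real k = K k" for k by (simp add: K_def)
  have \<epsilon>: "\<epsilon> k = t / (K k * sqrt m)" for k by (simp add: \<epsilon>_def step_def K_def m_def)
  have \<epsilon>0: "\<epsilon> k \<noteq> 0" for k using t m K[of k] by (simp add: \<epsilon>)
  \<comment> \<open>By the choice of the step, a division by \<open>(\<epsilon> k)^2\<close> amounts
    to a multiplication by \<open>(K k)^2\<close>, up to a constant.\<close>
  have \<epsilon>K: "(\<epsilon> k)\<^sup>2 * (K k)\<^sup>2 = t\<^sup>2 / m" for k using m K[of k] by (simp add: \<epsilon> power_divide power_mult_distrib)
  have "(\<lambda>k. inverse (K k)) \<longlonglongrightarrow> 0" unfolding K_def by (rule LIMSEQ_inverse_real_of_nat)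
  from tendsto_mult_left_zero[OF this, of "t / sqrt m"] have \<epsilon>lim: "\<epsilon> \<longlonglongrightarrow> 0"
    unfolding \<epsilon>[abs_def] by (simp add: divide_inverse mult_ac)
  have "(\<lambda>k. e k / (\<epsilon> k)\<^sup>2 * (t\<^sup>2 / m)) \<longlonglongrightarrow> m * \<rho>\<^sup>2 * (t\<^sup>2 / m)"
    unfolding e_def m_def \<rho>_def by (intro tendsto_mult tendsto_const bgrad_tendsto \<epsilon>lim \<epsilon>0)
  moreover have "e k / (\<epsilon> k)\<^sup>2 * (t\<^sup>2 / m) = (K k)\<^sup>2 * e k" for k
    using \<epsilon>0[of k] by (simp add: \<epsilon>K[of k, symmetric])
  ultimately have eK: "(\<lambda>k. (K k)\<^sup>2 * e k) \<longlonglongrightarrow> (t * \<rho>)\<^sup>2" using m by (simp add: power_mult_distrib mult.commute)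
  have "(\<lambda>k. (1 - x k) / (\<epsilon> k)\<^sup>2 * (t\<^sup>2 / m)) \<longlonglongrightarrow> m * \<rho>\<^sup>2 / 2 * (t\<^sup>2 / m)"
    unfolding x_def m_def \<rho>_def by (intro tendsto_mult tendsto_const bmul_tendsto \<epsilon>lim \<epsilon>0)
  moreover have "(1 - x k) / (\<epsilon> k)\<^sup>2 * (t\<^sup>2 / m) = (K k)\<^sup>2 * (1 - x k)" for k
    using \<epsilon>0[of k] by (simp add: \<epsilon>K[of k, symmetric])
  ultimately have xK: "(\<lambda>k. (K k)\<^sup>2 * (1 - x k)) \<longlonglongrightarrow> (t * \<rho>)\<^sup>2 / 2" using m by (simp add: power_mult_distrib mult.commute)
  have "(\<lambda>k. (1 - x k) / (\<epsilon> k)\<^sup>2 * (\<epsilon> k)\<^sup>2) \<longlonglongrightarrow> m * \<rho>\<^sup>2 / 2 * 0\<^sup>2"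
    unfolding x_def m_def \<rho>_def by (intro tendsto_mult tendsto_power bmul_tendsto \<epsilon>lim \<epsilon>0)
  then have "(\<lambda>k. 1 - x k) \<longlonglongrightarrow> 0" using \<epsilon>0 by simp
  from tendsto_diff[OF tendsto_const[of 1] this] have x1: "x \<longlonglongrightarrow> 1" by simp
  have xb: "\<bar>x k\<bar> \<le> 1" for k unfolding x_def by (rule abs_bmul_le)
  have cos\<theta>: "cos (\<theta> k) = x k" for k using xb[of k] by (simp add: \<theta>_def abs_le_iff cos_arccos)
  have \<theta>ge: "0 \<le> \<theta> k" for k using xb[of k] by (simp add: \<theta>_def abs_le_iff arccos_lbound)
  have "(\<lambda>k. arccos (x k)) \<longlonglongrightarrow> arccos 1"
    by (rule continuous_on_tendsto_compose[OF continuous_on_arccos' x1]) (use xb in \<open>auto simp: abs_le_iff minus_le_iff\<close>)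
  then have \<theta>0: "\<theta> \<longlonglongrightarrow> 0" by (simp add: \<theta>_def[abs_def])
  have "\<forall>\<^sub>F k in sequentially. 0 < (K k)\<^sup>2 * (1 - x k)"
    using order_tendstoD(1)[OF xK, of 0] t \<rho> by simp
  \<comment> \<open>The limit of \<open>K^2 (1 - x)\<close> is positive, so \<open>x\<close>
    eventually differs from 1 and dividing by \<open>\<theta>\<close> is legitimate.\<close>
  then have \<theta>ne: "\<forall>\<^sub>F k in sequentially. \<theta> k \<noteq> 0"
  proof eventually_elim
    fix k assume "0 < (K k)\<^sup>2 * (1 - x k)"
    then have "x k \<noteq> 1" by auto
    then show "\<theta> k \<noteq> 0" using cos\<theta>[of k] by auto
  qed
  have sinc: "(\<lambda>k. sin (\<theta> k / c) / (\<theta> k / c)) \<longlonglongrightarrow> 1" if "c \<noteq> 0" for c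
  proof (rule filterlim_compose[OF sin_over_x_tendsto])
    show "filterlim (\<lambda>k. \<theta> k / c) (at 0) sequentially"
      using \<theta>ne that tendsto_divide_zero[OF \<theta>0, of c] by (auto simp: filterlim_at elim: eventually_mono)
  qed
  \<comment> \<open>\<open>K^2 (1 - x)\<close> is half of \<open>(K \<theta>)^2\<close> times the
    square of a factor \<open>sin y / y\<close> that tends to 1; dividing by that square isolates
    \<open>K \<theta>\<close>.\<close>
  have "(\<lambda>k. (K k)\<^sup>2 * (1 - x k) * 2 / (sin (\<theta> k / 2) / (\<theta> k / 2))\<^sup>2) \<longlonglongrightarrow> (t * \<rho>)\<^sup>2 / 2 * 2 / 1\<^sup>2"
    by (intro tendsto_divide tendsto_mult tendsto_power tendsto_const xK sinc) auto
  then have "(\<lambda>k. (K k * \<theta> k)\<^sup>2) \<longlonglongrightarrow> (t * \<rho>)\<^sup>2 / 2 * 2 / 1\<^sup>2"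
  proof (rule Lim_transform_eventually)
    have "\<forall>\<^sub>F k in sequentially. 0 < sin (\<theta> k / 2) / (\<theta> k / 2)"
      using order_tendstoD(1)[OF sinc[of 2], of 0] by simp
    with \<theta>ne show "\<forall>\<^sub>F k in sequentially. (K k)\<^sup>2 * (1 - x k) * 2 / (sin (\<theta> k / 2) / (\<theta> k / 2))\<^sup>2 = (K k * \<theta> k)\<^sup>2"
    proof eventually_elim
      case (elim k)
      have "1 - x k = 2 * (sin (\<theta> k / 2))\<^sup>2" using cos_double_sin[of "\<theta> k / 2"] cos\<theta>[of k] by simp
      moreover have "sin (\<theta> k / 2) \<noteq> 0" using elim by auto
      ultimately show ?case using elim by (simp add: power_divide power_mult_distrib)
    qed
  qed
  then have "(\<lambda>k. sqrt ((K k * \<theta> k)\<^sup>2)) \<longlonglongrightarrow> sqrt ((t * \<rho>)\<^sup>2)" by (intro tendsto_real_sqrt) simp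
  moreover have "sqrt ((K k * \<theta> k)\<^sup>2) = K k * \<theta> k" for k using K[of k] \<theta>ge[of k] by simp
  ultimately have K\<theta>: "(\<lambda>k. K k * \<theta> k) \<longlonglongrightarrow> t * \<rho>" using t \<rho> by simp
  have "(\<lambda>k. K k * \<theta> k * (sin (\<theta> k / 1) / (\<theta> k / 1))) \<longlonglongrightarrow> t * \<rho> * 1"
    by (intro tendsto_mult K\<theta> sinc) simp
  then have "(\<lambda>k. K k * sin (\<theta> k)) \<longlonglongrightarrow> t * \<rho> * 1"
    by (rule Lim_transform_eventually) (use \<theta>ne in \<open>auto elim!: eventually_mono\<close>)
  then have Ks: "(\<lambda>k. K k * sin (\<theta> k)) \<longlonglongrightarrow> t * \<rho>" by simp
  have "\<forall>\<^sub>F k in sequentially. 0 < K k * sin (\<theta> k)"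
    using order_tendstoD(1)[OF Ks, of 0] t \<rho> by simp
  then have sne: "\<forall>\<^sub>F k in sequentially. sin (\<theta> k) \<noteq> 0" by eventually_elim auto
  have tr: "t * \<rho> \<noteq> 0" using t \<rho> by simp
  have T: "poly (mulT k) (x k) = cos (K k * \<theta> k)" for k
    unfolding mulT_def cos\<theta>[symmetric] chebT_cos K_def ..
  have V: "poly (chebV (Suc k)) (x k) = sin (K k * \<theta> k) / sin (\<theta> k)" if "sin (\<theta> k) \<noteq> 0" for k
    using chebV_sin[of "Suc k" "\<theta> k"] that by (simp add: cos\<theta> K_def field_simps)
  show "(\<lambda>k. poly (mulT k) (bmul (\<epsilon> k *\<^sub>R \<xi>))) \<longlonglongrightarrow> cos (t * \<rho>)"
    unfolding x_def[symmetric] T by (intro tendsto_cos K\<theta>)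
  have "(\<lambda>k. t * sin (K k * \<theta> k) / (K k * sin (\<theta> k))) \<longlonglongrightarrow> t * sin (t * \<rho>) / (t * \<rho>)"
    by (intro tendsto_intros K\<theta> Ks tr)
  then have "(\<lambda>k. poly (mulV t k) (x k)) \<longlonglongrightarrow> t * sin (t * \<rho>) / (t * \<rho>)"
    by (rule Lim_transform_eventually)
       (use sne in \<open>eventually_elim, simp add: mulV_def V, simp add: K_def\<close>)
  then show "(\<lambda>k. poly (mulV t k) (bmul (\<epsilon> k *\<^sub>R \<xi>))) \<longlonglongrightarrow> sin (t * \<rho>) / \<rho>"
    using t by (simp add: x_def)
  have "(\<lambda>k. sin (K k * \<theta> k) * ((K k)\<^sup>2 * e k) / (K k * sin (\<theta> k))) \<longlonglongrightarrow> sin (t * \<rho>) * (t * \<rho>)\<^sup>2 / (t * \<rho>)"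
    by (intro tendsto_intros K\<theta> Ks tr eK)
  then have "(\<lambda>k. poly (pderiv (mulT k)) (x k) * e k) \<longlonglongrightarrow> sin (t * \<rho>) * (t * \<rho>)\<^sup>2 / (t * \<rho>)"
  proof (rule Lim_transform_eventually)
    show "\<forall>\<^sub>F k in sequentially. sin (K k * \<theta> k) * ((K k)\<^sup>2 * e k) / (K k * sin (\<theta> k)) = poly (pderiv (mulT k)) (x k) * e k"
      using sne
    proof eventually_elim
      case (elim k)
      then show ?case using K[of k] by (simp add: mulT_def pderiv_chebT V KS power2_eq_square)
    qed
  qed
  then show "(\<lambda>k. poly (pderiv (mulT k)) (bmul (\<epsilon> k *\<^sub>R \<xi>)) * bgrad (\<epsilon> k *\<^sub>R \<xi>)) \<longlonglongrightarrow> t * \<rho> * sin (t * \<rho>)"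
    using tr by (simp add: x_def e_def power2_eq_square mult_ac)
  \<comment> \<open>The formula of \<open>pderiv_chebV_cos\<close>, expanded by powers of
    \<open>K\<close> so that only convergent quantities remain.\<close>
  have "(\<lambda>k. t * (sin (K k * \<theta> k) * cos (\<theta> k) / (K k * sin (\<theta> k)) - cos (K k * \<theta> k)) * ((K k)\<^sup>2 * e k) / (K k * sin (\<theta> k))\<^sup>2)
      \<longlonglongrightarrow> t * (sin (t * \<rho>) * cos 0 / (t * \<rho>) - cos (t * \<rho>)) * (t * \<rho>)\<^sup>2 / (t * \<rho>)\<^sup>2"
    by (intro tendsto_intros K\<theta> Ks tr eK \<theta>0) (use tr in simp)
  then have "(\<lambda>k. poly (pderiv (mulV t k)) (x k) * e k)
      \<longlonglongrightarrow> t * (sin (t * \<rho>) * cos 0 / (t * \<rho>) - cos (t * \<rho>)) * (t * \<rho>)\<^sup>2 / (t * \<rho>)\<^sup>2"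
  proof (rule Lim_transform_eventually)
    show "\<forall>\<^sub>F k in sequentially. t * (sin (K k * \<theta> k) * cos (\<theta> k) / (K k * sin (\<theta> k)) - cos (K k * \<theta> k)) * ((K k)\<^sup>2 * e k) / (K k * sin (\<theta> k))\<^sup>2
       = poly (pderiv (mulV t k)) (x k) * e k"
      using sne
    proof eventually_elim
      case (elim k)
      have "poly (pderiv (chebV (Suc k))) (x k) = (sin (K k * \<theta> k) * cos (\<theta> k) / sin (\<theta> k) - K k * cos (K k * \<theta> k)) / (sin (\<theta> k))\<^sup>2"
        using pderiv_chebV_cos[OF elim, of "Suc k"] by (simp add: cos\<theta> K_def)
      then have "poly (pderiv (mulV t k)) (x k) * e k
          = t / K k * ((sin (K k * \<theta> k) * cos (\<theta> k) / sin (\<theta> k) - K k * cos (K k * \<theta> k)) / (sin (\<theta> k))\<^sup>2) * e k"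
        by (simp add: mulV_def pderiv_smult KS)
      also have "\<dots> = t * (sin (K k * \<theta> k) * cos (\<theta> k) / (K k * sin (\<theta> k)) - cos (K k * \<theta> k)) * ((K k)\<^sup>2 * e k) / (K k * sin (\<theta> k))\<^sup>2"
        using K[of k] elim by (simp add: power2_eq_square field_simps)
      finally show ?case by simp
    qed
  qed
  moreover have "t * (sin (t * \<rho>) * cos 0 / (t * \<rho>) - cos (t * \<rho>)) * (t * \<rho>)\<^sup>2 / (t * \<rho>)\<^sup>2 = sin (t * \<rho>) / \<rho> - t * cos (t * \<rho>)"
    using t \<rho> by (simp add: field_simps)
  ultimately show "(\<lambda>k. poly (pderiv (mulV t k)) (bmul (\<epsilon> k *\<^sub>R \<xi>)) * bgrad (\<epsilon> k *\<^sub>R \<xi>)) \<longlonglongrightarrow> sin (t * \<rho>) / \<rho> - t * cos (t * \<rho>)"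
    by (simp add: x_def e_def)
qed

text \<open>The powers of \<open>K\<close> cancel: \<open>K * K\<close> from the derivative of
  \<open>chebT\<close>, or \<open>K ^ 3\<close> over \<open>K\<close> from \<open>mulV\<close>,
  meets \<open>1 / K^2\<close> from \<open>bgrad\<close>. The bounds are therefore uniform in
  \<open>k\<close>.\<close>

lemma mul_bounds:
  fixes \<xi> :: "real^'n::finite"
  assumes t: "0 < t"
  defines "\<epsilon> \<equiv> step TYPE('n) t"
  shows "\<bar>poly (mulT k) (bmul (\<epsilon> k *\<^sub>R \<xi>))\<bar> \<le> 1"
    and "\<bar>poly (mulV t k) (bmul (\<epsilon> k *\<^sub>R \<xi>))\<bar> \<le> t"
    and "\<bar>poly (pderiv (mulT k)) (bmul (\<epsilon> k *\<^sub>R \<xi>)) * bgrad (\<epsilon> k *\<^sub>R \<xi>)\<bar> \<le> t\<^sup>2 * (norm \<xi>)\<^sup>2"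
    and "\<bar>poly (pderiv (mulV t k)) (bmul (\<epsilon> k *\<^sub>R \<xi>)) * bgrad (\<epsilon> k *\<^sub>R \<xi>)\<bar> \<le> t ^ 3 * (norm \<xi>)\<^sup>2"
proof -
  define m where "m = bmom TYPE('n)"
  define K where "K = real (Suc k)"
  define x where "x = bmul (\<epsilon> k *\<^sub>R \<xi>)"
  have m: "0 < m" unfolding m_def by (rule bmom_pos)
  have K: "0 < K" by (simp add: K_def)
  have KS: "1 + real k = K" by (simp add: K_def)
  have xb: "\<bar>x\<bar> \<le> 1" unfolding x_def by (rule abs_bmul_le)
  have "\<bar>bgrad (\<epsilon> k *\<^sub>R \<xi>)\<bar> \<le> m * (norm (\<epsilon> k *\<^sub>R \<xi>))\<^sup>2" unfolding m_def by (rule abs_bgrad_le)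
  also have "\<dots> = t\<^sup>2 * (norm \<xi>)\<^sup>2 / K\<^sup>2"
    using m K t by (simp add: \<epsilon>_def step_def m_def[symmetric] K_def power_mult_distrib power_divide)
  finally have e: "\<bar>bgrad (\<epsilon> k *\<^sub>R \<xi>)\<bar> \<le> t\<^sup>2 * (norm \<xi>)\<^sup>2 / K\<^sup>2" .
  have V: "\<bar>poly (chebV (Suc k)) x\<bar> \<le> K" unfolding K_def by (rule abs_chebV_le[OF xb])
  show "\<bar>poly (mulT k) (bmul (\<epsilon> k *\<^sub>R \<xi>))\<bar> \<le> 1"
    unfolding mulT_def x_def[symmetric] by (rule abs_chebT_le[OF xb])
  have "t / K * \<bar>poly (chebV (Suc k)) x\<bar> \<le> t / K * K" using t K V by (intro mult_left_mono) auto
  then show "\<bar>poly (mulV t k) (bmul (\<epsilon> k *\<^sub>R \<xi>))\<bar> \<le> t"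
    using t K by (simp add: mulV_def x_def[symmetric] KS abs_mult)
  have "\<bar>poly (pderiv (mulT k)) x\<bar> * \<bar>bgrad (\<epsilon> k *\<^sub>R \<xi>)\<bar> \<le> (K * K) * (t\<^sup>2 * (norm \<xi>)\<^sup>2 / K\<^sup>2)"
    using K V by (intro mult_mono e) (auto simp: mulT_def pderiv_chebT abs_mult KS)
  also have "\<dots> = t\<^sup>2 * (norm \<xi>)\<^sup>2" using K by (simp add: power2_eq_square)
  finally show "\<bar>poly (pderiv (mulT k)) (bmul (\<epsilon> k *\<^sub>R \<xi>)) * bgrad (\<epsilon> k *\<^sub>R \<xi>)\<bar> \<le> t\<^sup>2 * (norm \<xi>)\<^sup>2"
    by (simp add: abs_mult x_def)
  have "\<bar>poly (pderiv (chebV (Suc k))) x\<bar> \<le> K ^ 3" unfolding K_def by (rule abs_pderiv_chebV_le[OF xb])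
  then have "\<bar>poly (pderiv (mulV t k)) x\<bar> * \<bar>bgrad (\<epsilon> k *\<^sub>R \<xi>)\<bar> \<le> (t / K * K ^ 3) * (t\<^sup>2 * (norm \<xi>)\<^sup>2 / K\<^sup>2)"
    using K t by (intro mult_mono e) (auto simp: mulV_def pderiv_smult abs_mult KS intro!: divide_right_mono)
  also have "\<dots> = t ^ 3 * (norm \<xi>)\<^sup>2" using K by (simp add: power2_eq_square power3_eq_cube)
  finally show "\<bar>poly (pderiv (mulV t k)) (bmul (\<epsilon> k *\<^sub>R \<xi>)) * bgrad (\<epsilon> k *\<^sub>R \<xi>)\<bar> \<le> t ^ 3 * (norm \<xi>)\<^sup>2"
    by (simp add: abs_mult x_def)
qed

section \<open>Bounded operators and semigroups on a complex Hilbert space\<close>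

lemma norm_scaleC: "norm (c *\<^sub>C x) = cmod c * norm (x :: 'h::complex_hilbert)"
proof -
  have "complex_of_real ((norm (c *\<^sub>C x))\<^sup>2) = c * cinner x (c *\<^sub>C x)"
    by (simp only: cinner_self[symmetric] cinner_scaleC_left)
  also have "cinner x (c *\<^sub>C x) = cnj c * cinner x x"
    by (subst cinner_commute, subst cinner_scaleC_left, subst (2) cinner_commute) simp
  also have "c * (cnj c * cinner x x) = c * cnj c * cinner x x" by simp
  also have "\<dots> = complex_of_real ((cmod c * norm x)\<^sup>2)"
    by (simp only: cinner_self complex_norm_square[symmetric] power_mult_distrib of_real_mult of_real_power)
  finally have "(norm (c *\<^sub>C x))\<^sup>2 = (cmod c * norm x)\<^sup>2" using of_real_eq_iff by blast
  then show ?thesis by (simp add: power2_eq_iff_nonneg)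
qed

lemma scaleC_diff_right: "c *\<^sub>C (x - y) = c *\<^sub>C x - c *\<^sub>C (y :: 'h::complex_hilbert)"
  by (metis add_diff_cancel_right' diff_add_cancel scaleC_add_right)

lemma scaleC_minus1: "(-1) *\<^sub>C x = - (x :: 'h::complex_hilbert)"
  using scaleC_of_real[of "-1" x] by simp

lemma scaleC_zero: "0 *\<^sub>C x = (0 :: 'h::complex_hilbert)"
  using scaleC_of_real[of 0 x] by simp

lemma tendsto_scaleC:
  assumes "(f \<longlongrightarrow> (x :: 'h::complex_hilbert)) F"
  shows "((\<lambda>t. c *\<^sub>C f t) \<longlongrightarrow> c *\<^sub>C x) F"
proof (rule Lim_null[THEN iffD2])
  have "((\<lambda>t. cmod c * norm (f t - x)) \<longlongrightarrow> cmod c * 0) F"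
    using assms by (intro tendsto_mult tendsto_const) (simp add: tendsto_norm_zero_iff Lim_null[symmetric])
  then show "((\<lambda>t. c *\<^sub>C f t - c *\<^sub>C x) \<longlongrightarrow> 0) F"
    by (subst tendsto_norm_zero_iff[symmetric]) (simp add: norm_scaleC scaleC_diff_right[symmetric])
qed

text \<open>Extension by uniform continuity. The bound survives with the same \<open>M\<close>,
  which keeps the exact growth exponent of the semigroup.\<close>

lemma extend_bounded_clinear:
  fixes T :: "'h::complex_hilbert \<Rightarrow> 'h"
  assumes dense: "closure E = UNIV"
    and E_add: "\<And>x y. x \<in> E \<Longrightarrow> y \<in> E \<Longrightarrow> x + y \<in> E"
    and E_scale: "\<And>c x. x \<in> E \<Longrightarrow> c *\<^sub>C x \<in> E"
    and T_add: "\<And>x y. x \<in> E \<Longrightarrow> y \<in> E \<Longrightarrow> T (x + y) = T x + T y"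
    and T_scale: "\<And>c x. x \<in> E \<Longrightarrow> T (c *\<^sub>C x) = c *\<^sub>C T x"
    and T_bound: "\<And>x. x \<in> E \<Longrightarrow> norm (T x) \<le> M * norm x"
  obtains T' where "bounded_clinear T'" "\<And>x. x \<in> E \<Longrightarrow> T' x = T x" "\<And>x. norm (T' x) \<le> M * norm x"
proof -
  have diff: "T x - T y = T (x - y)" "x - y \<in> E" if "x \<in> E" "y \<in> E" for x y
  proof -
    have "(-1) *\<^sub>C y \<in> E" using that E_scale by blast
    then show "x - y \<in> E" "T x - T y = T (x - y)"
      using E_add[OF that(1)] T_add[OF that(1)] T_scale[OF that(2), of "-1"] by (force simp: scaleC_minus1)+
  qed
  have "uniformly_continuous_on E T"
    unfolding uniformly_continuous_on_def
  proof (intro allI impI)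
    fix e :: real assume e: "e > 0"
    \<comment> \<open>The sign of \<open>M\<close> is left open; \<open>\<bar>M\<bar> + 1\<close> is
      positive in any case.\<close>
    have "dist (T y) (T x) < e" if "x \<in> E" "y \<in> E" "dist y x < e / (\<bar>M\<bar> + 1)" for x y
    proof -
      have "dist (T y) (T x) \<le> M * dist y x"
        unfolding dist_norm using T_bound[OF diff(2)[OF that(2,1)]] diff(1)[OF that(2,1)] by simp
      also have "\<dots> \<le> (\<bar>M\<bar> + 1) * dist y x" by (intro mult_right_mono) auto
      also have "\<dots> < e" using that(3) by (simp add: field_simps)
      finally show ?thesis .
    qed
    then show "\<exists>d>0. \<forall>x\<in>E. \<forall>y\<in>E. dist y x < d \<longrightarrow> dist (T y) (T x) < e"
      using e by (intro exI[of _ "e / (\<bar>M\<bar> + 1)"]) auto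
  qed
  then obtain T' where T': "uniformly_continuous_on UNIV T'" "\<And>x. x \<in> E \<Longrightarrow> T x = T' x"
    using uniformly_continuous_on_extension_on_closure dense by metis
  then have lim: "(\<lambda>n. T' (f n)) \<longlonglongrightarrow> T' x" if "f \<longlonglongrightarrow> x" for f x
    using uniformly_continuous_imp_continuous[OF T'(1)] that
    by (auto simp: continuous_on_eq_continuous_at intro: isCont_tendsto_compose)
  have seq: "\<exists>f. (\<forall>n. f n \<in> E) \<and> f \<longlonglongrightarrow> x" for x
    using dense by (metis UNIV_I closure_sequential)
  have add: "T' (x + y) = T' x + T' y" for x y
  proof -
    obtain f g where fg: "\<forall>n. f n \<in> E" "f \<longlonglongrightarrow> x" "\<forall>n. g n \<in> E" "g \<longlonglongrightarrow> y" using seq by metis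
    have "(\<lambda>n. T' (f n + g n)) \<longlonglongrightarrow> T' (x + y)" using lim tendsto_add[OF fg(2,4)] by blast
    moreover have "(\<lambda>n. T' (f n + g n)) = (\<lambda>n. T' (f n) + T' (g n))"
    proof
      fix n show "T' (f n + g n) = T' (f n) + T' (g n)"
        using fg(1,3) T_add[of "f n" "g n"] E_add[of "f n" "g n"] T'(2) by simp
    qed
    moreover have "(\<lambda>n. T' (f n) + T' (g n)) \<longlonglongrightarrow> T' x + T' y" using fg lim by (intro tendsto_add) auto
    ultimately show ?thesis using LIMSEQ_unique by metis
  qed
  have scale: "T' (c *\<^sub>C x) = c *\<^sub>C T' x" for c x
  proof -
    obtain f where f: "\<forall>n. f n \<in> E" "f \<longlonglongrightarrow> x" using seq by metis
    have "(\<lambda>n. T' (c *\<^sub>C f n)) \<longlonglongrightarrow> T' (c *\<^sub>C x)" using lim tendsto_scaleC[OF f(2)] by blast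
    moreover have "(\<lambda>n. T' (c *\<^sub>C f n)) = (\<lambda>n. c *\<^sub>C T' (f n))"
    proof
      fix n show "T' (c *\<^sub>C f n) = c *\<^sub>C T' (f n)"
        using f(1) T_scale[of "f n" c] E_scale[of "f n" c] T'(2) by simp
    qed
    moreover have "(\<lambda>n. c *\<^sub>C T' (f n)) \<longlonglongrightarrow> c *\<^sub>C T' x" using f lim by (intro tendsto_scaleC) auto
    ultimately show ?thesis using LIMSEQ_unique by metis
  qed
  have bound: "norm (T' x) \<le> M * norm x" for x
  proof -
    obtain f where f: "\<forall>n. f n \<in> E" "f \<longlonglongrightarrow> x" using seq by metis
    show ?thesis
    proof (rule LIMSEQ_le)
      show "(\<lambda>n. norm (T' (f n))) \<longlonglongrightarrow> norm (T' x)" using f lim by (intro tendsto_norm) auto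
      show "(\<lambda>n. M * norm (f n)) \<longlonglongrightarrow> M * norm x" using f by (intro tendsto_intros)
      show "\<exists>N. \<forall>n\<ge>N. norm (T' (f n)) \<le> M * norm (f n)" using f T_bound T'(2) by metis
    qed
  qed
  have "bounded_linear T'"
    by (rule bounded_linear_intro[of _ M]) (use add scale bound in \<open>auto simp: mult.commute scaleC_of_real[symmetric]\<close>)
  then show ?thesis using that[of T'] scale bound T'(2) by (simp add: bounded_clinear_def)
qed

text \<open>The fundamental theorem of calculus at the left endpoint.\<close>

lemma integral_average_tendsto:
  fixes f :: "real \<Rightarrow> 'a::banach"
  assumes "continuous_on {0..1} f"
  shows "((\<lambda>h. integral {0..h} f /\<^sub>R h) \<longlongrightarrow> f 0) (at_right 0)"
proof -
  have "((\<lambda>u. integral {0..u} f) has_vector_derivative f 0) (at 0 within {0..1})"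
    by (rule integral_has_vector_derivative[OF assms]) simp
  then have "((\<lambda>y. (1 / norm (y - 0)) *\<^sub>R (integral {0..y} f - (integral {0..0} f + (y - 0) *\<^sub>R f 0))) \<longlongrightarrow> 0) (at_right 0)"
    by (simp add: has_vector_derivative_def has_derivative_within at_within_Icc_at_right)
  then have "((\<lambda>h. integral {0..h} f /\<^sub>R h - f 0) \<longlongrightarrow> 0) (at_right 0)"
    by (rule Lim_transform_eventually)
       (rule eventually_mono[OF eventually_at_right_less[of 0]], simp add: divide_inverse scaleR_diff_right)
  then show ?thesis using Lim_null by blast
qed

text \<open>Riemann sums are linear combinations of values in \<open>C\<close> and come arbitrarily
  close to the integral.\<close>

lemma has_integral_closed_subspace:
  fixes f :: "real \<Rightarrow> 'a::real_normed_vector"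
  assumes "closed C" "subspace C" "\<And>t. t \<in> {a..b} \<Longrightarrow> f t \<in> C" "(f has_integral I) {a..b}"
  shows "I \<in> C"
proof -
  have "\<exists>y\<in>C. dist y I < e" if "e > 0" for e
  proof -
    from assms(4)[unfolded has_integral_real, rule_format, OF \<open>e > 0\<close>]
    obtain \<gamma> where g: "gauge \<gamma>" "\<forall>\<D>. \<D> tagged_division_of {a..b} \<and> \<gamma> fine \<D> \<longrightarrow>
        norm ((\<Sum>(x,k)\<in>\<D>. measure lborel k *\<^sub>R f x) - I) < e"
      by (elim exE conjE) (rule that)
    obtain p where p: "p tagged_division_of {a..b}" "\<gamma> fine p"
      using fine_division_exists_real[OF g(1)] by blast
    have "f x \<in> C" if "(x, k) \<in> p" for x k
      using assms(3) tagged_division_ofD(2,3)[OF p(1) that] by blast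
    then have "(\<Sum>(x,k)\<in>p. measure lborel k *\<^sub>R f x) \<in> C"
      by (intro subspace_sum[OF assms(2)]) (auto intro!: subspace_scale[OF assms(2)])
    then show ?thesis using g(2) p by (auto simp: dist_norm)
  qed
  then have "I \<in> closure C" by (simp add: closure_approachable)
  then show ?thesis using assms(1) by simp
qed

lemma subspace_closure:
  fixes S :: "'a::real_normed_vector set"
  assumes "subspace S"
  shows "subspace (closure S)"
proof (rule subspaceI)
  show "0 \<in> closure S" using subspace_0[OF assms] closure_subset by blast
  show "x + y \<in> closure S" if "x \<in> closure S" "y \<in> closure S" for x y
  proof -
    obtain f g where "\<forall>n. f n \<in> S" "f \<longlonglongrightarrow> x" "\<forall>n. g n \<in> S" "g \<longlonglongrightarrow> y"
      using \<open>x \<in> closure S\<close> \<open>y \<in> closure S\<close> unfolding closure_sequential by auto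
    then show ?thesis unfolding closure_sequential
      by (intro exI[of _ "\<lambda>n. f n + g n"]) (auto intro: tendsto_add subspace_add[OF assms])
  qed
  show "c *\<^sub>R x \<in> closure S" if "x \<in> closure S" for c x
  proof -
    obtain f where "\<forall>n. f n \<in> S" "f \<longlonglongrightarrow> x"
      using \<open>x \<in> closure S\<close> unfolding closure_sequential by auto
    then show ?thesis unfolding closure_sequential
      by (intro exI[of _ "\<lambda>n. c *\<^sub>R f n"]) (auto intro: tendsto_scaleR subspace_scale[OF assms])
  qed
qed

lemma has_integral_Pair:
  fixes f :: "real \<Rightarrow> 'a::real_normed_vector" and g :: "real \<Rightarrow> 'b::real_normed_vector"
  assumes "(f has_integral a) A" "(g has_integral b) A"
  shows "((\<lambda>t. (f t, g t)) has_integral (a, b)) A"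
proof -
  have "bounded_linear (\<lambda>x::'a. (x, 0::'b))" "bounded_linear (\<lambda>y::'b. (0::'a, y))"
    by (intro bounded_linear_Pair bounded_linear_ident bounded_linear_zero)+
  from has_integral_add[OF has_integral_linear[OF assms(1) this(1)] has_integral_linear[OF assms(2) this(2)]]
  show ?thesis by (simp add: o_def)
qed

section \<open>Generators and cores of exponentially bounded semigroups\<close>

locale exp_bounded_semigroup =
  fixes S :: "real \<Rightarrow> 'h::complex_hilbert \<Rightarrow> 'h" and \<omega> :: real
  assumes semigroup: "C0_semigroup S"
    and bound: "0 \<le> \<tau> \<Longrightarrow> norm (S \<tau> x) \<le> exp (\<omega> * \<tau>) * norm x"
begin

lemma linear_S: "0 \<le> \<tau> \<Longrightarrow> linear (S \<tau>)"
  using semigroup by (simp add: C0_semigroup_def bounded_clinear_def bounded_linear.linear)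

lemma continuous_S: "A \<subseteq> {0..} \<Longrightarrow> continuous_on A (\<lambda>\<tau>. S \<tau> x)"
  using semigroup unfolding C0_semigroup_def using continuous_on_subset by blast

lemma S_0 [simp]: "S 0 x = x"
  using semigroup by (simp add: C0_semigroup_def)

lemma S_add: "0 \<le> \<sigma> \<Longrightarrow> 0 \<le> \<tau> \<Longrightarrow> S (\<sigma> + \<tau>) x = S \<sigma> (S \<tau> x)"
  using semigroup by (simp add: C0_semigroup_def)

lemma bound_upto:
  assumes "0 \<le> \<tau>" "\<tau> \<le> T"
  shows "norm (S \<tau> x) \<le> exp (\<bar>\<omega>\<bar> * T) * norm x"
proof -
  have "\<omega> * \<tau> \<le> \<bar>\<omega>\<bar> * T" using assms by (intro mult_mono) auto
  then have "exp (\<omega> * \<tau>) * norm x \<le> exp (\<bar>\<omega>\<bar> * T) * norm x" by (intro mult_right_mono) auto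
  then show ?thesis using bound[OF assms(1), of x] by linarith
qed

lemma generator_unique: "(x, y) \<in> generator S \<Longrightarrow> (x, z) \<in> generator S \<Longrightarrow> y = z"
  unfolding generator_def using tendsto_unique[OF trivial_limit_at_right_real] by blast

text \<open>The generator only gives the right derivative at time 0. An increment to the right of
  \<open>\<tau>\<close> is transported by \<open>S \<tau>\<close>; one to the left is transported by
  \<open>S \<sigma>\<close> from the earlier time, which leaves the error
  \<open>S \<sigma> y - S \<tau> y\<close>, small by strong continuity.\<close>

lemma generator_derivative:
  assumes gen: "(x, y) \<in> generator S" and t: "\<tau> \<in> {0..T}"
  shows "((\<lambda>\<tau>. S \<tau> x) has_vector_derivative S \<tau> y) (at \<tau> within {0..T})"
  unfolding has_vector_derivative_def has_derivative_within_alt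
proof (intro conjI allI impI)
  show "bounded_linear (\<lambda>h. h *\<^sub>R S \<tau> y)" by (rule bounded_linear_scaleR_left)
  fix e :: real assume e: "e > 0"
  define M where "M = exp (\<bar>\<omega>\<bar> * T)"
  have M: "M > 0" by (simp add: M_def)
  \<comment> \<open>Half of \<open>e\<close> pays for the difference quotient, amplified by at most
    \<open>M\<close>; the other half is kept for the continuity of
    \<open>\<lambda>\<tau>. S \<tau> y\<close>.\<close>
  define e' where "e' = e / (2 * M)"
  have e': "e' > 0" using e M by (simp add: e'_def)
  have Me: "M * e' \<le> e / 2" using M by (simp add: e'_def)
  have "((\<lambda>\<tau>. (S \<tau> x - x) /\<^sub>R \<tau>) \<longlongrightarrow> y) (at_right 0)" using gen by (simp add: generator_def)
  from tendstoD[OF this e'] obtain d1 where d1: "d1 > 0"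
    "\<And>h. 0 < h \<Longrightarrow> h < d1 \<Longrightarrow> dist ((S h x - x) /\<^sub>R h) y < e'"
    unfolding eventually_at_right_field by auto
  have small: "norm (S h x - x - h *\<^sub>R y) \<le> e' * h" if "0 \<le> h" "h < d1" for h
  proof (cases "h = 0")
    case False
    then have h: "h > 0" using that by simp
    have "S h x - x - h *\<^sub>R y = h *\<^sub>R ((S h x - x) /\<^sub>R h - y)"
      using h by (simp add: scaleR_diff_right)
    then have "norm (S h x - x - h *\<^sub>R y) = h * norm ((S h x - x) /\<^sub>R h - y)" using h by simp
    also have "\<dots> \<le> h * e'" using d1(2)[OF h that(2)] h by (simp add: dist_norm)
    finally show ?thesis by (simp add: mult.commute)
  qed simp
  have "continuous_on {0..} (\<lambda>\<tau>. S \<tau> y)" by (rule continuous_S) simp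
  then obtain d2 where d2: "d2 > 0" "\<And>\<sigma>. \<sigma> \<in> {0..} \<Longrightarrow> dist \<sigma> \<tau> < d2 \<Longrightarrow> dist (S \<sigma> y) (S \<tau> y) < e / 2"
    unfolding continuous_on_iff using t e by (metis atLeastAtMost_iff atLeast_iff half_gt_zero)
  show "\<exists>d>0. \<forall>\<sigma>\<in>{0..T}. norm (\<sigma> - \<tau>) < d \<longrightarrow>
            norm (S \<sigma> x - S \<tau> x - (\<sigma> - \<tau>) *\<^sub>R S \<tau> y) \<le> e * norm (\<sigma> - \<tau>)"
  proof (intro exI[of _ "min d1 d2"] conjI ballI impI)
    show "0 < min d1 d2" using d1 d2 by simp
    fix \<sigma> assume s: "\<sigma> \<in> {0..T}" and near: "norm (\<sigma> - \<tau>) < min d1 d2"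
    show "norm (S \<sigma> x - S \<tau> x - (\<sigma> - \<tau>) *\<^sub>R S \<tau> y) \<le> e * norm (\<sigma> - \<tau>)"
    proof (cases "\<tau> \<le> \<sigma>")
      case True
      have lin: "linear (S \<tau>)" using linear_S t by auto
      have "S \<sigma> x = S \<tau> (S (\<sigma> - \<tau>) x)" using S_add[of \<tau> "\<sigma> - \<tau>"] t True by simp
      then have "S \<sigma> x - S \<tau> x - (\<sigma> - \<tau>) *\<^sub>R S \<tau> y = S \<tau> (S (\<sigma> - \<tau>) x - x - (\<sigma> - \<tau>) *\<^sub>R y)"
        by (simp add: linear_diff[OF lin] linear_scale[OF lin])
      then have "norm (S \<sigma> x - S \<tau> x - (\<sigma> - \<tau>) *\<^sub>R S \<tau> y) \<le> M * norm (S (\<sigma> - \<tau>) x - x - (\<sigma> - \<tau>) *\<^sub>R y)"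
        using bound_upto[of \<tau> T] t by (simp add: M_def)
      also have "\<dots> \<le> M * (e' * (\<sigma> - \<tau>))"
        using small[of "\<sigma> - \<tau>"] near True M by (intro mult_left_mono) auto
      also have "\<dots> \<le> e / 2 * (\<sigma> - \<tau>)" using mult_right_mono[OF Me, of "\<sigma> - \<tau>"] True by (simp add: mult.assoc)
      also have "\<dots> \<le> e * norm (\<sigma> - \<tau>)" using e True by (simp add: mult_right_mono)
      finally show ?thesis .
    next
      case False
      have lin: "linear (S \<sigma>)" using linear_S s by auto
      have "S \<tau> x = S \<sigma> (S (\<tau> - \<sigma>) x)" using S_add[of \<sigma> "\<tau> - \<sigma>"] s False by simp
      then have "S \<sigma> x - S \<tau> x - (\<sigma> - \<tau>) *\<^sub>R S \<tau> y
          = - (S \<sigma> (S (\<tau> - \<sigma>) x - x - (\<tau> - \<sigma>) *\<^sub>R y)) - (\<tau> - \<sigma>) *\<^sub>R (S \<sigma> y - S \<tau> y)"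
        by (simp add: linear_diff[OF lin] linear_scale[OF lin] scaleR_diff_right scaleR_diff_left)
      then have "norm (S \<sigma> x - S \<tau> x - (\<sigma> - \<tau>) *\<^sub>R S \<tau> y)
          \<le> norm (S \<sigma> (S (\<tau> - \<sigma>) x - x - (\<tau> - \<sigma>) *\<^sub>R y)) + (\<tau> - \<sigma>) * norm (S \<sigma> y - S \<tau> y)"
        using norm_triangle_ineq4[of "- (S \<sigma> (S (\<tau> - \<sigma>) x - x - (\<tau> - \<sigma>) *\<^sub>R y))" "(\<tau> - \<sigma>) *\<^sub>R (S \<sigma> y - S \<tau> y)"] False
        by simp
      also have "norm (S \<sigma> (S (\<tau> - \<sigma>) x - x - (\<tau> - \<sigma>) *\<^sub>R y)) \<le> M * norm (S (\<tau> - \<sigma>) x - x - (\<tau> - \<sigma>) *\<^sub>R y)"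
        using bound_upto[of \<sigma> T] s by (simp add: M_def)
      also have "M * norm (S (\<tau> - \<sigma>) x - x - (\<tau> - \<sigma>) *\<^sub>R y) \<le> M * (e' * (\<tau> - \<sigma>))"
        using small[of "\<tau> - \<sigma>"] near False M by (intro mult_left_mono) auto
      also have "M * (e' * (\<tau> - \<sigma>)) \<le> e / 2 * (\<tau> - \<sigma>)" using mult_right_mono[OF Me, of "\<tau> - \<sigma>"] False by (simp add: mult.assoc)
      also have "(\<tau> - \<sigma>) * norm (S \<sigma> y - S \<tau> y) \<le> (\<tau> - \<sigma>) * (e / 2)"
        using d2(2)[of \<sigma>] s near False by (intro mult_left_mono) (auto simp: dist_norm)
      finally show ?thesis using False by (simp add: algebra_simps)
    qed
  qed
qed

lemma generator_integral:
  assumes "(x, y) \<in> generator S" "0 \<le> h"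
  shows "((\<lambda>\<tau>. S \<tau> y) has_integral (S h x - x)) {0..h}"
  using fundamental_theorem_of_calculus[OF assms(2) generator_derivative[OF assms(1)]] by simp

lemma integral_bound_S:
  assumes "0 \<le> h"
  shows "norm (integral {0..h} (\<lambda>\<tau>. S \<tau> x)) \<le> exp (\<bar>\<omega>\<bar> * h) * norm x * h"
  using integral_bound[OF assms, of "\<lambda>\<tau>. S \<tau> x" "exp (\<bar>\<omega>\<bar> * h) * norm x"] bound_upto[of _ h x] continuous_S[of "{0..h}" x]
  by force

lemma integral_tendsto_S:
  assumes "f \<longlonglongrightarrow> x" "0 \<le> h"
  shows "(\<lambda>n. integral {0..h} (\<lambda>\<tau>. S \<tau> (f n))) \<longlonglongrightarrow> integral {0..h} (\<lambda>\<tau>. S \<tau> x)"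
proof (rule Lim_null[THEN iffD2], rule Lim_null_comparison)
  have eq: "integral {0..h} (\<lambda>\<tau>. S \<tau> (f n)) - integral {0..h} (\<lambda>\<tau>. S \<tau> x) = integral {0..h} (\<lambda>\<tau>. S \<tau> (f n - x))" for n
  proof -
    have "integral {0..h} (\<lambda>\<tau>. S \<tau> (f n - x)) = integral {0..h} (\<lambda>\<tau>. S \<tau> (f n) - S \<tau> x)"
      by (rule Henstock_Kurzweil_Integration.integral_cong) (simp add: linear_diff[OF linear_S])
    then show ?thesis
      by (simp add: Henstock_Kurzweil_Integration.integral_diff integrable_continuous_real continuous_S)
  qed
  show "\<forall>\<^sub>F n in sequentially. norm (integral {0..h} (\<lambda>\<tau>. S \<tau> (f n)) - integral {0..h} (\<lambda>\<tau>. S \<tau> x)) \<le> exp (\<bar>\<omega>\<bar> * h) * norm (f n - x) * h"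
    using integral_bound_S[OF assms(2)] by (simp add: eq)
  have "(\<lambda>n. norm (f n - x)) \<longlonglongrightarrow> 0" using assms(1) by (simp add: tendsto_norm_zero_iff Lim_null[symmetric])
  then show "(\<lambda>n. exp (\<bar>\<omega>\<bar> * h) * norm (f n - x) * h) \<longlonglongrightarrow> 0"
    by (intro tendsto_mult_left_zero tendsto_mult_right_zero)
qed

lemma tendsto_S:
  assumes "f \<longlonglongrightarrow> x" "0 \<le> \<tau>"
  shows "(\<lambda>n. S \<tau> (f n)) \<longlonglongrightarrow> S \<tau> x"
  using semigroup assms by (auto simp: C0_semigroup_def bounded_clinear_def intro: bounded_linear.tendsto)

text \<open>The closure lies in the generator because the integrated equation is stable under limits
  in the graph and can be differentiated again at time 0. The converse is the core criterion: a
  dense domain whose graph is carried by the flow into the closed graph.\<close>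

lemma generator_eq_closure:
  assumes sub: "subspace G" and dense: "closure (fst ` G) = UNIV"
    and gen: "G \<subseteq> generator S"
    and inv: "\<And>x y \<tau>. (x, y) \<in> G \<Longrightarrow> 0 \<le> \<tau> \<Longrightarrow> (S \<tau> x, S \<tau> y) \<in> closure G"
  shows "generator S = closure G"
proof (rule set_eqI, clarify)
  fix x y
  show "(x, y) \<in> generator S \<longleftrightarrow> (x, y) \<in> closure G"
  proof
    assume "(x, y) \<in> closure G"
    then obtain p where p: "\<forall>n. p n \<in> G" "p \<longlonglongrightarrow> (x, y)" unfolding closure_sequential by blast
    define f g where "f n = fst (p n)" and "g n = snd (p n)" for n
    have f: "f \<longlonglongrightarrow> x" and g: "g \<longlonglongrightarrow> y" unfolding f_def g_def using p(2) by (auto dest: tendsto_fst tendsto_snd)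
    have "S h x - x = integral {0..h} (\<lambda>\<tau>. S \<tau> y)" if "0 \<le> h" for h
    proof (rule LIMSEQ_unique)
      show "(\<lambda>n. S h (f n) - f n) \<longlonglongrightarrow> S h x - x" using tendsto_S[OF f that] f by (rule tendsto_diff)
      have "(f n, g n) \<in> generator S" for n using p(1) gen by (auto simp: f_def g_def)
      then have "S h (f n) - f n = integral {0..h} (\<lambda>\<tau>. S \<tau> (g n))" for n
        using generator_integral[OF _ that] by (metis integral_unique)
      then show "(\<lambda>n. S h (f n) - f n) \<longlonglongrightarrow> integral {0..h} (\<lambda>\<tau>. S \<tau> y)"
        using integral_tendsto_S[OF g that] by simp
    qed
    then have "\<forall>\<^sub>F h in at_right 0. integral {0..h} (\<lambda>\<tau>. S \<tau> y) /\<^sub>R h = (S h x - x) /\<^sub>R h"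
      by (intro eventually_mono[OF eventually_at_right_less[of 0]]) simp
    with integral_average_tendsto[OF continuous_S[of "{0..1}" y]]
    show "(x, y) \<in> generator S" unfolding generator_def by (auto intro: Lim_transform_eventually)
  next
    assume xy: "(x, y) \<in> generator S"
    \<comment> \<open>The curve \<open>(S \<tau> a, S \<tau> b)\<close> stays in a closed subspace,
      hence so does its integral; its second component integrates to
      \<open>S h a - a\<close>.\<close>
    have G0: "(integral {0..h} (\<lambda>\<tau>. S \<tau> a), S h a - a) \<in> closure G" if "(a, b) \<in> G" "0 \<le> h" for a b h
    proof (rule has_integral_closed_subspace[of _ 0 h "\<lambda>\<tau>. (S \<tau> a, S \<tau> b)"])
      show "subspace (closure G)" using sub by (rule subspace_closure)
      show "(S t a, S t b) \<in> closure G" if "t \<in> {0..h}" for t using inv \<open>(a, b) \<in> G\<close> that by simp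
      have "((\<lambda>\<tau>. S \<tau> a) has_integral integral {0..h} (\<lambda>\<tau>. S \<tau> a)) {0..h}"
        by (intro integrable_integral integrable_continuous_real continuous_S) auto
      moreover have "((\<lambda>\<tau>. S \<tau> b) has_integral S h a - a) {0..h}"
        using generator_integral gen that by blast
      ultimately show "((\<lambda>\<tau>. (S \<tau> a, S \<tau> b)) has_integral (integral {0..h} (\<lambda>\<tau>. S \<tau> a), S h a - a)) {0..h}"
        by (rule has_integral_Pair)
    qed simp
    \<comment> \<open>The pair obtained in \<open>G0\<close> no longer mentions \<open>b\<close>, so
      density of the domain alone extends the statement to \<open>x\<close>.\<close>
    have G1: "(integral {0..h} (\<lambda>\<tau>. S \<tau> x), S h x - x) \<in> closure G" if "0 \<le> h" for h
    proof -
      have "x \<in> closure (fst ` G)" using dense by simp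
      then obtain f where f: "\<forall>n. f n \<in> fst ` G" "f \<longlonglongrightarrow> x" unfolding closure_sequential by blast
      have G: "(integral {0..h} (\<lambda>\<tau>. S \<tau> (f n)), S h (f n) - f n) \<in> closure G" for n
        using f(1)[rule_format, of n] G0[OF _ that] by force
      have "(\<lambda>n. (integral {0..h} (\<lambda>\<tau>. S \<tau> (f n)), S h (f n) - f n)) \<longlonglongrightarrow> (integral {0..h} (\<lambda>\<tau>. S \<tau> x), S h x - x)"
        by (intro tendsto_Pair integral_tendsto_S tendsto_diff tendsto_S f that)
      with closed_closure G show ?thesis by (rule closed_sequentially)
    qed
    have lim: "((\<lambda>h. (integral {0..h} (\<lambda>\<tau>. S \<tau> x) /\<^sub>R h, (S h x - x) /\<^sub>R h)) \<longlongrightarrow> (x, y)) (at_right 0)"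
      using integral_average_tendsto[OF continuous_S[of "{0..1}" x]] xy by (auto simp: generator_def intro: tendsto_Pair)
    show "(x, y) \<in> closure G"
    proof (rule Lim_in_closed_set[OF closed_closure _ trivial_limit_at_right_real lim])
      have "(integral {0..h} (\<lambda>\<tau>. S \<tau> x) /\<^sub>R h, (S h x - x) /\<^sub>R h) \<in> closure G" if "0 < h" for h
        using subspace_scale[OF subspace_closure[OF sub] G1[of h], of "inverse h"] that by simp
      then show "\<forall>\<^sub>F h in at_right 0. (integral {0..h} (\<lambda>\<tau>. S \<tau> x) /\<^sub>R h, (S h x - x) /\<^sub>R h) \<in> closure G"
        by (intro eventually_mono[OF eventually_at_right_less[of 0]]) simp
    qed
  qed
qed

end

text \<open>The growth bound makes the operators uniformly bounded on compact time intervals;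
  continuity at 0 therefore spreads from the dense set to all vectors, and by the semigroup law to
  all times.\<close>

lemma C0_semigroupI:
  fixes S :: "real \<Rightarrow> 'h::complex_hilbert \<Rightarrow> 'h"
  assumes lin: "\<And>\<tau>. 0 \<le> \<tau> \<Longrightarrow> bounded_clinear (S \<tau>)"
    and S0: "S 0 = id"
    and add: "\<And>\<sigma> \<tau>. 0 \<le> \<sigma> \<Longrightarrow> 0 \<le> \<tau> \<Longrightarrow> S (\<sigma> + \<tau>) = S \<sigma> \<circ> S \<tau>"
    and bound: "\<And>\<tau> x. 0 \<le> \<tau> \<Longrightarrow> norm (S \<tau> x) \<le> exp (\<omega> * \<tau>) * norm x"
    and dense: "closure E = UNIV"
    and cont0: "\<And>x. x \<in> E \<Longrightarrow> ((\<lambda>\<tau>. S \<tau> x) \<longlongrightarrow> x) (at_right 0)"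
  shows "C0_semigroup S"
proof -
  have linS: "linear (S \<tau>)" if "0 \<le> \<tau>" for \<tau>
    using lin[OF that] by (simp add: bounded_clinear_def bounded_linear.linear)
  have bd: "norm (S \<tau> x) \<le> exp (\<bar>\<omega>\<bar> * T) * norm x" if "0 \<le> \<tau>" "\<tau> \<le> T" for \<tau> T x
  proof -
    have "\<omega> * \<tau> \<le> \<bar>\<omega>\<bar> * T" using that by (intro mult_mono) auto
    then have "exp (\<omega> * \<tau>) * norm x \<le> exp (\<bar>\<omega>\<bar> * T) * norm x" by (intro mult_right_mono) auto
    then show ?thesis using bound[OF that(1), of x] by linarith
  qed
  have small: "\<exists>d>0. \<forall>h. 0 \<le> h \<longrightarrow> h < d \<longrightarrow> norm (S h x - x) < e" if e: "e > 0" for x e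
  proof -
    \<comment> \<open>For times below 1 this \<open>M\<close> bounds all operators, whatever the
      sign of \<open>\<omega>\<close>.\<close>
    define M where "M = exp (\<bar>\<omega>\<bar> * 1)"
    have M: "M \<ge> 1" by (simp add: M_def)
    have "x \<in> closure E" using dense by simp
    moreover have "e / (3 * M) > 0" using e M by simp
    ultimately obtain z where z: "z \<in> E" "dist z x < e / (3 * M)" unfolding closure_approachable by blast
    from tendstoD[OF cont0[OF z(1)], of "e / 3"] e obtain d where d: "d > 0"
      "\<And>h. 0 < h \<Longrightarrow> h < d \<Longrightarrow> dist (S h z) z < e / 3"
      unfolding eventually_at_right_field by auto
    have "norm (S h x - x) < e" if h: "0 \<le> h" "h < min d 1" for h
    proof -
      have a: "norm (S h (x - z)) \<le> M * norm (x - z)" using bd[of h 1] h by (simp add: M_def)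
      have b: "M * norm (x - z) < e / 3" using z(2) M by (simp add: dist_norm norm_minus_commute field_simps)
      have "norm (x - z) \<le> M * norm (x - z)" using M by (simp add: mult_le_cancel_right1)
      then have c: "norm (z - x) < e / 3" using b by (simp add: norm_minus_commute)
      have "norm (S h z - z) < e / 3" using d(2)[of h] h S0 e by (cases "h = 0") (auto simp: dist_norm)
      moreover have "S h x - x = S h (x - z) + (S h z - z) + (z - x)" using linS h by (simp add: linear_diff)
      then have "norm (S h x - x) \<le> norm (S h (x - z)) + norm (S h z - z) + norm (z - x)"
        using norm_triangle_ineq[of "S h (x - z) + (S h z - z)" "z - x"] norm_triangle_ineq[of "S h (x - z)" "S h z - z"]
        by simp
      ultimately show ?thesis using a b c by linarith
    qed
    then show ?thesis using d(1) by (intro exI[of _ "min d 1"]) auto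
  qed
  have "continuous_on {0..} (\<lambda>\<tau>. S \<tau> x)" for x
    unfolding continuous_on_iff
  proof (intro ballI allI impI)
    fix \<tau> e :: real assume t: "\<tau> \<in> {0..}" and e: "0 < e"
    \<comment> \<open>Times up to \<open>\<tau> + 1\<close> leave room to the right of
      \<open>\<tau>\<close>.\<close>
    define M where "M = exp (\<bar>\<omega>\<bar> * (\<tau> + 1))"
    have M: "M > 0" by (simp add: M_def)
    from small[of "e / M" x] e M obtain d where d: "d > 0" "\<And>h. 0 \<le> h \<Longrightarrow> h < d \<Longrightarrow> norm (S h x - x) < e / M" by auto
    have key: "norm (S b x - S a x) < e" if "0 \<le> a" "a \<le> b" "b \<le> \<tau> + 1" "b - a < d" for a b
    proof -
      have "S b x - S a x = S a (S (b - a) x - x)"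
        using add[of a "b - a"] that linS[of a] by (simp add: linear_diff)
      then have "norm (S b x - S a x) \<le> M * norm (S (b - a) x - x)" using bd[of a "\<tau> + 1"] that by (simp add: M_def)
      also have "\<dots> < M * (e / M)" using d(2)[of "b - a"] that M by (intro mult_strict_left_mono) auto
      finally show ?thesis using M by simp
    qed
    show "\<exists>d>0. \<forall>\<sigma>\<in>{0..}. dist \<sigma> \<tau> < d \<longrightarrow> dist (S \<sigma> x) (S \<tau> x) < e"
    proof (intro exI[of _ "min d 1"] conjI ballI impI)
      fix \<sigma> assume "\<sigma> \<in> {0..}" "dist \<sigma> \<tau> < min d 1"
      then show "dist (S \<sigma> x) (S \<tau> x) < e"
        using key[of \<sigma> \<tau>] key[of \<tau> \<sigma>] t by (cases "\<sigma> \<le> \<tau>") (auto simp: dist_norm norm_minus_commute)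
    qed (use d in simp)
  qed
  then show ?thesis using lin S0 add by (auto simp: C0_semigroup_def)
qed

section \<open>The Hilbert space on the Fourier side\<close>

text \<open>Where \<open>k \<le> norm \<xi> < k + 1\<close> the function is at most
  \<open>c k\<close>; enlarging this shell to a ball costs a volume proportional to
  \<open>(k + 1)^n\<close>. The exponent \<open>n + 2\<close> leaves a sum of inverse
  squares.\<close>

lemma integrable_decay: "integrable lborel (\<lambda>\<xi>::'a::euclidean_space. 1 / (1 + norm \<xi>) ^ (DIM('a) + 2))"
proof (rule integrableI_nonneg)
  define n where "n = DIM('a)"
  define c where "c k = 1 / real (Suc k) ^ (n + 2)" for k
  have V: "0 \<le> unit_ball_vol (real n)" by simp
  have "(\<integral>\<^sup>+(\<xi>::'a). ennreal (1 / (1 + norm \<xi>) ^ (n + 2)) \<partial>lborel)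
      \<le> (\<integral>\<^sup>+(\<xi>::'a). (\<Sum>k. ennreal (c k) * indicator (ball 0 (real (Suc k))) \<xi>) \<partial>lborel)"
  proof (rule nn_integral_mono)
    fix \<xi> :: 'a
    define k where "k = nat \<lfloor>norm \<xi>\<rfloor>"
    have k: "real k \<le> norm \<xi>" "norm \<xi> < real (Suc k)" unfolding k_def by (simp_all add: of_nat_floor) linarith
    have "1 / (1 + norm \<xi>) ^ (n + 2) \<le> c k"
      unfolding c_def using k by (intro divide_left_mono power_mono mult_pos_pos zero_less_power) auto
    then have "ennreal (1 / (1 + norm \<xi>) ^ (n + 2)) \<le> ennreal (c k) * indicator (ball 0 (real (Suc k))) \<xi>"
      using k by (simp add: ennreal_leI)
    also have "\<dots> \<le> (\<Sum>k. ennreal (c k) * indicator (ball 0 (real (Suc k))) \<xi>)"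
    proof -
      have "(\<Sum>j\<in>{k}. g j) \<le> (\<Sum>j. g j)" for g :: "nat \<Rightarrow> ennreal" by (rule sum_le_suminf) auto
      then have "g k \<le> (\<Sum>j. g j)" for g :: "nat \<Rightarrow> ennreal" by simp
      then show ?thesis .
    qed
    finally show "ennreal (1 / (1 + norm \<xi>) ^ (n + 2)) \<le> (\<Sum>k. ennreal (c k) * indicator (ball 0 (real (Suc k))) \<xi>)" .
  qed
  also have "\<dots> = (\<Sum>k. \<integral>\<^sup>+(\<xi>::'a). ennreal (c k) * indicator (ball 0 (real (Suc k))) \<xi> \<partial>lborel)"
    by (rule nn_integral_suminf) (intro borel_measurable_times_ennreal borel_measurable_const borel_measurable_indicator, simp)
  also have "\<dots> = (\<Sum>k. ennreal (unit_ball_vol (real n) * inverse (real (Suc k) ^ 2)))"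
  proof (rule suminf_cong)
    fix k
    have "(\<integral>\<^sup>+(\<xi>::'a). ennreal (c k) * indicator (ball 0 (real (Suc k))) \<xi> \<partial>lborel)
        = ennreal (c k) * ennreal (unit_ball_vol (real n) * real (Suc k) ^ n)"
      by (subst nn_integral_cmult_indicator) (auto simp: emeasure_ball n_def)
    also have "\<dots> = ennreal (c k * (unit_ball_vol (real n) * real (Suc k) ^ n))"
      using V by (intro ennreal_mult[symmetric]) (auto simp: c_def)
    also have "c k * (unit_ball_vol (real n) * real (Suc k) ^ n) = unit_ball_vol (real n) * inverse (real (Suc k) ^ 2)"
    proof -
      have "1 / K ^ (n + 2) * (V * K ^ n) = V * inverse (K ^ 2)" if "0 < K" for K V :: real
        using that by (simp add: power_add power2_eq_square field_simps)
      then show ?thesis unfolding c_def by simp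
    qed
    finally show "(\<integral>\<^sup>+(\<xi>::'a). ennreal (c k) * indicator (ball 0 (real (Suc k))) \<xi> \<partial>lborel) = ennreal (unit_ball_vol (real n) * inverse (real (Suc k) ^ 2))" .
  qed
  also have "\<dots> < \<infinity>"
  proof -
    have "summable (\<lambda>k. unit_ball_vol (real n) * inverse (real (Suc k) ^ 2))"
      using inverse_power_summable[of 2, where 'a = real] by (intro summable_mult) (subst summable_Suc_iff, simp)
    then have "(\<Sum>k. ennreal (unit_ball_vol (real n) * inverse (real (Suc k) ^ 2))) \<noteq> top"
      by (rule ennreal_suminf_neq_top) (intro mult_nonneg_nonneg V, simp)
    then show ?thesis unfolding infinity_ennreal_def less_top[symmetric] .
  qed
  finally show "(\<integral>\<^sup>+(\<xi>::'a). ennreal (1 / (1 + norm \<xi>) ^ (DIM('a) + 2)) \<partial>lborel) < \<infinity>" by (simp add: n_def)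
qed auto

lemma rapid_diff:
  assumes "rapid F" "rapid G"
  shows "rapid (\<lambda>i \<xi>. F i \<xi> - G i \<xi>)"
  unfolding rapid_def
proof
  fix m
  obtain C D where C: "\<And>i \<xi>. (1 + norm \<xi>) ^ m * norm (F i \<xi>) \<le> C" and D: "\<And>i \<xi>. (1 + norm \<xi>) ^ m * norm (G i \<xi>) \<le> D"
    using assms unfolding rapid_def by meson
  have "(1 + norm \<xi>) ^ m * norm (F i \<xi> - G i \<xi>) \<le> C + D" for i \<xi>
  proof -
    have "(1 + norm \<xi>) ^ m * norm (F i \<xi> - G i \<xi>) \<le> (1 + norm \<xi>) ^ m * (norm (F i \<xi>) + norm (G i \<xi>))"
      by (intro mult_left_mono norm_triangle_ineq4) auto
    also have "\<dots> \<le> C + D" using C[of \<xi> i] D[of \<xi> i] by (simp add: ring_distribs)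
    finally show ?thesis .
  qed
  then show "\<exists>C. \<forall>i \<xi>. (1 + norm \<xi>) ^ m * norm (F i \<xi> - G i \<xi>) \<le> C" by blast
qed

text \<open>A multiplier of polynomial growth costs \<open>p\<close> powers, which are taken from
  the bound for the exponent \<open>m + p\<close>.\<close>

lemma rapid_mult:
  assumes F: "rapid F" and a: "\<And>i \<xi>. norm (a i \<xi>) \<le> A * (1 + norm \<xi>) ^ p"
  shows "rapid (\<lambda>i \<xi>. a i \<xi> * F i \<xi>)"
  unfolding rapid_def
proof
  fix m
  obtain C where C: "\<And>i \<xi>. (1 + norm \<xi>) ^ (m + p) * norm (F i \<xi>) \<le> C"
    using F unfolding rapid_def by meson
  have "(1 + norm \<xi>) ^ m * norm (a i \<xi> * F i \<xi>) \<le> \<bar>A\<bar> * C" for i \<xi>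
  proof -
    have "norm (a i \<xi>) \<le> \<bar>A\<bar> * (1 + norm \<xi>) ^ p"
      using a[of i \<xi>] by (rule order_trans) (intro mult_right_mono, auto)
    then have "(1 + norm \<xi>) ^ m * (norm (a i \<xi>) * norm (F i \<xi>)) \<le> (1 + norm \<xi>) ^ m * (\<bar>A\<bar> * (1 + norm \<xi>) ^ p * norm (F i \<xi>))"
      by (intro mult_left_mono mult_right_mono) auto
    also have "\<dots> = \<bar>A\<bar> * ((1 + norm \<xi>) ^ (m + p) * norm (F i \<xi>))" by (simp add: power_add mult_ac)
    also have "\<dots> \<le> \<bar>A\<bar> * C" using C by (intro mult_left_mono) auto
    finally show ?thesis by (simp add: norm_mult)
  qed
  then show "\<exists>C. \<forall>i \<xi>. (1 + norm \<xi>) ^ m * norm (a i \<xi> * F i \<xi>) \<le> C" by blast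
qed

lemma rapid_cmult: "rapid F \<Longrightarrow> (\<And>i. norm (a i) \<le> A) \<Longrightarrow> rapid (\<lambda>i \<xi>. a i * F i \<xi>)"
  by (rule rapid_mult[where A = A and p = 0]) auto

lemma rapid_add:
  assumes "rapid F" "rapid G"
  shows "rapid (\<lambda>i \<xi>. F i \<xi> + G i \<xi>)"
  using rapid_diff[OF assms(1) rapid_cmult[OF assms(2), of "\<lambda>_. -1" 1]] by simp

text \<open>A factor of at least 1 moves the argument outwards, where the decay is stronger.\<close>

lemma rapid_dilate:
  assumes "rapid F" "\<And>i. 1 \<le> a i"
  shows "rapid (\<lambda>i \<xi>. F i (a i *\<^sub>R \<xi>))"
  unfolding rapid_def
proof
  fix m
  obtain C where C: "\<And>i \<xi>. (1 + norm \<xi>) ^ m * norm (F i \<xi>) \<le> C"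
    using assms(1) unfolding rapid_def by meson
  have "(1 + norm \<xi>) ^ m * norm (F i (a i *\<^sub>R \<xi>)) \<le> C" for i \<xi>
  proof -
    have "norm \<xi> \<le> norm (a i *\<^sub>R \<xi>)" using assms(2)[of i] by (simp add: mult_le_cancel_right1)
    then have "(1 + norm \<xi>) ^ m * norm (F i (a i *\<^sub>R \<xi>)) \<le> (1 + norm (a i *\<^sub>R \<xi>)) ^ m * norm (F i (a i *\<^sub>R \<xi>))"
      by (intro mult_right_mono power_mono) auto
    then show ?thesis using C order_trans by blast
  qed
  then show "\<exists>C. \<forall>i \<xi>. (1 + norm \<xi>) ^ m * norm (F i (a i *\<^sub>R \<xi>)) \<le> C" by blast
qed

text \<open>After the triangle inequality, the difference of the two sides times
  \<open>r * q\<close> is a perfect square. The free weights are chosen in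
  \<open>Nsq_triangle\<close>.\<close>

lemma norm_diff_sq_le:
  fixes x y :: complex
  assumes "0 < r" "0 < q" "r + q = 1"
  shows "(norm (x - y))\<^sup>2 \<le> (norm x)\<^sup>2 / r + (norm y)\<^sup>2 / q"
proof -
  have "(norm (x - y))\<^sup>2 \<le> (norm x + norm y)\<^sup>2" by (intro power_mono norm_triangle_ineq4) auto
  also have "\<dots> \<le> (norm x)\<^sup>2 / r + (norm y)\<^sup>2 / q"
  proof -
    define a where "a = norm x"
    define b where "b = norm y"
    have q: "q = 1 - r" using assms by simp
    have "(a\<^sup>2 / r + b\<^sup>2 / q - (a + b)\<^sup>2) * (r * q) = (q * a - r * b)\<^sup>2"
      using assms(1,2) unfolding q by (simp add: field_simps power2_eq_square)
    then have "0 \<le> (a\<^sup>2 / r + b\<^sup>2 / q - (a + b)\<^sup>2) * (r * q)" by simp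
    then have "0 \<le> a\<^sup>2 / r + b\<^sup>2 / q - (a + b)\<^sup>2" using assms by (simp add: zero_le_mult_iff mult_pos_pos) (metis mult_pos_pos not_less)
    then show ?thesis by (simp add: a_def b_def)
  qed
  finally show ?thesis .
qed

definition ft2 :: "'n::finite fpair \<Rightarrow> 'n fpair" where
  "ft2 u = (fourier (fst u), fourier (snd u))"

section \<open>The weighted norm on pairs of functions of the frequency\<close>

locale H_weights =
  fixes s1 s2 :: real
  assumes s1: "1 < s1" and s12: "s1 \<le> s2"
begin

text \<open>One weight for both components: the first component carries two more powers of
  \<open>r\<close>, which are left in \<open>dens\<close> to form the wave energy.\<close>

definition wt :: "real \<Rightarrow> real" where
  "wt r = (r powr (s1 - 1))\<^sup>2 + (if s1 < s2 then (r powr (s2 - 1))\<^sup>2 else 0)"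

definition dens :: "'n::finite fpair \<Rightarrow> real^'n \<Rightarrow> real" where
  "dens \<Phi> \<xi> = wt (norm \<xi>) * ((norm \<xi>)\<^sup>2 * (norm (fst \<Phi> \<xi>))\<^sup>2 + (norm (snd \<Phi> \<xi>))\<^sup>2)"

definition Nsq :: "'n::finite fpair \<Rightarrow> real" where
  "Nsq \<Phi> = (LINT \<xi>|lborel. dens \<Phi> \<xi>)"

text \<open>Integrability has to be recorded separately, because \<open>Nsq\<close> of a
  non-integrable density is 0 by the convention for the integral.\<close>

definition inX :: "'n::finite fpair \<Rightarrow> bool" where
  "inX \<Phi> \<longleftrightarrow> fst \<Phi> \<in> borel_measurable borel \<and> snd \<Phi> \<in> borel_measurable borel \<and> integrable lborel (dens \<Phi>)"

lemma wt_nonneg: "0 \<le> wt r" by (simp add: wt_def)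

lemma dens_nonneg: "0 \<le> dens \<Phi> \<xi>" by (simp add: dens_def wt_nonneg)

lemma Nsq_nonneg: "0 \<le> Nsq \<Phi>" by (simp add: Nsq_def dens_nonneg)

lemma wt_measurable [measurable]: "wt \<in> borel_measurable borel"
  unfolding wt_def[abs_def] by measurable

lemma dens_measurable [measurable]:
  assumes [measurable]: "fst \<Phi> \<in> borel_measurable borel" "snd \<Phi> \<in> borel_measurable borel"
  shows "dens \<Phi> \<in> borel_measurable borel"
  unfolding dens_def[abs_def] by measurable

lemma wt_le: "0 \<le> r \<Longrightarrow> wt r \<le> 2 * (1 + r) ^ (2 * nat \<lceil>s2\<rceil>)"
proof -
  assume r: "0 \<le> r"
  have p: "(r powr (s - 1))\<^sup>2 \<le> (1 + r) ^ (2 * nat \<lceil>s2\<rceil>)" if "1 < s" "s \<le> s2" for s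
  proof -
    have "r powr (s - 1) \<le> (1 + r) powr (s - 1)" using r that by (intro powr_mono2) auto
    also have "\<dots> \<le> (1 + r) powr (real (nat \<lceil>s2\<rceil>))" using r that by (intro powr_mono) linarith+
    also have "\<dots> = (1 + r) ^ nat \<lceil>s2\<rceil>" using r by (simp add: powr_realpow)
    finally have "(r powr (s - 1))\<^sup>2 \<le> ((1 + r) ^ nat \<lceil>s2\<rceil>)\<^sup>2" by (intro power_mono) auto
    then show ?thesis by (simp add: power_mult[symmetric] mult.commute)
  qed
  have nn: "0 \<le> (1 + r) ^ (2 * nat \<lceil>s2\<rceil>)" using r by simp
  show ?thesis
  proof (cases "s1 < s2")
    case True then show ?thesis using p[OF s1 s12] p[of s2] s1 by (simp add: wt_def)
  next
    case False
    then have "wt r = (r powr (s1 - 1))\<^sup>2" by (simp add: wt_def)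
    then show ?thesis using p[OF s1 s12] nn by linarith
  qed
qed

text \<open>Decay of this order makes the weighted density \<open>O((1 + |\<xi>|) ^ -(n + 2))\<close>, hence integrable.\<close>

definition rate :: "'n::finite itself \<Rightarrow> nat" where
  "rate T = nat \<lceil>s2\<rceil> + 1 + (CARD('n) + 2)"

lemma dens_le:
  fixes \<Phi> :: "'n::finite fpair"
  assumes C: "(1 + norm \<xi>) ^ rate TYPE('n) * norm (fst \<Phi> \<xi>) \<le> C" "(1 + norm \<xi>) ^ rate TYPE('n) * norm (snd \<Phi> \<xi>) \<le> C"
  shows "dens \<Phi> \<xi> \<le> 4 * C\<^sup>2 * (1 / (1 + norm \<xi>) ^ (DIM(real^'n) + 2))"
proof -
  define r where "r = 1 + norm \<xi>"
  define L where "L = rate TYPE('n)"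
  have r: "1 \<le> r" "norm \<xi> \<le> r" by (simp_all add: r_def)
  have sq: "r ^ (2 * L) * (norm z)\<^sup>2 \<le> C\<^sup>2" if "r ^ L * norm z \<le> C" for z :: complex
  proof -
    have "(r ^ L * norm z)\<^sup>2 \<le> C\<^sup>2" using that r by (intro power_mono) auto
    then show ?thesis by (simp add: power_mult_distrib power_mult[symmetric] mult.commute)
  qed
  have "(norm \<xi>)\<^sup>2 * (norm (fst \<Phi> \<xi>))\<^sup>2 + (norm (snd \<Phi> \<xi>))\<^sup>2 \<le> r\<^sup>2 * (norm (fst \<Phi> \<xi>))\<^sup>2 + r\<^sup>2 * (norm (snd \<Phi> \<xi>))\<^sup>2"
    using r by (intro add_mono mult_right_mono power_mono) (auto simp: mult_le_cancel_right1)
  then have "dens \<Phi> \<xi> \<le> (2 * r ^ (2 * nat \<lceil>s2\<rceil>)) * (r\<^sup>2 * ((norm (fst \<Phi> \<xi>))\<^sup>2 + (norm (snd \<Phi> \<xi>))\<^sup>2))"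
    unfolding dens_def using wt_le[of "norm \<xi>"] wt_nonneg by (intro mult_mono) (auto simp: r_def ring_distribs)
  also have "\<dots> = 2 * (r ^ (2 * nat \<lceil>s2\<rceil> + 2) * ((norm (fst \<Phi> \<xi>))\<^sup>2 + (norm (snd \<Phi> \<xi>))\<^sup>2))"
    by (simp add: power_add power2_eq_square)
  finally have "dens \<Phi> \<xi> * r ^ (CARD('n) + 2) \<le> 2 * (r ^ (2 * nat \<lceil>s2\<rceil> + 2 + (CARD('n) + 2)) * ((norm (fst \<Phi> \<xi>))\<^sup>2 + (norm (snd \<Phi> \<xi>))\<^sup>2))"
    using r by (auto simp: power_add mult_ac dest: mult_right_mono[where c = "r ^ (CARD('n) + 2)"])
  also have "\<dots> \<le> 2 * (r ^ (2 * L) * ((norm (fst \<Phi> \<xi>))\<^sup>2 + (norm (snd \<Phi> \<xi>))\<^sup>2))"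
    using r by (intro mult_left_mono mult_right_mono power_increasing) (auto simp: L_def rate_def)
  also have "\<dots> \<le> 4 * C\<^sup>2"
    using sq[OF C(1)[folded r_def L_def]] sq[OF C(2)[folded r_def L_def]] by (simp add: ring_distribs)
  finally have "dens \<Phi> \<xi> \<le> 4 * C\<^sup>2 / r ^ (CARD('n) + 2)" using r by (subst pos_le_divide_eq) auto
  then show ?thesis by (simp add: r_def)
qed

lemma dens_bound_rapid:
  fixes F1 F2 :: "'i \<Rightarrow> real^'n::finite \<Rightarrow> complex"
  assumes "rapid F1" "rapid F2"
  obtains w :: "real^'n \<Rightarrow> real" where "integrable lborel w" "\<And>i \<xi>. dens (F1 i, F2 i) \<xi> \<le> w \<xi>"
proof -
  obtain C1 C2 where C: "\<And>i \<xi>. (1 + norm \<xi>) ^ rate TYPE('n) * norm (F1 i \<xi>) \<le> C1" "\<And>i \<xi>. (1 + norm \<xi>) ^ rate TYPE('n) * norm (F2 i \<xi>) \<le> C2"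
    using assms unfolding rapid_def by meson
  define w where "w \<xi> = 4 * (max C1 C2)\<^sup>2 * (1 / (1 + norm \<xi>) ^ (DIM(real^'n) + 2))" for \<xi> :: "real^'n"
  have "integrable lborel w" unfolding w_def by (intro integrable_mult_right integrable_decay)
  moreover have "dens (F1 i, F2 i) \<xi> \<le> w \<xi>" for i \<xi>
    unfolding w_def by (rule dens_le) (use C[of \<xi> i] in \<open>auto simp: max_def\<close>)
  ultimately show ?thesis using that by blast
qed

lemma inX_rapid:
  assumes "rapid (\<lambda>_::unit. \<phi>1)" "rapid (\<lambda>_::unit. \<phi>2)" "\<phi>1 \<in> borel_measurable borel" "\<phi>2 \<in> borel_measurable borel"
  shows "inX (\<phi>1, \<phi>2)"
proof -
  obtain w where w: "integrable lborel w" "\<And>\<xi>. dens (\<phi>1, \<phi>2) \<xi> \<le> w \<xi>" using dens_bound_rapid[OF assms(1,2)] by metis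
  have "integrable lborel (dens (\<phi>1, \<phi>2))"
    by (rule Bochner_Integration.integrable_bound[OF w(1)])
       (use assms w(2) in \<open>auto simp: dens_nonneg dens_measurable intro: order_trans[OF _ abs_ge_self]\<close>)
  then show ?thesis using assms by (simp add: inX_def)
qed

lemma Nsq_tendsto_0:
  fixes F1 F2 :: "nat \<Rightarrow> real^'n::finite \<Rightarrow> complex"
  assumes "rapid F1" "rapid F2" and m: "\<And>k. F1 k \<in> borel_measurable borel" "\<And>k. F2 k \<in> borel_measurable borel"
    and l: "\<And>\<xi>. \<xi> \<noteq> 0 \<Longrightarrow> (\<lambda>k. F1 k \<xi>) \<longlonglongrightarrow> 0" "\<And>\<xi>. \<xi> \<noteq> 0 \<Longrightarrow> (\<lambda>k. F2 k \<xi>) \<longlonglongrightarrow> 0"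
  shows "(\<lambda>k. Nsq (F1 k, F2 k)) \<longlonglongrightarrow> 0"
proof -
  obtain w where w: "integrable lborel w" "\<And>k \<xi>. dens (F1 k, F2 k) \<xi> \<le> w \<xi>" using dens_bound_rapid[OF assms(1,2)] by metis
  have "(\<lambda>k. LINT \<xi>|lborel. dens (F1 k, F2 k) \<xi>) \<longlonglongrightarrow> (LINT (\<xi>::real^'n)|lborel. 0)"
  proof (rule integral_dominated_convergence[OF _ _ w(1)])
    show "dens (F1 k, F2 k) \<in> borel_measurable lborel" for k using m by (simp add: dens_measurable)
    show "AE \<xi> in lborel. (\<lambda>k. dens (F1 k, F2 k) \<xi>) \<longlonglongrightarrow> 0"
    proof (rule AE_I2)
      fix \<xi> :: "real^'n"
      show "(\<lambda>k. dens (F1 k, F2 k) \<xi>) \<longlonglongrightarrow> 0"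
      proof (cases "\<xi> = 0")
        \<comment> \<open>\<open>0 powr _ = 0\<close>, so the density vanishes at the origin, where
          no pointwise convergence is assumed.\<close>
        case True then show ?thesis by (simp add: dens_def wt_def)
      next
        case False
        have "(\<lambda>k. wt (norm \<xi>) * ((norm \<xi>)\<^sup>2 * (norm (F1 k \<xi>))\<^sup>2 + (norm (F2 k \<xi>))\<^sup>2)) \<longlonglongrightarrow> wt (norm \<xi>) * ((norm \<xi>)\<^sup>2 * (norm (0::complex))\<^sup>2 + (norm (0::complex))\<^sup>2)"
          by (intro tendsto_intros l False)
        then show ?thesis by (simp add: dens_def)
      qed
    qed
    show "AE \<xi> in lborel. norm (dens (F1 k, F2 k) \<xi>) \<le> w \<xi>" for k
      using w(2) by (simp add: dens_nonneg)
  qed simp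
  then show ?thesis by (simp add: Nsq_def)
qed

lemma dens_diff_le:
  assumes "0 < r" "0 < q" "r + q = 1"
  shows "dens (\<Phi> - \<Psi>) \<xi> \<le> dens \<Phi> \<xi> / r + dens \<Psi> \<xi> / q"
proof -
  have "(norm \<xi>)\<^sup>2 * (norm (fst \<Phi> \<xi> - fst \<Psi> \<xi>))\<^sup>2 + (norm (snd \<Phi> \<xi> - snd \<Psi> \<xi>))\<^sup>2
    \<le> (norm \<xi>)\<^sup>2 * ((norm (fst \<Phi> \<xi>))\<^sup>2 / r + (norm (fst \<Psi> \<xi>))\<^sup>2 / q) + ((norm (snd \<Phi> \<xi>))\<^sup>2 / r + (norm (snd \<Psi> \<xi>))\<^sup>2 / q)"
    by (intro add_mono mult_left_mono norm_diff_sq_le assms) auto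
  then have "dens (\<Phi> - \<Psi>) \<xi> \<le> wt (norm \<xi>) * ((norm \<xi>)\<^sup>2 * ((norm (fst \<Phi> \<xi>))\<^sup>2 / r + (norm (fst \<Psi> \<xi>))\<^sup>2 / q) + ((norm (snd \<Phi> \<xi>))\<^sup>2 / r + (norm (snd \<Psi> \<xi>))\<^sup>2 / q))"
    unfolding dens_def by (intro mult_left_mono wt_nonneg) simp
  also have "\<dots> = dens \<Phi> \<xi> / r + dens \<Psi> \<xi> / q"
    by (simp add: dens_def ring_distribs add_divide_distrib)
  finally show ?thesis .
qed

lemma inX_diff:
  assumes "inX \<Phi>" "inX \<Psi>"
  shows "inX (\<Phi> - \<Psi>)"
proof -
  have m: "fst (\<Phi> - \<Psi>) \<in> borel_measurable borel" "snd (\<Phi> - \<Psi>) \<in> borel_measurable borel"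
    using assms by (auto simp: inX_def fun_diff_def)
  have "integrable lborel (dens (\<Phi> - \<Psi>))"
  proof (rule Bochner_Integration.integrable_bound)
    show "integrable lborel (\<lambda>\<xi>. dens \<Phi> \<xi> / (1/2) + dens \<Psi> \<xi> / (1/2))" using assms by (simp add: inX_def)
    show "AE \<xi> in lborel. norm (dens (\<Phi> - \<Psi>) \<xi>) \<le> norm (dens \<Phi> \<xi> / (1/2) + dens \<Psi> \<xi> / (1/2))"
      using dens_diff_le[of "1/2" "1/2" \<Phi> \<Psi>] by (auto simp: dens_nonneg)
  qed (use m in \<open>simp add: dens_measurable\<close>)
  then show ?thesis using m by (simp add: inX_def)
qed

text \<open>Minkowski's inequality, obtained from \<open>dens_diff_le\<close> with weights
  proportional to the two norms.\<close>

lemma Nsq_triangle: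
  assumes "inX \<Phi>" "inX \<Psi>"
  shows "sqrt (Nsq (\<Phi> - \<Psi>)) \<le> sqrt (Nsq \<Phi>) + sqrt (Nsq \<Psi>)"
proof -
  define a where "a = sqrt (Nsq \<Phi>)"
  define b where "b = sqrt (Nsq \<Psi>)"
  have ab: "0 \<le> a" "0 \<le> b" by (simp_all add: a_def b_def Nsq_nonneg)
  have N: "Nsq \<Phi> = a\<^sup>2" "Nsq \<Psi> = b\<^sup>2" by (simp_all add: a_def b_def Nsq_nonneg)
  have ineq: "Nsq (\<Phi> - \<Psi>) \<le> (a + b + 2 * e) * (a + b)" if e: "0 < e" for e
  proof -
    define s where "s = a + b + 2 * e"
    \<comment> \<open>The shift by \<open>e\<close> keeps both weights positive when a norm
      vanishes; it is removed by a limit at the end.\<close>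
    define r where "r = (a + e) / s"
    define q where "q = (b + e) / s"
    have s: "0 < s" using ab e by (simp add: s_def)
    have rq: "0 < r" "0 < q" "r + q = 1"
      using ab e s by (simp_all add: r_def q_def add_divide_distrib[symmetric]) (simp add: s_def)
    have "Nsq (\<Phi> - \<Psi>) \<le> (LINT \<xi>|lborel. dens \<Phi> \<xi> / r + dens \<Psi> \<xi> / q)"
      unfolding Nsq_def using assms inX_diff[OF assms] by (intro integral_mono dens_diff_le[OF rq]) (simp_all add: inX_def)
    also have "\<dots> = a\<^sup>2 / r + b\<^sup>2 / q" using assms by (simp add: inX_def Nsq_def[symmetric] N)
    also have "a\<^sup>2 / r \<le> s * a"
    proof -
      have "a\<^sup>2 / r = s * (a * (a / (a + e)))" using ab e by (simp add: r_def power2_eq_square)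
      also have "\<dots> \<le> s * (a * 1)" using ab e s by (intro mult_left_mono) auto
      finally show ?thesis by simp
    qed
    also have "b\<^sup>2 / q \<le> s * b"
    proof -
      have "b\<^sup>2 / q = s * (b * (b / (b + e)))" using ab e by (simp add: q_def power2_eq_square)
      also have "\<dots> \<le> s * (b * 1)" using ab e s by (intro mult_left_mono) auto
      finally show ?thesis by simp
    qed
    finally show ?thesis by (simp add: s_def ring_distribs)
  qed
  have "((\<lambda>e. (a + b + 2 * e) * (a + b)) \<longlongrightarrow> (a + b + 2 * 0) * (a + b)) (at_right 0)"
    by (intro tendsto_intros)
  then have "Nsq (\<Phi> - \<Psi>) \<le> (a + b + 2 * 0) * (a + b)"
    by (rule tendsto_lowerbound) (auto intro: eventually_mono[OF eventually_at_right_less[of 0]] ineq)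
  then have "sqrt (Nsq (\<Phi> - \<Psi>)) \<le> sqrt ((a + b)\<^sup>2)" by (intro real_sqrt_le_mono) (simp add: power2_eq_square)
  then show ?thesis using ab by (simp add: a_def b_def)
qed

lemma Nsq_commute: "Nsq (\<Phi> - \<Psi>) = Nsq (\<Psi> - \<Phi>)"
  by (simp add: Nsq_def dens_def norm_minus_commute)

text \<open>The reverse triangle inequality for \<open>sqrt (Nsq _)\<close>, with the differences
  arranged so that \<open>Nsq_triangle\<close> gives both directions.\<close>

lemma Nsq_continuous:
  assumes X: "\<And>k. inX (\<Phi> k)" "inX \<Phi>'" "inX \<Psi>" and lim: "(\<lambda>k. Nsq (\<Phi> k - \<Phi>')) \<longlonglongrightarrow> 0"
  shows "(\<lambda>k. Nsq (\<Phi> k - \<Psi>)) \<longlonglongrightarrow> Nsq (\<Phi>' - \<Psi>)"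
proof -
  have le: "\<bar>sqrt (Nsq (\<Phi> k - \<Psi>)) - sqrt (Nsq (\<Phi>' - \<Psi>))\<bar> \<le> sqrt (Nsq (\<Phi> k - \<Phi>'))" for k
  proof -
    have "\<Phi> k - \<Psi> = (\<Phi> k - \<Phi>') - (\<Psi> - \<Phi>')" "\<Phi>' - \<Psi> = (\<Phi>' - \<Phi> k) - (\<Psi> - \<Phi> k)"
      by (auto simp: prod_eq_iff fun_diff_def)
    then show ?thesis
      using Nsq_triangle[of "\<Phi> k - \<Phi>'" "\<Psi> - \<Phi>'"] Nsq_triangle[of "\<Phi>' - \<Phi> k" "\<Psi> - \<Phi> k"] X
        Nsq_commute[of "\<Phi> k" \<Phi>'] Nsq_commute[of \<Psi>] by (simp add: inX_diff)
  qed
  have "(\<lambda>k. sqrt (Nsq (\<Phi> k - \<Phi>'))) \<longlonglongrightarrow> 0" using tendsto_real_sqrt[OF lim] by simp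
  then have "(\<lambda>k. sqrt (Nsq (\<Phi> k - \<Psi>)) - sqrt (Nsq (\<Phi>' - \<Psi>))) \<longlonglongrightarrow> 0"
    by (rule Lim_null_comparison[rotated]) (simp add: le)
  then have "(\<lambda>k. sqrt (Nsq (\<Phi> k - \<Psi>))) \<longlonglongrightarrow> sqrt (Nsq (\<Phi>' - \<Psi>))" by (rule Lim_null[THEN iffD2])
  from tendsto_power[OF this, of 2] show ?thesis by (simp add: Nsq_nonneg)
qed

lemma L0_domainD:
  assumes "u \<in> L0_domain"
  shows "fst u \<in> radial_test_functions" "snd u \<in> radial_test_functions"
    "smooth (fst u)" "csupp (fst u)" "smooth (snd u)" "csupp (snd u)"
  using assms by (auto simp: L0_domain_def radial_test_functions_iff)

lemma inX_ft2: "u \<in> L0_domain \<Longrightarrow> inX (ft2 u)"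
  unfolding ft2_def using L0_domainD[of u] by (intro inX_rapid rapid_fourier fourier_measurable)

lemma H_inner_self:
  fixes u :: "'n::finite fpair"
  assumes u: "u \<in> L0_domain"
  shows "H_inner s1 s2 u u = of_real (Nsq (ft2 u))"
proof -
  note d = L0_domainD[OF u]
  define d1 where "d1 s \<xi> = (norm \<xi> powr s)\<^sup>2 * (norm (fourier (fst u) \<xi>))\<^sup>2" for s and \<xi> :: "real^'n"
  define d2 where "d2 s \<xi> = (norm \<xi> powr s)\<^sup>2 * (norm (fourier (snd u) \<xi>))\<^sup>2" for s and \<xi> :: "real^'n"
  have h: "Hdot_inner s f f = of_real (LINT \<xi>|lborel. (norm \<xi> powr s)\<^sup>2 * (norm (fourier f \<xi>))\<^sup>2)" for s and f :: "real^'n \<Rightarrow> complex"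
  proof -
    have "complex_of_real (norm \<xi> powr s) * fourier f \<xi> * cnj (complex_of_real (norm \<xi> powr s) * fourier f \<xi>)
       = of_real ((norm \<xi> powr s)\<^sup>2 * (norm (fourier f \<xi>))\<^sup>2)" for \<xi> :: "real^'n"
      by (subst complex_norm_square[symmetric]) (simp add: norm_mult power_mult_distrib)
    then show ?thesis unfolding Hdot_inner_def L2_inner_def by (simp only: integral_complex_of_real)
  qed
  \<comment> \<open>Moves two powers of \<open>r\<close> out of the weight of the first component.
    At \<open>r = 0\<close> both sides are 0, since \<open>0 powr _ = 0\<close>.\<close>
  have pw: "(r powr s)\<^sup>2 = (r powr (s - 1))\<^sup>2 * r\<^sup>2" if "0 \<le> r" for r s :: real
    using that by (cases "r = 0") (simp_all add: powr_diff power_divide)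
  have m[measurable]: "fourier (fst u) \<in> borel_measurable borel" "fourier (snd u) \<in> borel_measurable borel"
    using d by (auto intro: fourier_measurable)
  have X: "integrable lborel (dens (ft2 u))" using inX_ft2[OF u] by (simp add: inX_def)
  \<comment> \<open>Each single Sobolev density lies below \<open>dens\<close>; it is therefore
    integrable, and the integral of the sum may be split.\<close>
  have le: "d1 s \<xi> \<le> dens (ft2 u) \<xi> \<and> d2 (s - 1) \<xi> \<le> dens (ft2 u) \<xi>" if "s = s1 \<or> (s = s2 \<and> s1 < s2)" for s \<xi>
  proof -
    have w: "(norm \<xi> powr (s - 1))\<^sup>2 \<le> wt (norm \<xi>)" using that by (auto simp: wt_def)
    have "d1 s \<xi> \<le> wt (norm \<xi>) * ((norm \<xi>)\<^sup>2 * (norm (fourier (fst u) \<xi>))\<^sup>2)"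
      unfolding d1_def using mult_right_mono[OF w, of "(norm \<xi>)\<^sup>2 * (norm (fourier (fst u) \<xi>))\<^sup>2"] by (subst pw) (simp_all add: mult_ac)
    moreover have "d2 (s - 1) \<xi> \<le> wt (norm \<xi>) * (norm (fourier (snd u) \<xi>))\<^sup>2"
      unfolding d2_def using w by (intro mult_right_mono) auto
    moreover have "0 \<le> wt (norm \<xi>) * ((norm \<xi>)\<^sup>2 * (norm (fourier (fst u) \<xi>))\<^sup>2)" "0 \<le> wt (norm \<xi>) * (norm (fourier (snd u) \<xi>))\<^sup>2"
      by (simp_all add: wt_nonneg)
    ultimately show ?thesis by (simp add: dens_def ft2_def ring_distribs)
  qed
  have int: "integrable lborel (d1 s) \<and> integrable lborel (d2 (s - 1))" if "s = s1 \<or> (s = s2 \<and> s1 < s2)" for s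
  proof
    show "integrable lborel (d1 s)"
      by (rule Bochner_Integration.integrable_bound[OF X])
         (use le[OF that] in \<open>auto simp: d1_def[abs_def] intro: order_trans[OF _ abs_ge_self]\<close>)
    show "integrable lborel (d2 (s - 1))"
      by (rule Bochner_Integration.integrable_bound[OF X])
         (use le[OF that] in \<open>auto simp: d2_def[abs_def] intro: order_trans[OF _ abs_ge_self]\<close>)
  qed
  show ?thesis
  proof (cases "s1 < s2")
    case True
    have "dens (ft2 u) = (\<lambda>\<xi>. (d1 s1 \<xi> + d1 s2 \<xi>) + (d2 (s1 - 1) \<xi> + d2 (s2 - 1) \<xi>))"
    proof
      fix \<xi> :: "real^'n"
      show "dens (ft2 u) \<xi> = (d1 s1 \<xi> + d1 s2 \<xi>) + (d2 (s1 - 1) \<xi> + d2 (s2 - 1) \<xi>)"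
        unfolding d1_def pw[OF norm_ge_zero, of \<xi> s1] pw[OF norm_ge_zero, of \<xi> s2] using True
        by (simp add: dens_def wt_def ft2_def d2_def algebra_simps)
    qed
    then show ?thesis using int[of s1] int[of s2] True
      by (simp add: H_inner_def Hdot_cap_inner_def h Nsq_def d1_def[symmetric] d2_def[symmetric])
  next
    case False
    have "dens (ft2 u) = (\<lambda>\<xi>. d1 s1 \<xi> + d2 (s1 - 1) \<xi>)"
    proof
      fix \<xi> :: "real^'n"
      show "dens (ft2 u) \<xi> = d1 s1 \<xi> + d2 (s1 - 1) \<xi>"
        unfolding d1_def pw[OF norm_ge_zero, of \<xi> s1] using False
        by (simp add: dens_def wt_def ft2_def d2_def algebra_simps)
    qed
    then show ?thesis using int[of s1] False
      by (simp add: H_inner_def Hdot_cap_inner_def h Nsq_def d1_def[symmetric] d2_def[symmetric])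
  qed
qed

end

section \<open>Elements of the completion and the functions that represent them\<close>

locale H_space = H_weights s1 s2 for s1 s2 +
  fixes \<iota> :: "'n::finite fpair \<Rightarrow> 'h::complex_hilbert"
  assumes completion: "H_completion s1 s2 \<iota>"
begin

lemma \<iota>_add:
  assumes "u \<in> L0_domain" "v \<in> L0_domain"
  shows "\<iota> (\<lambda>x. fst u x + fst v x, \<lambda>x. snd u x + snd v x) = \<iota> u + \<iota> v"
    "(\<lambda>x. fst u x + fst v x, \<lambda>x. snd u x + snd v x) \<in> L0_domain"
  using assms completion by (auto simp: H_completion_def L0_domain_def rt_add)

lemma \<iota>_scale:
  assumes "u \<in> L0_domain"
  shows "\<iota> (\<lambda>x. c * fst u x, \<lambda>x. c * snd u x) = c *\<^sub>C \<iota> u"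
    "(\<lambda>x. c * fst u x, \<lambda>x. c * snd u x) \<in> L0_domain"
  using assms completion by (auto simp: H_completion_def L0_domain_def rt_cmult)

lemma dense_\<iota>: "closure (\<iota> ` L0_domain) = UNIV"
  using completion by (simp add: H_completion_def)

lemma norm_\<iota>: "u \<in> L0_domain \<Longrightarrow> (norm (\<iota> u))\<^sup>2 = Nsq (ft2 u)"
proof -
  assume u: "u \<in> L0_domain"
  then have "cinner (\<iota> u) (\<iota> u) = H_inner s1 s2 u u" using completion by (simp add: H_completion_def)
  then have "complex_of_real ((norm (\<iota> u))\<^sup>2) = of_real (Nsq (ft2 u))"
    unfolding cinner_self H_inner_self[OF u] .
  then show ?thesis using of_real_eq_iff by blast
qed

lemma ft2_add:
  assumes "u \<in> L0_domain" "v \<in> L0_domain"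
  shows "ft2 (\<lambda>x. fst u x + fst v x, \<lambda>x. snd u x + snd v x)
     = (\<lambda>\<xi>. fst (ft2 u) \<xi> + fst (ft2 v) \<xi>, \<lambda>\<xi>. snd (ft2 u) \<xi> + snd (ft2 v) \<xi>)"
  using L0_domainD[OF assms(1)] L0_domainD[OF assms(2)] by (simp add: ft2_def fun_eq_iff fourier_add)

lemma ft2_scale:
  "ft2 (\<lambda>x. c * fst u x, \<lambda>x. c * snd u x) = (\<lambda>\<xi>. c * fst (ft2 u) \<xi>, \<lambda>\<xi>. c * snd (ft2 u) \<xi>)"
  by (simp add: ft2_def fun_eq_iff fourier_cmult)

lemma \<iota>_diff:
  assumes u: "u \<in> L0_domain" and v: "v \<in> L0_domain"
  shows "(norm (\<iota> u - \<iota> v))\<^sup>2 = Nsq (ft2 u - ft2 v)"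
proof -
  let ?w = "(\<lambda>x. (-1) * fst v x, \<lambda>x. (-1) * snd v x)"
  have w: "?w \<in> L0_domain" "\<iota> ?w = - \<iota> v" using \<iota>_scale[OF v, of "-1"] by (simp_all add: scaleC_minus1)
  have "ft2 (\<lambda>x. fst u x + fst ?w x, \<lambda>x. snd u x + snd ?w x) = ft2 u - ft2 v"
    unfolding ft2_add[OF u w(1)] ft2_scale by (simp add: prod_eq_iff fun_diff_def)
  then show ?thesis using norm_\<iota>[OF \<iota>_add(2)[OF u w(1)]] \<iota>_add(1)[OF u w(1)] w(2) by simp
qed

text \<open>\<open>Rep \<Phi> h\<close>: the pair \<open>\<Phi>\<close> is the Fourier transform of the abstract element \<open>h\<close>. Only distances
  to test functions enter, so no embedding of the completion into an \<open>L\<^sup>2\<close> space is needed.\<close>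

definition Rep :: "'n fpair \<Rightarrow> 'h \<Rightarrow> bool" where
  "Rep \<Phi> h \<longleftrightarrow> inX \<Phi> \<and> (\<forall>u\<in>L0_domain. (norm (h - \<iota> u))\<^sup>2 = Nsq (\<Phi> - ft2 u))"

lemma Rep_ft2: "u \<in> L0_domain \<Longrightarrow> Rep (ft2 u) (\<iota> u)"
  by (simp add: Rep_def inX_ft2 \<iota>_diff)

text \<open>Both sides of the equation in \<open>Rep\<close> are continuous. All facts about
  \<open>Rep\<close> beyond test pairs are obtained through this closedness.\<close>

lemma Rep_closed:
  assumes R: "\<And>k. Rep (\<Phi> k) (h k)" and h: "h \<longlonglongrightarrow> h'" and X: "inX \<Phi>'" and lim: "(\<lambda>k. Nsq (\<Phi> k - \<Phi>')) \<longlonglongrightarrow> 0"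
  shows "Rep \<Phi>' h'"
  unfolding Rep_def
proof (intro conjI ballI X)
  fix u :: "'n fpair" assume u: "u \<in> L0_domain"
  have "(\<lambda>k. (norm (h k - \<iota> u))\<^sup>2) \<longlonglongrightarrow> (norm (h' - \<iota> u))\<^sup>2"
    by (intro tendsto_intros h)
  moreover have "(\<lambda>k. (norm (h k - \<iota> u))\<^sup>2) = (\<lambda>k. Nsq (\<Phi> k - ft2 u))" using R u by (simp add: Rep_def)
  moreover have "(\<lambda>k. Nsq (\<Phi> k - ft2 u)) \<longlonglongrightarrow> Nsq (\<Phi>' - ft2 u)"
    using R X inX_ft2[OF u] lim by (intro Nsq_continuous) (auto simp: Rep_def)
  ultimately show "(norm (h' - \<iota> u))\<^sup>2 = Nsq (\<Phi>' - ft2 u)" using LIMSEQ_unique by metis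
qed

lemma Rep_approx:
  assumes "Rep \<Phi> h"
  obtains u where "\<And>k. u k \<in> L0_domain" "(\<lambda>k. \<iota> (u k)) \<longlonglongrightarrow> h" "(\<lambda>k. Nsq (ft2 (u k) - \<Phi>)) \<longlonglongrightarrow> 0"
proof -
  have "h \<in> closure (\<iota> ` L0_domain)" using dense_\<iota> by simp
  then obtain f where f: "\<forall>n. f n \<in> \<iota> ` L0_domain" "f \<longlonglongrightarrow> h" unfolding closure_sequential by blast
  then have "\<forall>n. \<exists>u\<in>L0_domain. f n = \<iota> u" by blast
  then obtain u where u: "\<And>n. u n \<in> L0_domain" "\<And>n. f n = \<iota> (u n)" by metis
  have "f = (\<lambda>k. \<iota> (u k))" using u(2) by auto
  then have lim: "(\<lambda>k. \<iota> (u k)) \<longlonglongrightarrow> h" using f(2) by simp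
  have "(\<lambda>k. (norm (h - \<iota> (u k)))\<^sup>2) \<longlonglongrightarrow> (norm (h - h))\<^sup>2" by (intro tendsto_intros lim)
  moreover have "(norm (h - \<iota> (u k)))\<^sup>2 = Nsq (ft2 (u k) - \<Phi>)" for k
    using assms u(1)[of k] Nsq_commute[of \<Phi> "ft2 (u k)"] by (simp add: Rep_def)
  moreover have "(norm (h - h))\<^sup>2 = 0" by simp
  ultimately have "(\<lambda>k. Nsq (ft2 (u k) - \<Phi>)) \<longlonglongrightarrow> 0" by (simp only:)
  then show ?thesis using that u(1) lim by blast
qed

text \<open>Convergence on the Fourier side makes the test pairs a Cauchy sequence, and completeness
  supplies the element.\<close>

lemma Rep_limit:
  assumes u: "\<And>k. u k \<in> L0_domain" and X: "inX \<Phi>" and lim: "(\<lambda>k. Nsq (ft2 (u k) - \<Phi>)) \<longlonglongrightarrow> 0"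
  obtains h where "Rep \<Phi> h" "(\<lambda>k. \<iota> (u k)) \<longlonglongrightarrow> h"
proof -
  have s: "(\<lambda>k. sqrt (Nsq (ft2 (u k) - \<Phi>))) \<longlonglongrightarrow> 0" using tendsto_real_sqrt[OF lim] by simp
  have le: "norm (\<iota> (u k) - \<iota> (u l)) \<le> sqrt (Nsq (ft2 (u k) - \<Phi>)) + sqrt (Nsq (ft2 (u l) - \<Phi>))" for k l
  proof -
    have "ft2 (u k) - ft2 (u l) = (ft2 (u k) - \<Phi>) - (ft2 (u l) - \<Phi>)" by (auto simp: prod_eq_iff fun_diff_def)
    then have "sqrt (Nsq (ft2 (u k) - ft2 (u l))) \<le> sqrt (Nsq (ft2 (u k) - \<Phi>)) + sqrt (Nsq (ft2 (u l) - \<Phi>))"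
      using Nsq_triangle inX_diff inX_ft2 u X by metis
    moreover have "norm (\<iota> (u k) - \<iota> (u l)) = sqrt (Nsq (ft2 (u k) - ft2 (u l)))"
      using \<iota>_diff[OF u u, of k l] by (metis norm_ge_zero real_sqrt_unique)
    ultimately show ?thesis by simp
  qed
  have "Cauchy (\<lambda>k. \<iota> (u k))"
  proof (rule CauchyI)
    fix e :: real assume "0 < e"
    then have "\<forall>\<^sub>F k in sequentially. sqrt (Nsq (ft2 (u k) - \<Phi>)) < e / 2"
      using order_tendstoD(2)[OF s, of "e / 2"] by simp
    then obtain M where "\<And>k. M \<le> k \<Longrightarrow> sqrt (Nsq (ft2 (u k) - \<Phi>)) < e / 2"
      unfolding eventually_sequentially by blast
    then show "\<exists>M. \<forall>m\<ge>M. \<forall>n\<ge>M. norm (\<iota> (u m) - \<iota> (u n)) < e"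
      using le by (intro exI[of _ M]) (smt (verit) field_sum_of_halves)
  qed
  then obtain h where h: "(\<lambda>k. \<iota> (u k)) \<longlonglongrightarrow> h" using Cauchy_convergent convergent_def by blast
  have "Rep \<Phi> h" by (rule Rep_closed[OF Rep_ft2[OF u] h X lim])
  then show ?thesis using that h by blast
qed

text \<open>Test pairs converging to \<open>h\<close> have the same distances from
  \<open>h'\<close>, so they converge to \<open>h'\<close> as well.\<close>

lemma Rep_unique:
  assumes "Rep \<Phi> h" "Rep \<Phi> h'"
  shows "h = h'"
proof -
  obtain u where u: "\<And>k. u k \<in> L0_domain" "(\<lambda>k. \<iota> (u k)) \<longlonglongrightarrow> h" using Rep_approx[OF assms(1)] by metis
  have eq: "(norm (h - \<iota> (u k)))\<^sup>2 = (norm (h' - \<iota> (u k)))\<^sup>2" for k using assms u(1) by (simp add: Rep_def)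
  have "(\<lambda>k. (norm (h - \<iota> (u k)))\<^sup>2) \<longlonglongrightarrow> (norm (h - h))\<^sup>2" "(\<lambda>k. (norm (h' - \<iota> (u k)))\<^sup>2) \<longlonglongrightarrow> (norm (h' - h))\<^sup>2"
    by (intro tendsto_intros u(2))+
  then have "(norm (h - h))\<^sup>2 = (norm (h' - h))\<^sup>2" unfolding eq using LIMSEQ_unique by metis
  then show ?thesis by simp
qed

lemma zero_L0_domain: "\<iota> (\<lambda>x. 0, \<lambda>x. 0) = 0" "((\<lambda>x. 0, \<lambda>x. 0) :: 'n fpair) \<in> L0_domain"
  "ft2 (\<lambda>x. 0, \<lambda>x. 0) = ((\<lambda>\<xi>. 0, \<lambda>\<xi>. 0) :: 'n fpair)"
proof -
  show d: "((\<lambda>x. 0, \<lambda>x. 0) :: 'n fpair) \<in> L0_domain"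
    by (simp add: L0_domain_def radial_test_functions_iff smooth_const csupp_zero radial_def)
  show "\<iota> (\<lambda>x. 0, \<lambda>x. 0) = 0" using \<iota>_scale(1)[OF d, of 0] by (simp add: scaleC_zero)
  show "ft2 (\<lambda>x. 0, \<lambda>x. 0) = ((\<lambda>\<xi>. 0, \<lambda>\<xi>. 0) :: 'n fpair)" by (simp add: ft2_def fourier_def fun_eq_iff)
qed

text \<open>The norm is the distance to the zero test pair.\<close>

lemma Rep_norm: "Rep \<Phi> h \<Longrightarrow> (norm h)\<^sup>2 = Nsq \<Phi>"
proof -
  assume "Rep \<Phi> h"
  then have "(norm (h - \<iota> (\<lambda>x. 0, \<lambda>x. 0)))\<^sup>2 = Nsq (\<Phi> - ft2 (\<lambda>x. 0, \<lambda>x. 0))"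
    using zero_L0_domain(2) by (simp add: Rep_def)
  moreover have "\<Phi> - (\<lambda>\<xi>. 0, \<lambda>\<xi>. 0) = \<Phi>" by (simp add: prod_eq_iff fun_diff_def)
  ultimately show ?thesis by (simp add: zero_L0_domain)
qed

lemma Rep_diff:
  assumes "Rep \<Phi> h" "Rep \<Psi> k"
  shows "Rep (\<Phi> - \<Psi>) (h - k)"
proof -
  obtain u where u: "\<And>k. u k \<in> L0_domain" "(\<lambda>k. \<iota> (u k)) \<longlonglongrightarrow> h" "(\<lambda>k. Nsq (ft2 (u k) - \<Phi>)) \<longlonglongrightarrow> 0"
    using Rep_approx[OF assms(1)] by metis
  obtain v where v: "\<And>k. v k \<in> L0_domain" "(\<lambda>j. \<iota> (v j)) \<longlonglongrightarrow> k" "(\<lambda>k. Nsq (ft2 (v k) - \<Psi>)) \<longlonglongrightarrow> 0"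
    using Rep_approx[OF assms(2)] by metis
  have X: "inX \<Phi>" "inX \<Psi>" using assms by (auto simp: Rep_def)
  \<comment> \<open>The difference of two test pairs, written as a sum with a multiple by -1 to fit
    \<open>\<iota>_add\<close> and \<open>\<iota>_scale\<close>.\<close>
  define w where "w j = (\<lambda>x. fst (u j) x + fst (\<lambda>x. (-1) * fst (v j) x, \<lambda>x. (-1) * snd (v j) x) x,
      \<lambda>x. snd (u j) x + snd (\<lambda>x. (-1) * fst (v j) x, \<lambda>x. (-1) * snd (v j) x) x)" for j
  have w: "w j \<in> L0_domain" "\<iota> (w j) = \<iota> (u j) - \<iota> (v j)" for j
  proof -
    show "w j \<in> L0_domain" unfolding w_def by (rule \<iota>_add(2)[OF u(1) \<iota>_scale(2)[OF v(1)]])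
    show "\<iota> (w j) = \<iota> (u j) - \<iota> (v j)"
      unfolding w_def \<iota>_add(1)[OF u(1) \<iota>_scale(2)[OF v(1)]] \<iota>_scale(1)[OF v(1)] scaleC_minus1 by simp
  qed
  have "ft2 (w j) = ft2 (u j) - ft2 (v j)" for j
    unfolding w_def ft2_add[OF u(1)[of j] \<iota>_scale(2)[OF v(1)[of j], of "-1"]] ft2_scale by (simp add: prod_eq_iff fun_diff_def)
  then have "ft2 (w j) - (\<Phi> - \<Psi>) = (ft2 (u j) - \<Phi>) - (ft2 (v j) - \<Psi>)" for j by (auto simp: prod_eq_iff fun_diff_def)
  then have le: "sqrt (Nsq (ft2 (w j) - (\<Phi> - \<Psi>))) \<le> sqrt (Nsq (ft2 (u j) - \<Phi>)) + sqrt (Nsq (ft2 (v j) - \<Psi>))" for j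
    using Nsq_triangle inX_diff inX_ft2 u(1) v(1) X by metis
  have "(\<lambda>j. sqrt (Nsq (ft2 (u j) - \<Phi>)) + sqrt (Nsq (ft2 (v j) - \<Psi>))) \<longlonglongrightarrow> sqrt 0 + sqrt 0"
    by (intro tendsto_intros u v)
  then have lim0: "(\<lambda>j. sqrt (Nsq (ft2 (u j) - \<Phi>)) + sqrt (Nsq (ft2 (v j) - \<Psi>))) \<longlonglongrightarrow> 0" by simp
  have "(\<lambda>j. sqrt (Nsq (ft2 (w j) - (\<Phi> - \<Psi>)))) \<longlonglongrightarrow> 0"
    by (rule Lim_null_comparison[OF _ lim0]) (simp add: le Nsq_nonneg)
  from tendsto_power[OF this, of 2] have lim2: "(\<lambda>j. Nsq (ft2 (w j) - (\<Phi> - \<Psi>))) \<longlonglongrightarrow> 0" by (simp add: Nsq_nonneg)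
  have lim1: "(\<lambda>j. \<iota> (w j)) \<longlonglongrightarrow> h - k" unfolding w(2) by (intro tendsto_diff u v)
  show ?thesis by (rule Rep_closed[OF Rep_ft2[OF w(1)] lim1 inX_diff[OF X] lim2])
qed

lemma dens_scale: "dens (\<lambda>\<xi>. c * fst \<Phi> \<xi>, \<lambda>\<xi>. c * snd \<Phi> \<xi>) \<xi> = (norm c)\<^sup>2 * dens \<Phi> \<xi>"
  by (simp add: dens_def norm_mult power_mult_distrib algebra_simps)

lemma Nsq_scale: "Nsq (\<lambda>\<xi>. c * fst \<Phi> \<xi>, \<lambda>\<xi>. c * snd \<Phi> \<xi>) = (norm c)\<^sup>2 * Nsq \<Phi>"
  unfolding Nsq_def dens_scale by simp

lemma Rep_scale:
  assumes "Rep \<Phi> h"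
  shows "Rep (\<lambda>\<xi>. c * fst \<Phi> \<xi>, \<lambda>\<xi>. c * snd \<Phi> \<xi>) (c *\<^sub>C h)"
proof -
  obtain u where u: "\<And>k. u k \<in> L0_domain" "(\<lambda>k. \<iota> (u k)) \<longlonglongrightarrow> h" "(\<lambda>k. Nsq (ft2 (u k) - \<Phi>)) \<longlonglongrightarrow> 0"
    using Rep_approx[OF assms(1)] by metis
  define w where "w j = (\<lambda>x. c * fst (u j) x, \<lambda>x. c * snd (u j) x)" for j
  have w: "w j \<in> L0_domain" "\<iota> (w j) = c *\<^sub>C \<iota> (u j)" for j
    unfolding w_def using \<iota>_scale[OF u(1)[of j], of c] by simp_all
  show ?thesis
  proof (rule Rep_closed[OF Rep_ft2[OF w(1)]])
    show "(\<lambda>j. \<iota> (w j)) \<longlonglongrightarrow> c *\<^sub>C h" unfolding w(2) by (intro tendsto_scaleC u)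
    have X: "inX \<Phi>" using assms by (simp add: Rep_def)
    then show "inX (\<lambda>\<xi>. c * fst \<Phi> \<xi>, \<lambda>\<xi>. c * snd \<Phi> \<xi>)"
      by (auto simp: inX_def dens_scale[abs_def])
    have "ft2 (w j) - (\<lambda>\<xi>. c * fst \<Phi> \<xi>, \<lambda>\<xi>. c * snd \<Phi> \<xi>)
        = (\<lambda>\<xi>. c * fst (ft2 (u j) - \<Phi>) \<xi>, \<lambda>\<xi>. c * snd (ft2 (u j) - \<Phi>) \<xi>)" for j
      unfolding w_def ft2_scale by (simp add: prod_eq_iff fun_eq_iff fun_diff_def right_diff_distrib)
    then have "Nsq (ft2 (w j) - (\<lambda>\<xi>. c * fst \<Phi> \<xi>, \<lambda>\<xi>. c * snd \<Phi> \<xi>)) = (norm c)\<^sup>2 * Nsq (ft2 (u j) - \<Phi>)" for j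
      by (simp only: Nsq_scale)
    then show "(\<lambda>j. Nsq (ft2 (w j) - (\<lambda>\<xi>. c * fst \<Phi> \<xi>, \<lambda>\<xi>. c * snd \<Phi> \<xi>))) \<longlonglongrightarrow> 0"
      using u(3) by (auto intro: tendsto_mult_right_zero)
  qed
qed

end

section \<open>The semigroup on the Fourier side\<close>

definition coA :: "'n::finite itself \<Rightarrow> real \<Rightarrow> real \<Rightarrow> real" where
  "coA T \<tau> r = exp ((real CARD('n) - 2) * \<tau>) * cos ((exp \<tau> - 1) * r)"
definition coB :: "'n::finite itself \<Rightarrow> real \<Rightarrow> real \<Rightarrow> real" where
  "coB T \<tau> r = exp ((real CARD('n) - 3) * \<tau>) * (sin ((exp \<tau> - 1) * r) / r)"
definition coC :: "'n::finite itself \<Rightarrow> real \<Rightarrow> real \<Rightarrow> real" where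
  "coC T \<tau> r = exp ((real CARD('n) - 3) * \<tau>) * cos ((exp \<tau> - 1) * r)"
definition coD :: "'n::finite itself \<Rightarrow> real \<Rightarrow> real \<Rightarrow> real" where
  "coD T \<tau> r = exp ((real CARD('n) - 2) * \<tau>) * (r * sin ((exp \<tau> - 1) * r))"

text \<open>For radial \<open>\<Phi>\<close> and \<open>v\<^sub>1 = r \<Phi>\<^sub>1\<close>, \<open>v\<^sub>2 = \<Phi>\<^sub>2\<close>, multiplying \<open>v\<^sub>1 \<plusminus> \<i> v\<^sub>2\<close> by \<open>exp (\<mp>\<i>r)\<close> turns the
  transformed equation into the pure dilation equation \<open>y' = r \<partial>\<^sub>r y + (n - 3) y\<close>; undoing this
  gives the formula below.\<close>

definition Ssym :: "real \<Rightarrow> 'n::finite fpair \<Rightarrow> 'n fpair" where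
  "Ssym \<tau> \<Phi> =
    (\<lambda>\<xi>. of_real (coA TYPE('n) \<tau> (norm \<xi>)) * fst \<Phi> (exp \<tau> *\<^sub>R \<xi>) + of_real (coB TYPE('n) \<tau> (norm \<xi>)) * snd \<Phi> (exp \<tau> *\<^sub>R \<xi>),
     \<lambda>\<xi>. of_real (coC TYPE('n) \<tau> (norm \<xi>)) * snd \<Phi> (exp \<tau> *\<^sub>R \<xi>) - of_real (coD TYPE('n) \<tau> (norm \<xi>)) * fst \<Phi> (exp \<tau> *\<^sub>R \<xi>))"

lemma Ssym_0: "Ssym 0 \<Phi> = \<Phi>"
  by (simp add: Ssym_def coA_def coB_def coC_def coD_def prod_eq_iff)

lemma Ssym_diff: "Ssym \<tau> (\<Phi> - \<Psi>) = Ssym \<tau> \<Phi> - Ssym \<tau> \<Psi>"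
  by (simp add: Ssym_def prod_eq_iff fun_eq_iff algebra_simps)

lemma Ssym_scale: "Ssym \<tau> (\<lambda>\<xi>. c * fst \<Phi> \<xi>, \<lambda>\<xi>. c * snd \<Phi> \<xi>) = (\<lambda>\<xi>. c * fst (Ssym \<tau> \<Phi>) \<xi>, \<lambda>\<xi>. c * snd (Ssym \<tau> \<Phi>) \<xi>)"
  by (simp add: Ssym_def fun_eq_iff algebra_simps)

text \<open>Addition theorems for sine and cosine. The phases add up because the second flow sees
  the frequency \<open>exp \<sigma> * r\<close>.\<close>

lemma co_add:
  shows "coA T (\<sigma> + \<tau>) r = coA T \<sigma> r * coA T \<tau> (exp \<sigma> * r) - coB T \<sigma> r * coD T \<tau> (exp \<sigma> * r)"
    and "coB T (\<sigma> + \<tau>) r = coA T \<sigma> r * coB T \<tau> (exp \<sigma> * r) + coB T \<sigma> r * coC T \<tau> (exp \<sigma> * r)"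
    and "coC T (\<sigma> + \<tau>) r = coC T \<sigma> r * coC T \<tau> (exp \<sigma> * r) - coD T \<sigma> r * coB T \<tau> (exp \<sigma> * r)"
    and "coD T (\<sigma> + \<tau>) r = coC T \<sigma> r * coD T \<tau> (exp \<sigma> * r) + coD T \<sigma> r * coA T \<tau> (exp \<sigma> * r)"
proof -
  define \<alpha> where "\<alpha> = (exp \<sigma> - 1) * r"
  define \<beta> where "\<beta> = (exp \<tau> - 1) * (exp \<sigma> * r)"
  have sum: "(exp (\<sigma> + \<tau>) - 1) * r = \<alpha> + \<beta>" by (simp add: \<alpha>_def \<beta>_def exp_add algebra_simps)
  define x where "x = exp ((real CARD('a) - 3) * \<sigma>)"
  define y where "y = exp ((real CARD('a) - 3) * \<tau>)"
  have e3: "exp ((real CARD('a) - 3) * (\<sigma> + \<tau>)) = x * y" by (simp add: x_def y_def exp_add[symmetric] ring_distribs)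
  have e2: "exp ((real CARD('a) - 2) * s) = exp ((real CARD('a) - 3) * s) * exp s" for s
    by (simp add: exp_add[symmetric] algebra_simps)
  have e2s: "exp ((real CARD('a) - 2) * (\<sigma> + \<tau>)) = x * y * (exp \<sigma> * exp \<tau>)" unfolding e2 e3 by (simp add: exp_add)
  note defs = coA_def coB_def coC_def coD_def sum e3 e2s e2 \<alpha>_def[symmetric] \<beta>_def[symmetric] x_def[symmetric] y_def[symmetric]
  \<comment> \<open>At \<open>r = 0\<close> the quotient in \<open>coB\<close> is 0 by the
    convention for division; the identities also hold with this value.\<close>
  have r0: "\<alpha> = 0" "\<beta> = 0" if "r = 0" using that by (simp_all add: \<alpha>_def \<beta>_def)
  show "coA T (\<sigma> + \<tau>) r = coA T \<sigma> r * coA T \<tau> (exp \<sigma> * r) - coB T \<sigma> r * coD T \<tau> (exp \<sigma> * r)"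
    unfolding defs by (cases "r = 0") (simp_all add: r0 cos_add exp_add algebra_simps)
  show "coB T (\<sigma> + \<tau>) r = coA T \<sigma> r * coB T \<tau> (exp \<sigma> * r) + coB T \<sigma> r * coC T \<tau> (exp \<sigma> * r)"
    unfolding defs by (cases "r = 0") (simp_all add: r0 sin_add exp_add field_simps)
  show "coC T (\<sigma> + \<tau>) r = coC T \<sigma> r * coC T \<tau> (exp \<sigma> * r) - coD T \<sigma> r * coB T \<tau> (exp \<sigma> * r)"
    unfolding defs by (cases "r = 0") (simp_all add: r0 cos_add exp_add field_simps)
  show "coD T (\<sigma> + \<tau>) r = coC T \<sigma> r * coD T \<tau> (exp \<sigma> * r) + coD T \<sigma> r * coA T \<tau> (exp \<sigma> * r)"
    unfolding defs by (simp add: sin_add exp_add algebra_simps)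
qed

lemma Ssym_add: "Ssym (\<sigma> + \<tau>) \<Phi> = Ssym \<sigma> (Ssym \<tau> \<Phi>)"
proof -
  have e: "exp (\<sigma> + \<tau>) *\<^sub>R \<xi> = exp \<tau> *\<^sub>R exp \<sigma> *\<^sub>R \<xi>" for \<xi> :: "real^'a" by (simp add: exp_add mult.commute)
  show ?thesis by (simp add: Ssym_def fun_eq_iff e co_add algebra_simps)
qed

lemma Ssym_measurable:
  assumes [measurable]: "fst \<Phi> \<in> borel_measurable borel" "snd \<Phi> \<in> borel_measurable borel"
  shows "fst (Ssym \<tau> \<Phi>) \<in> borel_measurable borel" "snd (Ssym \<tau> \<Phi>) \<in> borel_measurable borel"
  unfolding Ssym_def coA_def coB_def coC_def coD_def fst_conv snd_conv by measurable

text \<open>The coefficients grow at most linearly in \<open>norm \<xi>\<close>, the linear growth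
  coming from \<open>coD\<close>, and for nonnegative times the dilation points outwards. Uniformity
  over bounded times serves the dominated convergence of difference quotients.\<close>

lemma rapid_Ssym:
  fixes u :: "'n::finite fpair" and g :: "'i \<Rightarrow> real"
  assumes u: "u \<in> L0_domain" and g: "\<And>i. 0 \<le> g i" "\<And>i. g i \<le> T"
  shows "rapid (\<lambda>i. fst (Ssym (g i) (ft2 u)))" "rapid (\<lambda>i. snd (Ssym (g i) (ft2 u)))"
proof -
  define M where "M = exp (real CARD('n) * T)"
  have d: "smooth (fst u)" "csupp (fst u)" "smooth (snd u)" "csupp (snd u)"
    using u by (auto simp: L0_domain_def radial_test_functions_iff)
  have r: "rapid (\<lambda>i::'i. \<lambda>\<xi>. fourier (fst u) (exp (g i) *\<^sub>R \<xi>))" "rapid (\<lambda>i::'i. \<lambda>\<xi>. fourier (snd u) (exp (g i) *\<^sub>R \<xi>))"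
    using rapid_dilate[OF rapid_fourier[OF d(1,2)], of "\<lambda>i. exp (g i)"] rapid_dilate[OF rapid_fourier[OF d(3,4)], of "\<lambda>i. exp (g i)"] g
    by auto
  have E: "exp ((real CARD('n) - j) * g i) \<le> M" if "0 \<le> j" for i j
  proof -
    have "(real CARD('n) - j) * g i \<le> real CARD('n) * g i" using that g(1)[of i] by (intro mult_right_mono) auto
    also have "\<dots> \<le> real CARD('n) * T" using g(2)[of i] by (intro mult_left_mono) auto
    finally show ?thesis by (simp add: M_def)
  qed
  have M: "0 < M" by (simp add: M_def)
  have A: "norm (complex_of_real (coA TYPE('n) (g i) (norm \<xi>))) \<le> M * (1 + norm \<xi>) ^ 1" for i and \<xi> :: "real^'n"
  proof -
    have "norm (complex_of_real (coA TYPE('n) (g i) (norm \<xi>))) \<le> M * 1"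
      unfolding coA_def norm_of_real abs_mult using E[of 2 i] M by (intro mult_mono) auto
    also have "\<dots> \<le> M * (1 + norm \<xi>) ^ 1" using M by (intro mult_left_mono) auto
    finally show ?thesis .
  qed
  have C: "norm (complex_of_real (coC TYPE('n) (g i) (norm \<xi>))) \<le> M * (1 + norm \<xi>) ^ 1" for i and \<xi> :: "real^'n"
  proof -
    have "norm (complex_of_real (coC TYPE('n) (g i) (norm \<xi>))) \<le> M * 1"
      unfolding coC_def norm_of_real abs_mult using E[of 3 i] M by (intro mult_mono) auto
    also have "\<dots> \<le> M * (1 + norm \<xi>) ^ 1" using M by (intro mult_left_mono) auto
    finally show ?thesis .
  qed
  have B: "norm (complex_of_real (coB TYPE('n) (g i) (norm \<xi>))) \<le> M * (1 + norm \<xi>) ^ 1" for i and \<xi> :: "real^'n"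
  proof -
    have e1: "0 \<le> exp (g i) - 1" using g(1)[of i] by simp
    have "\<bar>sin ((exp (g i) - 1) * norm \<xi>)\<bar> \<le> (exp (g i) - 1) * norm \<xi>"
      using abs_sin_x_le_abs_x[of "(exp (g i) - 1) * norm \<xi>"] e1 by simp
    then have "\<bar>sin ((exp (g i) - 1) * norm \<xi>) / norm \<xi>\<bar> \<le> exp (g i) - 1"
      using e1 by (cases "\<xi> = 0") (simp_all add: divide_le_eq)
    also have "\<dots> \<le> exp (g i)" by simp
    finally have "norm (complex_of_real (coB TYPE('n) (g i) (norm \<xi>))) \<le> exp ((real CARD('n) - 3) * g i) * exp (g i)"
      unfolding coB_def norm_of_real abs_mult by (intro mult_mono) auto
    also have "\<dots> = exp ((real CARD('n) - 2) * g i)" by (simp add: exp_add[symmetric] algebra_simps)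
    also have "\<dots> \<le> M * 1" using E[of 2 i] by simp
    also have "\<dots> \<le> M * (1 + norm \<xi>) ^ 1" using M by (intro mult_left_mono) auto
    finally show ?thesis .
  qed
  have D: "norm (complex_of_real (- coD TYPE('n) (g i) (norm \<xi>))) \<le> M * (1 + norm \<xi>) ^ 1" for i and \<xi> :: "real^'n"
  proof -
    have "\<bar>norm \<xi> * sin ((exp (g i) - 1) * norm \<xi>)\<bar> \<le> norm \<xi> * 1"
      unfolding abs_mult by (intro mult_mono) auto
    then have "norm (complex_of_real (- coD TYPE('n) (g i) (norm \<xi>))) \<le> M * (norm \<xi> * 1)"
      unfolding coD_def norm_of_real abs_minus_cancel abs_mult[of "exp _"] using E[of 2 i] M by (intro mult_mono) auto
    also have "\<dots> \<le> M * (1 + norm \<xi>) ^ 1" using M by (intro mult_left_mono) auto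
    finally show ?thesis .
  qed
  show "rapid (\<lambda>i. fst (Ssym (g i) (ft2 u)))"
    using rapid_add[OF rapid_mult[OF r(1) A] rapid_mult[OF r(2) B]] by (simp add: Ssym_def ft2_def)
  show "rapid (\<lambda>i. snd (Ssym (g i) (ft2 u)))"
    using rapid_add[OF rapid_mult[OF r(2) C] rapid_mult[OF r(1) D]] by (simp add: Ssym_def ft2_def)
qed

text \<open>A real rotation acts on real and imaginary parts separately.\<close>

lemma norm_rotate:
  fixes a b :: complex and c s :: real
  assumes "c\<^sup>2 + s\<^sup>2 = 1"
  shows "(norm (of_real c * a + of_real s * b))\<^sup>2 + (norm (of_real c * b - of_real s * a))\<^sup>2 = (norm a)\<^sup>2 + (norm b)\<^sup>2"
proof -
  have "(c * x + s * y)\<^sup>2 + (c * y - s * x)\<^sup>2 = x\<^sup>2 + y\<^sup>2" for x y :: real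
  proof -
    have "(c * x + s * y)\<^sup>2 + (c * y - s * x)\<^sup>2 = (c\<^sup>2 + s\<^sup>2) * (x\<^sup>2 + y\<^sup>2)" by (simp add: power2_eq_square algebra_simps)
    then show ?thesis by (simp add: assms)
  qed
  from this[of "Re a" "Re b"] this[of "Im a" "Im b"] show ?thesis by (simp add: cmod_power2)
qed

lemma integrable_lborel_scaleR:
  fixes f :: "'a::euclidean_space \<Rightarrow> real"
  assumes f: "integrable lborel f" and c: "0 < c"
  shows "integrable lborel (\<lambda>x. f (c *\<^sub>R x))"
proof -
  have [measurable]: "f \<in> borel_measurable borel" using f by simp
  have "integrable (density (distr lborel borel (\<lambda>x. 0 + c *\<^sub>R x)) (\<lambda>_. ennreal (\<bar>c\<bar> ^ DIM('a)))) f"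
    using lborel_affine[of c "0::'a"] c f by simp
  then have "integrable lborel (\<lambda>x. c ^ DIM('a) *\<^sub>R f (c *\<^sub>R x))"
    using c by (subst (asm) integrable_density) (auto simp: integrable_distr_eq)
  then show ?thesis using c by simp
qed

section \<open>The growth bound on the Fourier side\<close>

context H_weights
begin

text \<open>Both powers are homogeneous, and for nonnegative times the smaller exponent
  \<open>s1\<close> gives the weaker gain.\<close>

lemma wt_dilate:
  assumes "0 \<le> \<tau>" "0 \<le> r"
  shows "wt r * exp (2 * (s1 - 1) * \<tau>) \<le> wt (exp \<tau> * r)"
proof -
  have p: "((exp \<tau> * r) powr s)\<^sup>2 = (r powr s)\<^sup>2 * exp (2 * s * \<tau>)" for s
  proof -
    have "(exp \<tau> powr s)\<^sup>2 = exp (2 * s * \<tau>)" by (simp add: powr_def exp_double[symmetric] mult_ac)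
    then show ?thesis using assms by (simp add: powr_mult power_mult_distrib)
  qed
  have "exp (2 * (s1 - 1) * \<tau>) \<le> exp (2 * (s2 - 1) * \<tau>)" using assms s12 by (simp add: mult_right_mono)
  then have "(r powr (s2 - 1))\<^sup>2 * exp (2 * (s1 - 1) * \<tau>) \<le> (r powr (s2 - 1))\<^sup>2 * exp (2 * (s2 - 1) * \<tau>)"
    by (intro mult_left_mono) auto
  then show ?thesis by (simp add: wt_def p ring_distribs)
qed

text \<open>In the variables \<open>r * fst \<Phi>\<close> and \<open>snd \<Phi>\<close> the flow is
  a rotation by \<open>\<theta>\<close>, a dilation and the scalar
  \<open>exp ((n - 3) * \<tau>)\<close>. The square of the scalar contributes
  \<open>2 (n - 3)\<close> to the exponent, and \<open>wt_dilate\<close> removes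
  \<open>2 (s1 - 1)\<close>.\<close>

lemma dens_Ssym_le:
  fixes \<Phi> :: "'n::finite fpair"
  assumes "0 \<le> \<tau>"
  shows "dens (Ssym \<tau> \<Phi>) \<xi> \<le> exp ((2 * real CARD('n) - 4 - 2 * s1) * \<tau>) * dens \<Phi> (exp \<tau> *\<^sub>R \<xi>)"
proof (cases "\<xi> = 0")
  case True
  then show ?thesis by (simp add: dens_def wt_def)
next
  case False
  define r where "r = norm \<xi>"
  define \<theta> where "\<theta> = (exp \<tau> - 1) * r"
  define e where "e = exp ((real CARD('n) - 3) * \<tau>)"
  define R where "R = exp \<tau> * r"
  define a where "a = fst \<Phi> (exp \<tau> *\<^sub>R \<xi>)"
  define b where "b = snd \<Phi> (exp \<tau> *\<^sub>R \<xi>)"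
  have r: "0 < r" using False by (simp add: r_def)
  have e2: "exp ((real CARD('n) - 2) * \<tau>) = e * exp \<tau>" by (simp add: e_def exp_add[symmetric] algebra_simps)
  have co: "coA TYPE('n) \<tau> r = e * exp \<tau> * cos \<theta>" "coB TYPE('n) \<tau> r = e * (sin \<theta> / r)"
    "coC TYPE('n) \<tau> r = e * cos \<theta>" "coD TYPE('n) \<tau> r = e * exp \<tau> * (r * sin \<theta>)"
    by (simp_all add: coA_def coB_def coC_def coD_def e2 \<theta>_def e_def)
  have "of_real r * fst (Ssym \<tau> \<Phi>) \<xi> = of_real e * (of_real (cos \<theta>) * (of_real R * a) + of_real (sin \<theta>) * b)"
    unfolding Ssym_def fst_conv r_def[symmetric] co R_def a_def[symmetric] b_def[symmetric] using r by (simp add: field_simps)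
  then have 1: "r\<^sup>2 * (norm (fst (Ssym \<tau> \<Phi>) \<xi>))\<^sup>2 = e\<^sup>2 * (norm (of_real (cos \<theta>) * (of_real R * a) + of_real (sin \<theta>) * b))\<^sup>2"
    by (metis norm_mult norm_of_real power_mult_distrib power2_abs)
  have "snd (Ssym \<tau> \<Phi>) \<xi> = of_real e * (of_real (cos \<theta>) * b - of_real (sin \<theta>) * (of_real R * a))"
    unfolding Ssym_def snd_conv r_def[symmetric] co R_def a_def[symmetric] b_def[symmetric] by (simp add: algebra_simps)
  then have 2: "(norm (snd (Ssym \<tau> \<Phi>) \<xi>))\<^sup>2 = e\<^sup>2 * (norm (of_real (cos \<theta>) * b - of_real (sin \<theta>) * (of_real R * a)))\<^sup>2"
    by (metis norm_mult norm_of_real power_mult_distrib power2_abs)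
  have "dens (Ssym \<tau> \<Phi>) \<xi> = wt r * (e\<^sup>2 * ((norm (of_real R * a))\<^sup>2 + (norm b)\<^sup>2))"
    unfolding dens_def r_def[symmetric] 1 2 by (subst norm_rotate[symmetric, of "cos \<theta>" "sin \<theta>"]) (simp_all add: ring_distribs)
  also have "\<dots> = e\<^sup>2 * (wt r * (R\<^sup>2 * (norm a)\<^sup>2 + (norm b)\<^sup>2))"
    by (simp add: norm_mult power_mult_distrib)
  also have "e\<^sup>2 = exp ((2 * real CARD('n) - 4 - 2 * s1) * \<tau>) * exp (2 * (s1 - 1) * \<tau>)"
    by (simp add: e_def exp_double[symmetric] exp_add[symmetric] algebra_simps)
  also have "\<dots> * (wt r * (R\<^sup>2 * (norm a)\<^sup>2 + (norm b)\<^sup>2))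
      = exp ((2 * real CARD('n) - 4 - 2 * s1) * \<tau>) * (wt r * exp (2 * (s1 - 1) * \<tau>) * (R\<^sup>2 * (norm a)\<^sup>2 + (norm b)\<^sup>2))"
    by simp
  also have "\<dots> \<le> exp ((2 * real CARD('n) - 4 - 2 * s1) * \<tau>) * (wt R * (R\<^sup>2 * (norm a)\<^sup>2 + (norm b)\<^sup>2))"
    unfolding R_def using wt_dilate[OF assms, of r] r by (intro mult_left_mono mult_right_mono) auto
  also have "wt R * (R\<^sup>2 * (norm a)\<^sup>2 + (norm b)\<^sup>2) = dens \<Phi> (exp \<tau> *\<^sub>R \<xi>)"
    by (simp add: dens_def R_def r_def a_def b_def)
  finally show ?thesis .
qed

text \<open>The change of variables contributes \<open>exp (- n * \<tau>)\<close>, which turns the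
  exponent \<open>2 n - 4 - 2 s1\<close> into twice \<open>n / 2 - 2 - s1\<close>.\<close>

lemma inX_Ssym:
  fixes \<Phi> :: "'n::finite fpair"
  assumes X: "inX \<Phi>" and \<tau>: "0 \<le> \<tau>"
  shows "inX (Ssym \<tau> \<Phi>)"
    and "Nsq (Ssym \<tau> \<Phi>) \<le> (exp ((real CARD('n) / 2 - 2 - s1) * \<tau>))\<^sup>2 * Nsq \<Phi>"
proof -
  define k where "k = exp ((2 * real CARD('n) - 4 - 2 * s1) * \<tau>)"
  have m: "fst (Ssym \<tau> \<Phi>) \<in> borel_measurable borel" "snd (Ssym \<tau> \<Phi>) \<in> borel_measurable borel"
    using X by (auto simp: inX_def intro: Ssym_measurable)
  have i: "integrable lborel (\<lambda>\<xi>. k * dens \<Phi> (exp \<tau> *\<^sub>R \<xi>))"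
    using X by (intro integrable_mult_right integrable_lborel_scaleR) (auto simp: inX_def)
  have int: "integrable lborel (dens (Ssym \<tau> \<Phi>))"
    by (rule Bochner_Integration.integrable_bound[OF i])
       (use m dens_Ssym_le[OF \<tau>, of \<Phi>] in \<open>auto simp: dens_measurable dens_nonneg k_def\<close>)
  then show "inX (Ssym \<tau> \<Phi>)" using m by (simp add: inX_def)
  have "Nsq (Ssym \<tau> \<Phi>) \<le> (LINT \<xi>|lborel. k * dens \<Phi> (exp \<tau> *\<^sub>R \<xi>))"
    unfolding Nsq_def using dens_Ssym_le[OF \<tau>, of \<Phi>] by (intro integral_mono int i) (simp add: k_def)
  also have "\<dots> = k * (Nsq \<Phi> /\<^sub>R exp \<tau> ^ CARD('n))"
  proof -
    have "dens \<Phi> \<in> borel_measurable borel" using X by (simp add: inX_def dens_measurable)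
    from integral_lborel_scaleR[OF this, of "exp \<tau>"] show ?thesis by (simp add: Nsq_def)
  qed
  also have "\<dots> = (exp ((real CARD('n) / 2 - 2 - s1) * \<tau>))\<^sup>2 * Nsq \<Phi>"
  proof -
    have "k * inverse (exp \<tau> ^ CARD('n)) = (exp ((real CARD('n) / 2 - 2 - s1) * \<tau>))\<^sup>2"
      by (simp add: k_def exp_of_nat_mult[symmetric] exp_minus[symmetric] exp_add[symmetric] exp_double[symmetric] algebra_simps)
    then show ?thesis by (simp add: mult.assoc[symmetric])
  qed
  finally show "Nsq (Ssym \<tau> \<Phi>) \<le> (exp ((real CARD('n) / 2 - 2 - s1) * \<tau>))\<^sup>2 * Nsq \<Phi>" .
qed

end

section \<open>The generator on the Fourier side\<close>

lemma ft2_L0: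
  assumes "u \<in> L0_domain"
  shows "fst (ft2 (L0_tilde u)) \<xi> = - fourier (Lam (fst u)) \<xi> - 2 * fourier (fst u) \<xi> + fourier (snd u) \<xi>"
    and "snd (ft2 (L0_tilde u)) \<xi> = - of_real ((norm \<xi>)\<^sup>2) * fourier (fst u) \<xi> - fourier (Lam (snd u)) \<xi> - 3 * fourier (snd u) \<xi>"
proof -
  obtain u1 u2 where u: "u = (u1, u2)" by (cases u)
  have d: "smooth u1" "csupp u1" "smooth u2" "csupp u2"
    using assms by (auto simp: u L0_domain_def radial_test_functions_iff)
  note s = smooth_mult smooth_const smooth_add csupp_mult csupp_add Lam_smooth Lam_csupp Laplacian_smooth Laplacian_csupp
  have "fourier (\<lambda>x. ((-1) * Lam u1 x + (-2) * u1 x) + u2 x) \<xi> = - fourier (Lam u1) \<xi> - 2 * fourier u1 \<xi> + fourier u2 \<xi>"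
    by (subst fourier_add, (intro s d)+, subst fourier_add, (intro s d)+, subst fourier_cmult, subst fourier_cmult) simp
  then show "fst (ft2 (L0_tilde u)) \<xi> = - fourier (Lam (fst u)) \<xi> - 2 * fourier (fst u) \<xi> + fourier (snd u) \<xi>"
    by (simp add: ft2_def L0_tilde_def u)
  have "fourier (\<lambda>x. (Laplacian u1 x + (-1) * Lam u2 x) + (-3) * u2 x) \<xi>
      = fourier (Laplacian u1) \<xi> - fourier (Lam u2) \<xi> - 3 * fourier u2 \<xi>"
    by (subst fourier_add, (intro s d)+, subst fourier_add, (intro s d)+, subst fourier_cmult, subst fourier_cmult) simp
  then show "snd (ft2 (L0_tilde u)) \<xi> = - of_real ((norm \<xi>)\<^sup>2) * fourier (fst u) \<xi> - fourier (Lam (snd u)) \<xi> - 3 * fourier (snd u) \<xi>"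
    by (simp add: ft2_def L0_tilde_def u fourier_Laplacian d)
qed

lemma Lam_add: "smooth f \<Longrightarrow> smooth g \<Longrightarrow> Lam (\<lambda>x. f x + g x) = (\<lambda>x. Lam f x + Lam g x)"
  by (simp add: Lam_def fun_eq_iff partial_add smooth_differentiable ring_distribs sum.distrib)

text \<open>\<Lambda> generates the dilations and therefore commutes with them.\<close>

lemma Lam_dilate:
  assumes "smooth f"
  shows "Lam (\<lambda>x. c * f (a *\<^sub>R x)) = (\<lambda>x. c * Lam f (a *\<^sub>R x))"
proof
  fix x
  have s: "smooth (\<lambda>x. f (a *\<^sub>R x))" using assms by (rule smooth_scale_arg)
  have "partial i (\<lambda>x. c * f (a *\<^sub>R x)) x = c * (of_real a * partial i f (a *\<^sub>R x))" for i
    using partial_mult[OF smooth_differentiable[OF smooth_const] smooth_differentiable[OF s], of i c x]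
      partial_scale_arg[OF smooth_differentiable[OF assms], of i a] by simp
  then show "Lam (\<lambda>x. c * f (a *\<^sub>R x)) x = c * Lam f (a *\<^sub>R x)"
    by (simp add: Lam_def sum_distrib_left mult_ac)
qed

lemma fourier_dilate:
  fixes f :: "real^'n::finite \<Rightarrow> complex"
  assumes "smooth f"
  shows "fourier (\<lambda>x. of_real (exp (- (j * \<tau>))) * f (exp (- \<tau>) *\<^sub>R x)) \<xi>
    = of_real (exp ((real CARD('n) - j) * \<tau>)) * fourier f (exp \<tau> *\<^sub>R \<xi>)"
proof -
  have "fourier (\<lambda>x. of_real (exp (- (j * \<tau>))) * f (exp (- \<tau>) *\<^sub>R x)) \<xi>
      = of_real (exp (- (j * \<tau>))) * (fourier f (\<xi> /\<^sub>R exp (- \<tau>)) / of_real (exp (- \<tau>) ^ CARD('n)))"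
    unfolding fourier_cmult by (subst fourier_scale_arg[OF smooth_measurable[OF assms]]) simp_all
  also have "\<xi> /\<^sub>R exp (- \<tau>) = exp \<tau> *\<^sub>R \<xi>" by (simp add: exp_minus)
  also have "of_real (exp (- (j * \<tau>))) * (fourier f (exp \<tau> *\<^sub>R \<xi>) / of_real (exp (- \<tau>) ^ CARD('n)))
      = of_real (exp (- (j * \<tau>)) / exp (- \<tau>) ^ CARD('n)) * fourier f (exp \<tau> *\<^sub>R \<xi>)"
    by simp
  also have "exp (- (j * \<tau>)) / exp (- \<tau>) ^ CARD('n) = exp ((real CARD('n) - j) * \<tau>)"
    by (simp add: exp_of_nat_mult[symmetric] exp_diff[symmetric] algebra_simps)
  finally show ?thesis .
qed

text \<open>The flow of \<open>- Lam - 2\<close> and \<open>- Lam - 3\<close>, the dilation part of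
  \<open>L0_tilde\<close>; it is applied after the wave part of the evolution.\<close>

definition dil :: "real \<Rightarrow> 'n::finite fpair \<Rightarrow> 'n fpair" where
  "dil \<tau> v = (\<lambda>x. of_real (exp (- (2 * \<tau>))) * fst v (exp (- \<tau>) *\<^sub>R x), \<lambda>x. of_real (exp (- (3 * \<tau>))) * snd v (exp (- \<tau>) *\<^sub>R x))"

lemma dil_domain: "v \<in> L0_domain \<Longrightarrow> dil \<tau> v \<in> L0_domain"
  by (auto simp: dil_def L0_domain_def intro!: rt_cmult rt_scale_arg)

lemma ft2_dil:
  fixes v :: "'n::finite fpair" and \<tau> :: real
  assumes v: "v \<in> L0_domain"
  defines "e2 \<equiv> complex_of_real (exp ((real CARD('n) - 2) * \<tau>))" and "e3 \<equiv> complex_of_real (exp ((real CARD('n) - 3) * \<tau>))"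
  shows "fst (ft2 (dil \<tau> v)) = (\<lambda>\<xi>. e2 * fourier (fst v) (exp \<tau> *\<^sub>R \<xi>))"
    and "snd (ft2 (dil \<tau> v)) = (\<lambda>\<xi>. e3 * fourier (snd v) (exp \<tau> *\<^sub>R \<xi>))"
    and "fst (ft2 (L0_tilde (dil \<tau> v))) = (\<lambda>\<xi>. (- e2) * fourier (Lam (fst v)) (exp \<tau> *\<^sub>R \<xi>)
       + ((- 2 * e2) * fourier (fst v) (exp \<tau> *\<^sub>R \<xi>) + e3 * fourier (snd v) (exp \<tau> *\<^sub>R \<xi>)))"
    and "snd (ft2 (L0_tilde (dil \<tau> v))) = (\<lambda>\<xi>. (- of_real ((norm \<xi>)\<^sup>2) * e2) * fourier (fst v) (exp \<tau> *\<^sub>R \<xi>)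
       + ((- e3) * fourier (Lam (snd v)) (exp \<tau> *\<^sub>R \<xi>) + (- 3 * e3) * fourier (snd v) (exp \<tau> *\<^sub>R \<xi>)))"
proof -
  have d: "smooth (fst v)" "smooth (snd v)" using v by (auto simp: L0_domain_def radial_test_functions_iff)
  have f1: "fourier (fst (dil \<tau> v)) \<xi> = e2 * fourier (fst v) (exp \<tau> *\<^sub>R \<xi>)"
    and f2: "fourier (snd (dil \<tau> v)) \<xi> = e3 * fourier (snd v) (exp \<tau> *\<^sub>R \<xi>)" for \<xi>
    using fourier_dilate[OF d(1), of 2 \<tau>] fourier_dilate[OF d(2), of 3 \<tau>] by (simp_all add: dil_def e2_def e3_def)
  have l1: "fourier (Lam (fst (dil \<tau> v))) \<xi> = e2 * fourier (Lam (fst v)) (exp \<tau> *\<^sub>R \<xi>)"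
    and l2: "fourier (Lam (snd (dil \<tau> v))) \<xi> = e3 * fourier (Lam (snd v)) (exp \<tau> *\<^sub>R \<xi>)" for \<xi>
    using fourier_dilate[OF Lam_smooth[OF d(1)], of 2 \<tau>] fourier_dilate[OF Lam_smooth[OF d(2)], of 3 \<tau>]
    by (simp_all add: dil_def e2_def e3_def Lam_dilate d)
  show "fst (ft2 (dil \<tau> v)) = (\<lambda>\<xi>. e2 * fourier (fst v) (exp \<tau> *\<^sub>R \<xi>))"
    "snd (ft2 (dil \<tau> v)) = (\<lambda>\<xi>. e3 * fourier (snd v) (exp \<tau> *\<^sub>R \<xi>))"
    by (simp_all add: ft2_def fun_eq_iff f1 f2)
  show "fst (ft2 (L0_tilde (dil \<tau> v))) = (\<lambda>\<xi>. (- e2) * fourier (Lam (fst v)) (exp \<tau> *\<^sub>R \<xi>)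
       + ((- 2 * e2) * fourier (fst v) (exp \<tau> *\<^sub>R \<xi>) + e3 * fourier (snd v) (exp \<tau> *\<^sub>R \<xi>)))"
    "snd (ft2 (L0_tilde (dil \<tau> v))) = (\<lambda>\<xi>. (- of_real ((norm \<xi>)\<^sup>2) * e2) * fourier (fst v) (exp \<tau> *\<^sub>R \<xi>)
       + ((- e3) * fourier (Lam (snd v)) (exp \<tau> *\<^sub>R \<xi>) + (- 3 * e3) * fourier (snd v) (exp \<tau> *\<^sub>R \<xi>)))"
    by (simp_all add: ft2_L0[OF dil_domain[OF v]] fun_eq_iff f1 f2 l1 l2)
qed

text \<open>The multiplier of the Laplacian is homogeneous of degree 2, so differentiating it along
  rays produces the commutator of \<Lambda> with \<Delta>, which is -2 \<Delta>.\<close>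

lemma fourier_Lam_Laplacian:
  assumes f: "smooth f" "csupp f"
  shows "fourier (Lam (Laplacian f)) \<xi> = of_real ((norm \<xi>)\<^sup>2) * (2 * fourier f \<xi> - fourier (Lam f) \<xi>)"
proof -
  let ?n = "of_nat CARD('a) :: complex"
  define r where "r = norm \<xi>"
  have "((\<lambda>\<sigma>. - ((exp \<sigma> * r)\<^sup>2)) has_real_derivative - 2 * r\<^sup>2) (at 0)"
    by (auto intro!: derivative_eq_intros simp: power2_eq_square)
  then have "((\<lambda>\<sigma>. complex_of_real (- ((exp \<sigma> * r)\<^sup>2))) has_vector_derivative of_real (- 2 * r\<^sup>2)) (at 0)"
    by (intro has_vector_derivative_of_real) (simp add: has_real_derivative_iff_has_vector_derivative)
  from has_vector_derivative_mult[OF this fourier_exp_ray[OF f, of \<xi> 0]]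
  have h1: "((\<lambda>\<sigma>. of_real (- ((exp \<sigma> * r)\<^sup>2)) * fourier f (exp \<sigma> *\<^sub>R \<xi>)) has_vector_derivative
      of_real (- (r\<^sup>2)) * (- fourier (Lam f) \<xi> - ?n * fourier f \<xi>) + of_real (- 2 * r\<^sup>2) * fourier f \<xi>) (at 0)"
    by simp
  have eq: "(\<lambda>\<sigma>. of_real (- ((exp \<sigma> * r)\<^sup>2)) * fourier f (exp \<sigma> *\<^sub>R \<xi>)) = (\<lambda>\<sigma>. fourier (Laplacian f) (exp \<sigma> *\<^sub>R \<xi>))"
    by (simp add: fourier_Laplacian[OF f] r_def)
  have h2: "((\<lambda>\<sigma>. fourier (Laplacian f) (exp \<sigma> *\<^sub>R \<xi>)) has_vector_derivative
      (- fourier (Lam (Laplacian f)) \<xi> - ?n * fourier (Laplacian f) \<xi>)) (at 0)"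
    using fourier_exp_ray[OF Laplacian_smooth[OF f(1)] Laplacian_csupp[OF f(2)], of \<xi> 0] by simp
  have "of_real (- (r\<^sup>2)) * (- fourier (Lam f) \<xi> - ?n * fourier f \<xi>) + of_real (- 2 * r\<^sup>2) * fourier f \<xi>
      = - fourier (Lam (Laplacian f)) \<xi> - ?n * fourier (Laplacian f) \<xi>"
    by (rule vector_derivative_unique_at[OF h1[unfolded eq] h2])
  then show ?thesis by (simp add: fourier_Laplacian[OF f] r_def[symmetric] algebra_simps)
qed

text \<open>Replacing the wave multipliers by Chebyshev polynomials in ball averages keeps all
  approximants in the space of test functions.\<close>

lemma wave_approximation:
  fixes u :: "'n::finite fpair"
  assumes u: "u \<in> L0_domain" and \<tau>: "0 < \<tau>"
  obtains w where "\<And>k. w k \<in> L0_domain"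
    "rapid (\<lambda>k::nat. fst (ft2 (w k)))" "rapid (\<lambda>k. snd (ft2 (w k)))"
    "rapid (\<lambda>k. fst (ft2 (L0_tilde (w k))))" "rapid (\<lambda>k. snd (ft2 (L0_tilde (w k))))"
    "\<And>\<xi>. \<xi> \<noteq> 0 \<Longrightarrow> (\<lambda>k. fst (ft2 (w k)) \<xi>) \<longlonglongrightarrow> fst (Ssym \<tau> (ft2 u)) \<xi>"
    "\<And>\<xi>. \<xi> \<noteq> 0 \<Longrightarrow> (\<lambda>k. snd (ft2 (w k)) \<xi>) \<longlonglongrightarrow> snd (Ssym \<tau> (ft2 u)) \<xi>"
    "\<And>\<xi>. \<xi> \<noteq> 0 \<Longrightarrow> (\<lambda>k. fst (ft2 (L0_tilde (w k))) \<xi>) \<longlonglongrightarrow> fst (Ssym \<tau> (ft2 (L0_tilde u))) \<xi>"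
    "\<And>\<xi>. \<xi> \<noteq> 0 \<Longrightarrow> (\<lambda>k. snd (ft2 (L0_tilde (w k))) \<xi>) \<longlonglongrightarrow> snd (Ssym \<tau> (ft2 (L0_tilde u))) \<xi>"
proof -
  obtain u1 u2 where uu: "u = (u1, u2)" by (cases u)
  \<comment> \<open>Then \<open>t * exp \<tau> = exp \<tau> - 1\<close>: at the dilated frequency
    the wave phase is the one in \<open>coA\<close>.\<close>
  define t where "t = 1 - exp (- \<tau>)"
  have t: "0 < t" using \<tau> by (simp add: t_def)
  have rt: "u1 \<in> radial_test_functions" "u2 \<in> radial_test_functions" "Laplacian u1 \<in> radial_test_functions"
    using u by (auto simp: uu L0_domain_def intro: rt_Laplacian)
  have d: "smooth u1" "csupp u1" "smooth u2" "csupp u2" "smooth (Laplacian u1)" "csupp (Laplacian u1)"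
    using rt by (auto simp: radial_test_functions_iff)
  define \<epsilon> where "\<epsilon> = step TYPE('n) t"
  define P where "P k \<eta> = poly (mulT k) (bmul (\<epsilon> k *\<^sub>R \<eta>))" for k and \<eta> :: "real^'n"
  define Q where "Q k \<eta> = poly (mulV t k) (bmul (\<epsilon> k *\<^sub>R \<eta>))" for k and \<eta> :: "real^'n"
  define P' where "P' k \<eta> = poly (pderiv (mulT k)) (bmul (\<epsilon> k *\<^sub>R \<eta>)) * bgrad (\<epsilon> k *\<^sub>R \<eta>)" for k and \<eta> :: "real^'n"
  define Q' where "Q' k \<eta> = poly (pderiv (mulV t k)) (bmul (\<epsilon> k *\<^sub>R \<eta>)) * bgrad (\<epsilon> k *\<^sub>R \<eta>)" for k and \<eta> :: "real^'n"
  have "\<forall>k. \<exists>a\<in>radial_test_functions. \<forall>\<xi>. fourier a \<xi> = of_real (P k \<xi>) * fourier u1 \<xi>"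
    unfolding P_def by (intro allI rt_poly rt)
  then obtain a where a: "\<And>k. a k \<in> radial_test_functions" "\<And>k \<xi>. fourier (a k) \<xi> = of_real (P k \<xi>) * fourier u1 \<xi>" by metis
  have "\<forall>k. \<exists>b\<in>radial_test_functions. \<forall>\<xi>. fourier b \<xi> = of_real (Q k \<xi>) * fourier u2 \<xi>"
    unfolding Q_def by (intro allI rt_poly rt)
  then obtain b where b: "\<And>k. b k \<in> radial_test_functions" "\<And>k \<xi>. fourier (b k) \<xi> = of_real (Q k \<xi>) * fourier u2 \<xi>" by metis
  have "\<forall>k. \<exists>c\<in>radial_test_functions. \<forall>\<xi>. fourier c \<xi> = of_real (P k \<xi>) * fourier u2 \<xi>"
    unfolding P_def by (intro allI rt_poly rt)
  then obtain c where c: "\<And>k. c k \<in> radial_test_functions" "\<And>k \<xi>. fourier (c k) \<xi> = of_real (P k \<xi>) * fourier u2 \<xi>" by metis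
  \<comment> \<open>The multiplier \<open>- r sin (t r)\<close> in the second component is realised
    as \<open>sin (t r) / r\<close> acting on the Laplacian of \<open>u1\<close>, so
    \<open>mulV\<close> approximates it too.\<close>
  have "\<forall>k. \<exists>e\<in>radial_test_functions. \<forall>\<xi>. fourier e \<xi> = of_real (Q k \<xi>) * fourier (Laplacian u1) \<xi>"
    unfolding Q_def by (intro allI rt_poly rt)
  then obtain e where e: "\<And>k. e k \<in> radial_test_functions" "\<And>k \<xi>. fourier (e k) \<xi> = of_real (Q k \<xi>) * fourier (Laplacian u1) \<xi>" by metis
  have ds: "smooth (a k)" "csupp (a k)" "smooth (b k)" "csupp (b k)" "smooth (c k)" "csupp (c k)" "smooth (e k)" "csupp (e k)" for k
    using a(1)[of k] b(1)[of k] c(1)[of k] e(1)[of k] by (auto simp: radial_test_functions_iff)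
  define v where "v k = (\<lambda>x. a k x + b k x, \<lambda>x. c k x + e k x)" for k
  have v: "v k \<in> L0_domain" for k using a b c e by (auto simp: v_def L0_domain_def intro: rt_add)
  have v1: "fourier (fst (v k)) \<eta> = of_real (P k \<eta>) * fourier u1 \<eta> + of_real (Q k \<eta>) * fourier u2 \<eta>" for k \<eta>
    by (simp add: v_def fourier_add ds a(2) b(2))
  have v2: "fourier (snd (v k)) \<eta> = of_real (P k \<eta>) * fourier u2 \<eta> + of_real (Q k \<eta>) * fourier (Laplacian u1) \<eta>" for k \<eta>
    by (simp add: v_def fourier_add ds c(2) e(2))
  have L1: "fourier (Lam (fst (v k))) \<eta> = (of_real (P k \<eta>) * fourier (Lam u1) \<eta> + of_real (P' k \<eta>) * fourier u1 \<eta>)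
      + (of_real (Q k \<eta>) * fourier (Lam u2) \<eta> + of_real (Q' k \<eta>) * fourier u2 \<eta>)" for k \<eta>
    using fourier_Lam_poly[OF d(1,2) ds(1,2)[of k], of "mulT k" "\<epsilon> k" \<eta>] fourier_Lam_poly[OF d(3,4) ds(3,4)[of k], of "mulV t k" "\<epsilon> k" \<eta>]
    by (simp add: v_def Lam_add fourier_add Lam_smooth Lam_csupp ds a(2) b(2) P_def Q_def P'_def Q'_def)
  have L2: "fourier (Lam (snd (v k))) \<eta> = (of_real (P k \<eta>) * fourier (Lam u2) \<eta> + of_real (P' k \<eta>) * fourier u2 \<eta>)
      + (of_real (Q k \<eta>) * fourier (Lam (Laplacian u1)) \<eta> + of_real (Q' k \<eta>) * fourier (Laplacian u1) \<eta>)" for k \<eta>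
    using fourier_Lam_poly[OF d(3,4) ds(5,6)[of k], of "mulT k" "\<epsilon> k" \<eta>] fourier_Lam_poly[OF d(5,6) ds(7,8)[of k], of "mulV t k" "\<epsilon> k" \<eta>]
    by (simp add: v_def Lam_add fourier_add Lam_smooth Lam_csupp ds c(2) e(2) P_def Q_def P'_def Q'_def)
  have bd: "norm (complex_of_real (P k \<eta>)) \<le> 1 * (1 + norm \<eta>) ^ 0" "norm (complex_of_real (Q k \<eta>)) \<le> t * (1 + norm \<eta>) ^ 0"
    "norm (complex_of_real (P' k \<eta>)) \<le> t\<^sup>2 * (1 + norm \<eta>) ^ 2" "norm (complex_of_real (Q' k \<eta>)) \<le> t ^ 3 * (1 + norm \<eta>) ^ 2" for k \<eta>
  proof -
    have n2: "(norm \<eta>)\<^sup>2 \<le> (1 + norm \<eta>) ^ 2" by (intro power_mono) auto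
    note m = mul_bounds[OF t, of k \<eta>, folded \<epsilon>_def]
    show "norm (complex_of_real (P k \<eta>)) \<le> 1 * (1 + norm \<eta>) ^ 0" "norm (complex_of_real (Q k \<eta>)) \<le> t * (1 + norm \<eta>) ^ 0"
      using m(1,2) by (simp_all add: P_def Q_def)
    show "norm (complex_of_real (P' k \<eta>)) \<le> t\<^sup>2 * (1 + norm \<eta>) ^ 2"
      using m(3) mult_left_mono[OF n2, of "t\<^sup>2"] unfolding P'_def norm_of_real by simp
    show "norm (complex_of_real (Q' k \<eta>)) \<le> t ^ 3 * (1 + norm \<eta>) ^ 2"
      using m(4) mult_left_mono[OF n2 zero_le_power[OF less_imp_le[OF t], of 3]] unfolding Q'_def norm_of_real by simp
  qed
  note rf = rapid_fourier[where 'i = nat]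
  have rv: "rapid (\<lambda>k. fourier (fst (v k)))" "rapid (\<lambda>k. fourier (snd (v k)))"
    "rapid (\<lambda>k. fourier (Lam (fst (v k))))" "rapid (\<lambda>k. fourier (Lam (snd (v k))))"
    unfolding v1[abs_def] v2[abs_def] L1[abs_def] L2[abs_def]
    by (intro rapid_add rapid_mult[OF _ bd(1)] rapid_mult[OF _ bd(2)] rapid_mult[OF _ bd(3)] rapid_mult[OF _ bd(4)] rf Lam_smooth Lam_csupp d)+
  define w where "w k = dil \<tau> (v k)" for k
  have e1: "1 \<le> exp \<tau>" using \<tau> by simp
  have rd: "rapid (\<lambda>k \<xi>. fourier (fst (v k)) (exp \<tau> *\<^sub>R \<xi>))" "rapid (\<lambda>k \<xi>. fourier (snd (v k)) (exp \<tau> *\<^sub>R \<xi>))"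
    "rapid (\<lambda>k \<xi>. fourier (Lam (fst (v k))) (exp \<tau> *\<^sub>R \<xi>))" "rapid (\<lambda>k \<xi>. fourier (Lam (snd (v k))) (exp \<tau> *\<^sub>R \<xi>))"
    by (rule rapid_dilate[OF rv(1) e1] rapid_dilate[OF rv(2) e1] rapid_dilate[OF rv(3) e1] rapid_dilate[OF rv(4) e1])+
  define e2 where "e2 = complex_of_real (exp ((real CARD('n) - 2) * \<tau>))"
  define e3 where "e3 = complex_of_real (exp ((real CARD('n) - 3) * \<tau>))"
  note fw = ft2_dil[OF v, of \<tau>, folded w_def e2_def e3_def]
  have n2: "norm (- complex_of_real ((norm \<xi>)\<^sup>2) * e2) \<le> norm e2 * (1 + norm \<xi>) ^ 2" for \<xi> :: "real^'n"
  proof -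
    have "(norm \<xi>)\<^sup>2 * norm e2 \<le> (1 + norm \<xi>) ^ 2 * norm e2" by (intro mult_right_mono power_mono) auto
    then show ?thesis by (simp add: norm_mult norm_power mult.commute)
  qed
  have rw: "rapid (\<lambda>k. fst (ft2 (w k)))" "rapid (\<lambda>k. snd (ft2 (w k)))"
    "rapid (\<lambda>k. fst (ft2 (L0_tilde (w k))))" "rapid (\<lambda>k. snd (ft2 (L0_tilde (w k))))"
    unfolding fw
    by (intro rapid_add rapid_cmult[OF _ order_refl] rapid_mult[OF _ n2] rd)+
  have lim: "(\<lambda>k. fst (ft2 (w k)) \<xi>) \<longlonglongrightarrow> fst (Ssym \<tau> (ft2 u)) \<xi> \<and>
      (\<lambda>k. snd (ft2 (w k)) \<xi>) \<longlonglongrightarrow> snd (Ssym \<tau> (ft2 u)) \<xi> \<and>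
      (\<lambda>k. fst (ft2 (L0_tilde (w k))) \<xi>) \<longlonglongrightarrow> fst (Ssym \<tau> (ft2 (L0_tilde u))) \<xi> \<and>
      (\<lambda>k. snd (ft2 (L0_tilde (w k))) \<xi>) \<longlonglongrightarrow> snd (Ssym \<tau> (ft2 (L0_tilde u))) \<xi>" if \<xi>: "\<xi> \<noteq> 0" for \<xi>
  proof -
    define \<eta> where "\<eta> = exp \<tau> *\<^sub>R \<xi>"
    define r where "r = norm \<xi>"
    define R where "R = norm \<eta>"
    define E where "E = exp \<tau>"
    define e where "e = exp ((real CARD('n) - 3) * \<tau>)"
    define C where "C = cos ((E - 1) * r)"
    define S where "S = sin ((E - 1) * r)"
    have \<eta>: "\<eta> \<noteq> 0" using \<xi> by (simp add: \<eta>_def)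
    have r: "0 < r" using \<xi> by (simp add: r_def)
    have E: "0 < E" by (simp add: E_def)
    have R: "R = E * r" by (simp add: R_def \<eta>_def r_def E_def)
    have tE: "t = 1 - 1 / E" by (simp add: t_def E_def exp_minus divide_inverse)
    have tR: "t * R = (E - 1) * r" using E by (simp add: tE R field_simps)
    have ee: "e2 = of_real (e * E)" "e3 = of_real e"
      by (simp_all add: e2_def e3_def e_def E_def exp_add[symmetric] algebra_simps)
    have co: "coA TYPE('n) \<tau> r = e * E * C" "coB TYPE('n) \<tau> r = e * (S / r)" "coC TYPE('n) \<tau> r = e * C" "coD TYPE('n) \<tau> r = e * E * (r * S)"
      by (simp_all add: coA_def coB_def coC_def coD_def e_def C_def S_def E_def exp_add[symmetric] algebra_simps)
    note ml = mul_limits[OF t \<eta>, folded \<epsilon>_def R_def, unfolded tR, folded C_def S_def]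
    have lP: "(\<lambda>k. complex_of_real (P k \<eta>)) \<longlonglongrightarrow> of_real C" unfolding P_def by (intro tendsto_of_real ml)
    have lQ: "(\<lambda>k. complex_of_real (Q k \<eta>)) \<longlonglongrightarrow> of_real (S / R)" unfolding Q_def by (intro tendsto_of_real ml)
    have lP': "(\<lambda>k. complex_of_real (P' k \<eta>)) \<longlonglongrightarrow> of_real ((E - 1) * r * S)" unfolding P'_def by (intro tendsto_of_real ml)
    have lQ': "(\<lambda>k. complex_of_real (Q' k \<eta>)) \<longlonglongrightarrow> of_real (S / R - t * C)" unfolding Q'_def by (intro tendsto_of_real ml)
    define x1 where "x1 = fourier u1 \<eta>"
    define x2 where "x2 = fourier u2 \<eta>"
    define y1 where "y1 = fourier (Lam u1) \<eta>"
    define y2 where "y2 = fourier (Lam u2) \<eta>"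
    have lap: "fourier (Laplacian u1) \<eta> = - of_real (R\<^sup>2) * x1" by (simp add: fourier_Laplacian d x1_def R_def)
    have llap: "fourier (Lam (Laplacian u1)) \<eta> = of_real (R\<^sup>2) * (2 * x1 - y1)" by (simp add: fourier_Lam_Laplacian d x1_def y1_def R_def)
    note vv = v1[of _ \<eta>] v2[of _ \<eta>] L1[of _ \<eta>] L2[of _ \<eta>]
    note V = vv[unfolded lap llap, folded x1_def x2_def y1_def y2_def]
    have l1: "(\<lambda>k. fourier (fst (v k)) \<eta>) \<longlonglongrightarrow> of_real C * x1 + of_real (S / R) * x2"
      unfolding V by (intro tendsto_intros lP lQ)
    have l2: "(\<lambda>k. fourier (snd (v k)) \<eta>) \<longlonglongrightarrow> of_real C * x2 + of_real (S / R) * (- of_real (R\<^sup>2) * x1)"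
      unfolding V by (intro tendsto_intros lP lQ)
    have l3: "(\<lambda>k. fourier (Lam (fst (v k))) \<eta>) \<longlonglongrightarrow> (of_real C * y1 + of_real ((E - 1) * r * S) * x1) + (of_real (S / R) * y2 + of_real (S / R - t * C) * x2)"
      unfolding V by (intro tendsto_add tendsto_mult lP lQ lP' lQ' tendsto_const)
    have l4: "(\<lambda>k. fourier (Lam (snd (v k))) \<eta>) \<longlonglongrightarrow> (of_real C * y2 + of_real ((E - 1) * r * S) * x2)
        + (of_real (S / R) * (of_real (R\<^sup>2) * (2 * x1 - y1)) + of_real (S / R - t * C) * (- of_real (R\<^sup>2) * x1))"
      unfolding V by (intro tendsto_add tendsto_mult lP lQ lP' lQ' tendsto_const)
    have su: "fst (ft2 u) \<eta> = x1" "snd (ft2 u) \<eta> = x2" by (simp_all add: ft2_def uu x1_def x2_def)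
    have sl: "fst (ft2 (L0_tilde u)) \<eta> = - y1 - 2 * x1 + x2" "snd (ft2 (L0_tilde u)) \<eta> = - of_real (R\<^sup>2) * x1 - y2 - 3 * x2"
      unfolding ft2_L0[OF u] by (simp_all add: uu x1_def x2_def y1_def y2_def R_def)
    have S: "fst (Ssym \<tau> \<Phi>) \<xi> = of_real (e * E * C) * fst \<Phi> \<eta> + of_real (e * (S / r)) * snd \<Phi> \<eta>"
      "snd (Ssym \<tau> \<Phi>) \<xi> = of_real (e * C) * snd \<Phi> \<eta> - of_real (e * E * (r * S)) * fst \<Phi> \<eta>" for \<Phi> :: "'n fpair"
      by (simp_all add: Ssym_def r_def[symmetric] co \<eta>_def[symmetric])
    have c1: "of_real (e * E) * (of_real C * x1 + of_real (S / R) * x2) = fst (Ssym \<tau> (ft2 u)) \<xi>"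
      unfolding S su R using r E by (simp add: field_simps)
    have c2: "of_real e * (of_real C * x2 + of_real (S / R) * (- of_real (R\<^sup>2) * x1)) = snd (Ssym \<tau> (ft2 u)) \<xi>"
      unfolding S su R using r E by (simp add: field_simps power2_eq_square)
    \<comment> \<open>\<open>c3\<close> and \<open>c4\<close> express that operator and flow
      commute: the limit of the transforms of \<open>L0_tilde (w k)\<close> is the flow applied to
      the transform of \<open>L0_tilde u\<close>.\<close>
    have c3: "- of_real (e * E) * ((of_real C * y1 + of_real ((E - 1) * r * S) * x1) + (of_real (S / R) * y2 + of_real (S / R - t * C) * x2))
       + ((- 2 * of_real (e * E)) * (of_real C * x1 + of_real (S / R) * x2) + of_real e * (of_real C * x2 + of_real (S / R) * (- of_real (R\<^sup>2) * x1)))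
       = fst (Ssym \<tau> (ft2 (L0_tilde u))) \<xi>"
      unfolding S sl R tE using r E by (simp add: field_simps power2_eq_square)
    have c4: "(- of_real (r\<^sup>2) * of_real (e * E)) * (of_real C * x1 + of_real (S / R) * x2)
       + (- of_real e * ((of_real C * y2 + of_real ((E - 1) * r * S) * x2)
        + (of_real (S / R) * (of_real (R\<^sup>2) * (2 * x1 - y1)) + of_real (S / R - t * C) * (- of_real (R\<^sup>2) * x1)))
       + (- 3 * of_real e) * (of_real C * x2 + of_real (S / R) * (- of_real (R\<^sup>2) * x1)))
       = snd (Ssym \<tau> (ft2 (L0_tilde u))) \<xi>"
      unfolding S sl R tE using r E by (simp add: field_simps power2_eq_square)
    show ?thesis
      unfolding fw \<eta>_def[symmetric] r_def[symmetric] c1[symmetric] c2[symmetric] c3[symmetric] c4[symmetric] ee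
      by (intro conjI tendsto_add tendsto_mult tendsto_const l1 l2 l3 l4)
  qed
  have wd: "w k \<in> L0_domain" for k unfolding w_def by (rule dil_domain[OF v])
  show ?thesis
    by (rule that[of w]) (use rw lim wd in blast)+
qed

text \<open>The derivative is written as the flow of \<open>L0_tilde u\<close>, so that
  \<open>rapid_Ssym\<close> bounds it uniformly in time. The origin is excluded because
  \<open>coB\<close> divides by \<open>r\<close>.\<close>

lemma Ssym_derivative:
  fixes u :: "'n::finite fpair"
  assumes u: "u \<in> L0_domain" and \<xi>: "\<xi> \<noteq> 0"
  shows "((\<lambda>\<tau>. fst (Ssym \<tau> (ft2 u)) \<xi>) has_vector_derivative fst (Ssym \<tau> (ft2 (L0_tilde u))) \<xi>) (at \<tau>)"
    and "((\<lambda>\<tau>. snd (Ssym \<tau> (ft2 u)) \<xi>) has_vector_derivative snd (Ssym \<tau> (ft2 (L0_tilde u))) \<xi>) (at \<tau>)"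
proof -
  define n where "n = real CARD('n)"
  define r where "r = norm \<xi>"
  define A where "A = coA TYPE('n) \<tau> r"
  define B where "B = coB TYPE('n) \<tau> r"
  define C where "C = coC TYPE('n) \<tau> r"
  define D where "D = coD TYPE('n) \<tau> r"
  define R where "R = exp \<tau> * r"
  have r: "0 < r" using \<xi> by (simp add: r_def)
  have e1: "exp ((n - 2) * \<tau>) = exp ((n - 3) * \<tau>) * exp \<tau>" by (simp add: exp_add[symmetric] algebra_simps)
  \<comment> \<open>The coefficients satisfy a linear system in which \<open>R\<close>, the dilated
    frequency, enters through its square, the multiplier of the Laplacian in
    \<open>ft2_L0\<close>.\<close>
  have dA: "((\<lambda>\<tau>. coA TYPE('n) \<tau> r) has_real_derivative (n - 2) * A - R\<^sup>2 * B) (at \<tau>)"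
    unfolding coA_def n_def[symmetric] A_def B_def coB_def R_def e1
    by (rule derivative_eq_intros refl)+ (unfold e1, use r in \<open>simp add: power2_eq_square field_simps\<close>)
  have dB: "((\<lambda>\<tau>. coB TYPE('n) \<tau> r) has_real_derivative (n - 3) * B + A) (at \<tau>)"
    unfolding coB_def n_def[symmetric] A_def B_def coA_def e1
    by (rule derivative_eq_intros refl | use r in simp)+
  have dC: "((\<lambda>\<tau>. coC TYPE('n) \<tau> r) has_real_derivative (n - 3) * C - D) (at \<tau>)"
    unfolding coC_def n_def[symmetric] C_def D_def coD_def e1
    by (rule derivative_eq_intros refl)+ (simp add: algebra_simps)
  have dD: "((\<lambda>\<tau>. coD TYPE('n) \<tau> r) has_real_derivative (n - 2) * D + R\<^sup>2 * C) (at \<tau>)"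
    unfolding coD_def n_def[symmetric] C_def D_def coC_def R_def e1
    by (rule derivative_eq_intros refl)+ (unfold e1, simp add: power2_eq_square algebra_simps)
  have v: "((\<lambda>\<tau>. complex_of_real (f \<tau>)) has_vector_derivative of_real f') (at \<tau>)" if "(f has_real_derivative f') (at \<tau>)" for f f'
    using that by (intro has_vector_derivative_of_real) (simp add: has_real_derivative_iff_has_vector_derivative)
  have d: "smooth (fst u)" "csupp (fst u)" "smooth (snd u)" "csupp (snd u)"
    using u by (auto simp: L0_domain_def radial_test_functions_iff)
  define \<eta> where "\<eta> = exp \<tau> *\<^sub>R \<xi>"
  have R: "norm \<eta> = R" by (simp add: \<eta>_def R_def r_def)
  have nn: "of_nat CARD('n) = complex_of_real n" by (simp add: n_def)
  note f1 = fourier_exp_ray[OF d(1,2), of \<xi> \<tau>, folded \<eta>_def, unfolded nn]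
  note f2 = fourier_exp_ray[OF d(3,4), of \<xi> \<tau>, folded \<eta>_def, unfolded nn]
  have "((\<lambda>\<tau>. of_real (coA TYPE('n) \<tau> r) * fourier (fst u) (exp \<tau> *\<^sub>R \<xi>) + of_real (coB TYPE('n) \<tau> r) * fourier (snd u) (exp \<tau> *\<^sub>R \<xi>)) has_vector_derivative
     (of_real A * (- fourier (Lam (fst u)) \<eta> - of_real n * fourier (fst u) \<eta>) + of_real ((n - 2) * A - R\<^sup>2 * B) * fourier (fst u) \<eta>)
     + (of_real B * (- fourier (Lam (snd u)) \<eta> - of_real n * fourier (snd u) \<eta>) + of_real ((n - 3) * B + A) * fourier (snd u) \<eta>)) (at \<tau>)"
    using has_vector_derivative_add[OF has_vector_derivative_mult[OF v[OF dA] f1] has_vector_derivative_mult[OF v[OF dB] f2]]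
    by (simp add: A_def B_def \<eta>_def)
  moreover have "fst (Ssym \<tau> (ft2 (L0_tilde u))) \<xi> =
     (of_real A * (- fourier (Lam (fst u)) \<eta> - of_real n * fourier (fst u) \<eta>) + of_real ((n - 2) * A - R\<^sup>2 * B) * fourier (fst u) \<eta>)
     + (of_real B * (- fourier (Lam (snd u)) \<eta> - of_real n * fourier (snd u) \<eta>) + of_real ((n - 3) * B + A) * fourier (snd u) \<eta>)"
    unfolding Ssym_def fst_conv r_def[symmetric] A_def[symmetric] B_def[symmetric] \<eta>_def[symmetric] ft2_L0[OF u] R by (simp add: algebra_simps)
  ultimately show "((\<lambda>\<tau>. fst (Ssym \<tau> (ft2 u)) \<xi>) has_vector_derivative fst (Ssym \<tau> (ft2 (L0_tilde u))) \<xi>) (at \<tau>)"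
    unfolding Ssym_def[of _ "ft2 u"] by (simp add: ft2_def r_def)
  have "((\<lambda>\<tau>. of_real (coC TYPE('n) \<tau> r) * fourier (snd u) (exp \<tau> *\<^sub>R \<xi>) - of_real (coD TYPE('n) \<tau> r) * fourier (fst u) (exp \<tau> *\<^sub>R \<xi>)) has_vector_derivative
     (of_real C * (- fourier (Lam (snd u)) \<eta> - of_real n * fourier (snd u) \<eta>) + of_real ((n - 3) * C - D) * fourier (snd u) \<eta>)
     - (of_real D * (- fourier (Lam (fst u)) \<eta> - of_real n * fourier (fst u) \<eta>) + of_real ((n - 2) * D + R\<^sup>2 * C) * fourier (fst u) \<eta>)) (at \<tau>)"
    using has_vector_derivative_diff[OF has_vector_derivative_mult[OF v[OF dC] f2] has_vector_derivative_mult[OF v[OF dD] f1]]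
    by (simp add: C_def D_def \<eta>_def)
  moreover have "snd (Ssym \<tau> (ft2 (L0_tilde u))) \<xi> =
     (of_real C * (- fourier (Lam (snd u)) \<eta> - of_real n * fourier (snd u) \<eta>) + of_real ((n - 3) * C - D) * fourier (snd u) \<eta>)
     - (of_real D * (- fourier (Lam (fst u)) \<eta> - of_real n * fourier (fst u) \<eta>) + of_real ((n - 2) * D + R\<^sup>2 * C) * fourier (fst u) \<eta>)"
    unfolding Ssym_def snd_conv r_def[symmetric] C_def[symmetric] D_def[symmetric] \<eta>_def[symmetric] ft2_L0[OF u] R by (simp add: algebra_simps)
  ultimately show "((\<lambda>\<tau>. snd (Ssym \<tau> (ft2 u)) \<xi>) has_vector_derivative snd (Ssym \<tau> (ft2 (L0_tilde u))) \<xi>) (at \<tau>)"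
    unfolding Ssym_def[of _ "ft2 u"] by (simp add: ft2_def r_def)
qed

section \<open>The semigroup on the completion\<close>

lemma bounded_linear_eq_dense:
  assumes "bounded_linear A" "bounded_linear B" "closure E = UNIV" "\<And>x. x \<in> E \<Longrightarrow> A x = B x"
  shows "A = B"
proof
  fix x
  have "x \<in> closure E" using assms(3) by simp
  then obtain f where f: "\<forall>n. f n \<in> E" "f \<longlonglongrightarrow> x" unfolding closure_sequential by blast
  have "(\<lambda>n. A (f n)) \<longlonglongrightarrow> A x" "(\<lambda>n. B (f n)) \<longlonglongrightarrow> B x"
    using f(2) assms(1,2) by (auto intro: bounded_linear.tendsto)
  moreover have "(\<lambda>n. A (f n)) = (\<lambda>n. B (f n))" using f(1) assms(4) by auto
  ultimately show "A x = B x" using LIMSEQ_unique by metis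
qed

lemma partial_cmult: "smooth f \<Longrightarrow> partial i (\<lambda>x. c * f x) = (\<lambda>x. c * partial i f x)"
  using partial_mult[OF smooth_differentiable[OF smooth_const] smooth_differentiable, of f i c] by (simp add: fun_eq_iff)

lemma partial_add_smooth: "smooth f \<Longrightarrow> smooth g \<Longrightarrow> partial i (\<lambda>x. f x + g x) = (\<lambda>x. partial i f x + partial i g x)"
  by (simp add: fun_eq_iff partial_add smooth_differentiable)

lemma L0_tilde_add:
  assumes "u \<in> L0_domain" "v \<in> L0_domain"
  shows "L0_tilde (\<lambda>x. fst u x + fst v x, \<lambda>x. snd u x + snd v x)
     = (\<lambda>x. fst (L0_tilde u) x + fst (L0_tilde v) x, \<lambda>x. snd (L0_tilde u) x + snd (L0_tilde v) x)"
proof -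
  have "smooth (fst u)" "smooth (snd u)" "smooth (fst v)" "smooth (snd v)"
    using assms by (auto simp: L0_domain_def radial_test_functions_iff)
  then show ?thesis
    by (cases u; cases v) (simp add: L0_tilde_def Lam_def Laplacian_def partial_add_smooth smooth_partial
        sum.distrib ring_distribs fun_eq_iff)
qed

lemma L0_tilde_cmult:
  assumes "u \<in> L0_domain"
  shows "L0_tilde (\<lambda>x. c * fst u x, \<lambda>x. c * snd u x) = (\<lambda>x. c * fst (L0_tilde u) x, \<lambda>x. c * snd (L0_tilde u) x)"
proof -
  have "smooth (fst u)" "smooth (snd u)"
    using assms by (auto simp: L0_domain_def radial_test_functions_iff)
  then show ?thesis
    by (cases u) (simp add: L0_tilde_def Lam_def Laplacian_def partial_cmult smooth_partial
        sum_distrib_left algebra_simps fun_eq_iff)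
qed

context H_space
begin

definition growth :: real where
  "growth = real CARD('n) / 2 - 2 - s1"

lemma Ssym_approx:
  fixes u :: "'n fpair"
  assumes u: "u \<in> L0_domain" and \<tau>: "0 \<le> \<tau>"
  obtains w where "\<And>k. w k \<in> L0_domain" "(\<lambda>k::nat. Nsq (ft2 (w k) - Ssym \<tau> (ft2 u))) \<longlonglongrightarrow> 0"
    "(\<lambda>k. Nsq (ft2 (L0_tilde (w k)) - Ssym \<tau> (ft2 (L0_tilde u)))) \<longlonglongrightarrow> 0"
proof (cases "\<tau> = 0")
  \<comment> \<open>At time 0 the wave time vanishes as well, outside the range of
    \<open>wave_approximation\<close>; a constant sequence serves.\<close>
  case True
  have z: "Nsq (\<Phi> - \<Phi>) = 0" for \<Phi> :: "'n fpair" by (simp add: Nsq_def dens_def)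
  show ?thesis by (rule that[of "\<lambda>_. u"]) (simp_all only: u True Ssym_0 z tendsto_const)
next
  case False
  then have "0 < \<tau>" using \<tau> by simp
  from wave_approximation[OF u this] obtain w where w: "\<And>k. w k \<in> L0_domain"
    "rapid (\<lambda>k::nat. fst (ft2 (w k)))" "rapid (\<lambda>k. snd (ft2 (w k)))"
    "rapid (\<lambda>k. fst (ft2 (L0_tilde (w k))))" "rapid (\<lambda>k. snd (ft2 (L0_tilde (w k))))"
    "\<And>\<xi>. \<xi> \<noteq> 0 \<Longrightarrow> (\<lambda>k. fst (ft2 (w k)) \<xi>) \<longlonglongrightarrow> fst (Ssym \<tau> (ft2 u)) \<xi>"
    "\<And>\<xi>. \<xi> \<noteq> 0 \<Longrightarrow> (\<lambda>k. snd (ft2 (w k)) \<xi>) \<longlonglongrightarrow> snd (Ssym \<tau> (ft2 u)) \<xi>"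
    "\<And>\<xi>. \<xi> \<noteq> 0 \<Longrightarrow> (\<lambda>k. fst (ft2 (L0_tilde (w k))) \<xi>) \<longlonglongrightarrow> fst (Ssym \<tau> (ft2 (L0_tilde u))) \<xi>"
    "\<And>\<xi>. \<xi> \<noteq> 0 \<Longrightarrow> (\<lambda>k. snd (ft2 (L0_tilde (w k))) \<xi>) \<longlonglongrightarrow> snd (Ssym \<tau> (ft2 (L0_tilde u))) \<xi>"
    by blast
  have conv: "(\<lambda>k::nat. Nsq (ft2 (a k) - Ssym \<tau> (ft2 b))) \<longlonglongrightarrow> 0"
    if a: "\<And>k. a k \<in> L0_domain" and b: "b \<in> L0_domain"
      and r: "rapid (\<lambda>k. fst (ft2 (a k)))" "rapid (\<lambda>k. snd (ft2 (a k)))"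
      and l: "\<And>\<xi>. \<xi> \<noteq> 0 \<Longrightarrow> (\<lambda>k. fst (ft2 (a k)) \<xi>) \<longlonglongrightarrow> fst (Ssym \<tau> (ft2 b)) \<xi>"
        "\<And>\<xi>. \<xi> \<noteq> 0 \<Longrightarrow> (\<lambda>k. snd (ft2 (a k)) \<xi>) \<longlonglongrightarrow> snd (Ssym \<tau> (ft2 b)) \<xi>"
    for a and b :: "'n fpair"
  proof -
    have X: "inX (ft2 (a k))" "inX (Ssym \<tau> (ft2 b))" for k using inX_ft2 a b inX_Ssym(1)[OF _ \<tau>] by blast+
    have rs: "rapid (\<lambda>k::nat. fst (Ssym \<tau> (ft2 b)))" "rapid (\<lambda>k::nat. snd (Ssym \<tau> (ft2 b)))"
      using rapid_Ssym[OF b, of "\<lambda>_. \<tau>" \<tau>] \<tau> by auto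
    have "(\<lambda>k. Nsq (\<lambda>\<xi>. fst (ft2 (a k)) \<xi> - fst (Ssym \<tau> (ft2 b)) \<xi>, \<lambda>\<xi>. snd (ft2 (a k)) \<xi> - snd (Ssym \<tau> (ft2 b)) \<xi>)) \<longlonglongrightarrow> 0"
    proof (rule Nsq_tendsto_0)
      show "(\<lambda>k. fst (ft2 (a k)) \<xi> - fst (Ssym \<tau> (ft2 b)) \<xi>) \<longlonglongrightarrow> 0" if "\<xi> \<noteq> 0" for \<xi>
        using l(1)[OF that] by (rule Lim_null[THEN iffD1])
      show "(\<lambda>k. snd (ft2 (a k)) \<xi> - snd (Ssym \<tau> (ft2 b)) \<xi>) \<longlonglongrightarrow> 0" if "\<xi> \<noteq> 0" for \<xi>
        using l(2)[OF that] by (rule Lim_null[THEN iffD1])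
    qed (use X r rs in \<open>auto intro!: rapid_diff borel_measurable_diff simp: inX_def\<close>)
    moreover have "(\<lambda>\<xi>. fst (ft2 (a k)) \<xi> - fst (Ssym \<tau> (ft2 b)) \<xi>, \<lambda>\<xi>. snd (ft2 (a k)) \<xi> - snd (Ssym \<tau> (ft2 b)) \<xi>) = ft2 (a k) - Ssym \<tau> (ft2 b)" for k
      by (simp add: prod_eq_iff fun_diff_def)
    ultimately show ?thesis by simp
  qed
  show ?thesis
    by (rule that[OF w(1) conv[OF w(1) u w(2,3,6,7)] conv[OF L0_tilde_domain[OF w(1)] L0_tilde_domain[OF u] w(4,5,8,9)]])
qed

lemma Rep_Ssym_bound:
  assumes "Rep \<Phi> x" "Rep (Ssym \<tau> \<Phi>) h" "0 \<le> \<tau>"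
  shows "norm h \<le> exp (growth * \<tau>) * norm x"
proof -
  have "inX \<Phi>" using assms(1) by (simp add: Rep_def)
  from inX_Ssym(2)[OF this assms(3)] have "(norm h)\<^sup>2 \<le> (exp (growth * \<tau>))\<^sup>2 * (norm x)\<^sup>2"
    unfolding Rep_norm[OF assms(1)] Rep_norm[OF assms(2)] growth_def .
  then have "(norm h)\<^sup>2 \<le> (exp (growth * \<tau>) * norm x)\<^sup>2" by (simp add: power_mult_distrib)
  then show ?thesis by (rule power2_le_imp_le) simp
qed

text \<open>An element may be represented by several functions. Their difference represents 0, and
  the norm bound forces the evolved elements to agree.\<close>

lemma Rep_Ssym_unique:
  assumes "Rep \<Phi> x" "Rep \<Psi> x" "Rep (Ssym \<tau> \<Phi>) h" "Rep (Ssym \<tau> \<Psi>) k" "0 \<le> \<tau>"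
  shows "h = k"
proof -
  have "norm (h - k) \<le> exp (growth * \<tau>) * norm (x - x)"
    using Rep_Ssym_bound[OF Rep_diff[OF assms(1,2)], of \<tau> "h - k"] Rep_diff[OF assms(3,4)] assms(5) by (simp add: Ssym_diff)
  then show ?thesis by simp
qed

lemma Rep_Ssym_exists:
  assumes "u \<in> L0_domain" "0 \<le> \<tau>"
  shows "\<exists>h. Rep (Ssym \<tau> (ft2 u)) h"
proof -
  obtain w where "\<And>k. w k \<in> L0_domain" "(\<lambda>k::nat. Nsq (ft2 (w k) - Ssym \<tau> (ft2 u))) \<longlonglongrightarrow> 0"
    using Ssym_approx[OF assms] by metis
  then show ?thesis using Rep_limit inX_Ssym(1)[OF inX_ft2[OF assms(1)] assms(2)] by metis
qed

lemma exists_semigroup_operator: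
  assumes \<tau>: "0 \<le> \<tau>"
  shows "\<exists>S. bounded_clinear S \<and> (\<forall>u\<in>L0_domain. Rep (Ssym \<tau> (ft2 u)) (S (\<iota> u))) \<and> (\<forall>x. norm (S x) \<le> exp (growth * \<tau>) * norm x)"
proof -
  define E where "E = \<iota> ` L0_domain"
  \<comment> \<open>The choice ranges over all representing functions, not only transforms of test
    pairs, so linearity can be checked on any convenient one.\<close>
  define T where "T x = (SOME h. \<exists>\<Phi>. Rep \<Phi> x \<and> Rep (Ssym \<tau> \<Phi>) h)" for x
  have ex: "\<exists>\<Phi>. Rep \<Phi> x \<and> Rep (Ssym \<tau> \<Phi>) (T x)" if "x \<in> E" for x
  proof -
    obtain u where u: "u \<in> L0_domain" "x = \<iota> u" using \<open>x \<in> E\<close> unfolding E_def by blast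
    then have "\<exists>h \<Phi>. Rep \<Phi> x \<and> Rep (Ssym \<tau> \<Phi>) h" using Rep_ft2 Rep_Ssym_exists \<tau> by blast
    then show ?thesis unfolding T_def by (rule someI_ex)
  qed
  have T_eq: "T x = h" if "x \<in> E" "Rep \<Phi> x" "Rep (Ssym \<tau> \<Phi>) h" for x \<Phi> h
    using ex[OF that(1)] Rep_Ssym_unique that \<tau> by blast
  have scale_E: "c *\<^sub>C x \<in> E" "T (c *\<^sub>C x) = c *\<^sub>C T x" if "x \<in> E" for c x
  proof -
    obtain u where u: "u \<in> L0_domain" "x = \<iota> u" using \<open>x \<in> E\<close> unfolding E_def by blast
    show cE: "c *\<^sub>C x \<in> E" unfolding E_def u(2) \<iota>_scale(1)[OF u(1), symmetric] by (intro imageI \<iota>_scale(2) u)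
    obtain \<Phi> where \<Phi>: "Rep \<Phi> x" "Rep (Ssym \<tau> \<Phi>) (T x)" using ex[OF \<open>x \<in> E\<close>] by blast
    show "T (c *\<^sub>C x) = c *\<^sub>C T x"
      using T_eq[OF cE Rep_scale[OF \<Phi>(1)]] Rep_scale[OF \<Phi>(2), of c] by (simp add: Ssym_scale)
  qed
  have add_E: "x + y \<in> E" "T (x + y) = T x + T y" if "x \<in> E" "y \<in> E" for x y
  proof -
    obtain u v where uv: "u \<in> L0_domain" "x = \<iota> u" "v \<in> L0_domain" "y = \<iota> v" using \<open>x \<in> E\<close> \<open>y \<in> E\<close> unfolding E_def by blast
    show sE: "x + y \<in> E" unfolding E_def uv(2,4) \<iota>_add(1)[OF uv(1,3), symmetric] by (intro imageI \<iota>_add(2) uv)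
    \<comment> \<open>\<open>Rep\<close> is available for differences, so the sum is treated as
      \<open>x - (- y)\<close>.\<close>
    have my: "- y \<in> E" "T (- y) = - T y" using scale_E[OF \<open>y \<in> E\<close>, of "-1"] by (simp_all add: scaleC_minus1)
    obtain \<Phi> where \<Phi>: "Rep \<Phi> x" "Rep (Ssym \<tau> \<Phi>) (T x)" using ex[OF \<open>x \<in> E\<close>] by blast
    obtain \<Psi> where \<Psi>: "Rep \<Psi> (- y)" "Rep (Ssym \<tau> \<Psi>) (- T y)" using ex[OF my(1)] unfolding my(2) by blast
    have "Rep (\<Phi> - \<Psi>) (x + y)" using Rep_diff[OF \<Phi>(1) \<Psi>(1)] by simp
    moreover have "Rep (Ssym \<tau> (\<Phi> - \<Psi>)) (T x + T y)" using Rep_diff[OF \<Phi>(2) \<Psi>(2)] unfolding Ssym_diff by simp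
    ultimately show "T (x + y) = T x + T y" by (rule T_eq[OF sE])
  qed
  have bound: "norm (T x) \<le> exp (growth * \<tau>) * norm x" if "x \<in> E" for x
    using ex[OF that] Rep_Ssym_bound \<tau> by blast
  have dense: "closure E = UNIV" by (simp add: E_def dense_\<iota>)
  obtain S where S: "bounded_clinear S" "\<And>x. x \<in> E \<Longrightarrow> S x = T x" "\<And>x. norm (S x) \<le> exp (growth * \<tau>) * norm x"
    using extend_bounded_clinear[OF dense add_E(1) scale_E(1) add_E(2) scale_E(2) bound] by blast
  have "Rep (Ssym \<tau> (ft2 u)) (S (\<iota> u))" if u: "u \<in> L0_domain" for u
  proof -
    have "\<iota> u \<in> E" using u by (simp add: E_def)
    moreover obtain h where h: "Rep (Ssym \<tau> (ft2 u)) h" using Rep_Ssym_exists[OF u \<tau>] by blast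
    ultimately show ?thesis using T_eq[OF _ Rep_ft2[OF u] h] S(2) by simp
  qed
  then show ?thesis using S by blast
qed

definition S :: "real \<Rightarrow> 'h \<Rightarrow> 'h" where
  "S \<tau> = (SOME S. bounded_clinear S \<and> (\<forall>u\<in>L0_domain. Rep (Ssym \<tau> (ft2 u)) (S (\<iota> u))) \<and> (\<forall>x. norm (S x) \<le> exp (growth * \<tau>) * norm x))"

lemma S_props:
  assumes "0 \<le> \<tau>"
  shows "bounded_clinear (S \<tau>)" "u \<in> L0_domain \<Longrightarrow> Rep (Ssym \<tau> (ft2 u)) (S \<tau> (\<iota> u))" "norm (S \<tau> x) \<le> exp (growth * \<tau>) * norm x"
  using someI_ex[OF exists_semigroup_operator[OF assms]] unfolding S_def by blast+

lemma bounded_linear_S: "0 \<le> \<tau> \<Longrightarrow> bounded_linear (S \<tau>)"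
  using S_props(1) by (simp add: bounded_clinear_def)

text \<open>Approximation by test pairs and \<open>Rep_closed\<close>. The semigroup law relies on
  it, since the evolved transform of a test pair need not be the transform of a test pair.\<close>

lemma Rep_S:
  assumes R: "Rep \<Phi> x" and \<tau>: "0 \<le> \<tau>"
  shows "Rep (Ssym \<tau> \<Phi>) (S \<tau> x)"
proof -
  obtain u where u: "\<And>k. u k \<in> L0_domain" "(\<lambda>k. \<iota> (u k)) \<longlonglongrightarrow> x" "(\<lambda>k. Nsq (ft2 (u k) - \<Phi>)) \<longlonglongrightarrow> 0"
    using Rep_approx[OF R] by metis
  have X: "inX \<Phi>" using R by (simp add: Rep_def)
  show ?thesis
  proof (rule Rep_closed[OF S_props(2)[OF \<tau> u(1)]])
    show "(\<lambda>k. S \<tau> (\<iota> (u k))) \<longlonglongrightarrow> S \<tau> x" using bounded_linear_S[OF \<tau>] u(2) by (rule bounded_linear.tendsto)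
    show "inX (Ssym \<tau> \<Phi>)" using inX_Ssym(1)[OF X \<tau>] .
    have lim: "(\<lambda>k. (exp (growth * \<tau>))\<^sup>2 * Nsq (ft2 (u k) - \<Phi>)) \<longlonglongrightarrow> 0" by (intro tendsto_mult_right_zero u)
    show "(\<lambda>k. Nsq (Ssym \<tau> (ft2 (u k)) - Ssym \<tau> \<Phi>)) \<longlonglongrightarrow> 0"
    proof (rule Lim_null_comparison[OF _ lim], rule always_eventually, rule allI)
      fix k
      show "norm (Nsq (Ssym \<tau> (ft2 (u k)) - Ssym \<tau> \<Phi>)) \<le> (exp (growth * \<tau>))\<^sup>2 * Nsq (ft2 (u k) - \<Phi>)"
        using inX_Ssym(2)[OF inX_diff[OF inX_ft2[OF u(1)] X] \<tau>, of k] by (simp add: Ssym_diff Nsq_nonneg growth_def)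
    qed
  qed
qed

lemma S_zero: "S 0 = id"
proof (rule bounded_linear_eq_dense[OF _ _ dense_\<iota>])
  show "S 0 x = id x" if "x \<in> \<iota> ` L0_domain" for x
  proof -
    obtain u where u: "u \<in> L0_domain" "x = \<iota> u" using \<open>x \<in> \<iota> ` L0_domain\<close> by blast
    have "Rep (ft2 u) (S 0 x)" using S_props(2)[OF order_refl u(1)] unfolding Ssym_0 u(2) .
    then have "S 0 x = \<iota> u" using Rep_ft2[OF u(1)] by (rule Rep_unique)
    then show ?thesis by (simp only: u(2) id_apply)
  qed
qed (simp_all add: bounded_linear_S id_def bounded_linear_ident)

lemma S_add:
  assumes "0 \<le> \<sigma>" "0 \<le> \<tau>"
  shows "S (\<sigma> + \<tau>) = S \<sigma> \<circ> S \<tau>"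
proof (rule bounded_linear_eq_dense[OF _ _ dense_\<iota>])
  show "S (\<sigma> + \<tau>) x = (S \<sigma> \<circ> S \<tau>) x" if x: "x \<in> \<iota> ` L0_domain" for x
  proof -
    obtain u where u: "u \<in> L0_domain" "x = \<iota> u" using x by blast
    have "Rep (Ssym (\<sigma> + \<tau>) (ft2 u)) (S (\<sigma> + \<tau>) x)" using S_props(2)[OF _ u(1)] assms u(2) by simp
    moreover have "Rep (Ssym \<sigma> (Ssym \<tau> (ft2 u))) (S \<sigma> (S \<tau> x))"
      using Rep_S[OF S_props(2)[OF assms(2) u(1)] assms(1)] u(2) by simp
    ultimately show ?thesis using Rep_unique by (simp add: Ssym_add)
  qed
  show "bounded_linear (S \<sigma> \<circ> S \<tau>)"
    using bounded_linear_compose[OF bounded_linear_S[OF assms(1)] bounded_linear_S[OF assms(2)]] by (simp add: o_def)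
qed (use assms bounded_linear_S in simp)

text \<open>The error of the difference quotient is represented by \<open>Q i\<close>, which tends
  to 0 pointwise off the origin and decays uniformly by the mean value inequality in time.\<close>

lemma difference_quotient_tendsto:
  assumes u: "u \<in> L0_domain" and \<tau>: "\<And>i::nat. 0 < \<tau> i" "\<tau> \<longlonglongrightarrow> 0"
  shows "(\<lambda>i. (S (\<tau> i) (\<iota> u) - \<iota> u) /\<^sub>R \<tau> i) \<longlonglongrightarrow> \<iota> (L0_tilde u)"
proof -
  define w where "w = L0_tilde u"
  have w: "w \<in> L0_domain" unfolding w_def using u by (rule L0_tilde_domain)
  \<comment> \<open>A convergent sequence of times is bounded; \<open>T\<close> confines the mean
    value argument to a compact interval.\<close>
  obtain T where T: "\<And>i. \<tau> i \<le> T"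
    using Bseq_bdd_above[OF convergent_imp_Bseq[OF convergentI[OF \<tau>(2)]]] by (auto simp: bdd_above_def)
  have T0: "0 \<le> T" using T[of 0] \<tau>(1)[of 0] by linarith
  define c where "c i = complex_of_real (inverse (\<tau> i))" for i
  define Q where "Q i = (\<lambda>\<xi>. c i * fst (Ssym (\<tau> i) (ft2 u) - ft2 u) \<xi>, \<lambda>\<xi>. c i * snd (Ssym (\<tau> i) (ft2 u) - ft2 u) \<xi>) - ft2 w" for i
  have R: "Rep (Q i) (c i *\<^sub>C (S (\<tau> i) (\<iota> u) - \<iota> u) - \<iota> w)" for i
    unfolding Q_def using \<tau>(1)[of i] u w by (intro Rep_diff Rep_scale Rep_ft2 S_props(2)) auto
  define Z where "Z f \<xi> = (if \<xi> = 0 then 0 else f \<xi>)" for f :: "real^'n \<Rightarrow> complex" and \<xi>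
  text \<open>The value at the origin is irrelevant, but the pointwise derivative is only available away from it.\<close>
  have densZ: "dens (Z (fst \<Phi>), Z (snd \<Phi>)) = dens \<Phi>" for \<Phi> :: "'n fpair"
    by (auto simp: dens_def Z_def wt_def fun_eq_iff)
  have NsqZ: "Nsq (Z (fst \<Phi>), Z (snd \<Phi>)) = Nsq \<Phi>" for \<Phi> :: "'n fpair" by (simp add: Nsq_def densZ)
  have Zm: "Z f \<in> borel_measurable borel" if "f \<in> borel_measurable borel" for f
    using that unfolding Z_def[abs_def] by measurable
  \<comment> \<open>Treats both components at once. Clamping the time to \<open>[0, T]\<close>
    yields a family indexed by all reals to which \<open>rapid_Ssym\<close> applies.\<close>
  have key: "rapid (\<lambda>i::nat. Z (\<lambda>\<xi>. c i * (p (\<tau> i) \<xi> - p 0 \<xi>) - p' 0 \<xi>)) \<and>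
      (\<forall>\<xi>. \<xi> \<noteq> 0 \<longrightarrow> (\<lambda>i. c i * (p (\<tau> i) \<xi> - p 0 \<xi>) - p' 0 \<xi>) \<longlonglongrightarrow> 0)"
    if d: "\<And>\<tau> \<xi>. \<xi> \<noteq> 0 \<Longrightarrow> ((\<lambda>\<tau>. p \<tau> \<xi>) has_vector_derivative p' \<tau> \<xi>) (at \<tau>)"
      and r: "rapid (\<lambda>\<sigma>::real. p' (max 0 (min T \<sigma>)))"
    for p p' :: "real \<Rightarrow> real^'n \<Rightarrow> complex"
  proof
    show "rapid (\<lambda>i::nat. Z (\<lambda>\<xi>. c i * (p (\<tau> i) \<xi> - p 0 \<xi>) - p' 0 \<xi>))"
      unfolding rapid_def
    proof
      fix m
      obtain C where "\<And>\<sigma> \<xi>. (1 + norm \<xi>) ^ m * norm (p' (max 0 (min T \<sigma>)) \<xi>) \<le> C"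
        using r unfolding rapid_def by meson
      then have C: "(1 + norm \<xi>) ^ m * norm (p' \<sigma> \<xi>) \<le> C" if "0 \<le> \<sigma>" "\<sigma> \<le> T" for \<sigma> \<xi>
        using that by (metis max.absorb2 min.absorb2)
      have "norm (p' 0 0) \<le> C" using C[of 0 0] T0 by simp
      then have C0: "0 \<le> C" using norm_ge_zero order_trans by blast
      have "(1 + norm \<xi>) ^ m * norm (Z (\<lambda>\<xi>. c i * (p (\<tau> i) \<xi> - p 0 \<xi>) - p' 0 \<xi>) \<xi>) \<le> 2 * C" for i \<xi>
      proof (cases "\<xi> = 0")
        case True then show ?thesis using C0 by (simp add: Z_def)
      next
        case False
        define B where "B = C / (1 + norm \<xi>) ^ m"
        have pos: "0 < (1 + norm \<xi>) ^ m" by (intro zero_less_power add_pos_nonneg) auto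
        have B: "norm (p' \<sigma> \<xi>) \<le> B" if "0 \<le> \<sigma>" "\<sigma> \<le> T" for \<sigma>
          using C[OF that, of \<xi>] pos by (simp add: B_def pos_le_divide_eq mult.commute)
        have "norm (p (\<tau> i) \<xi> - p 0 \<xi>) \<le> B * norm (\<tau> i - 0)"
        proof (rule differentiable_bound[where S = "{0..T}" and f' = "\<lambda>\<sigma> h. h *\<^sub>R p' \<sigma> \<xi>"])
          show "((\<lambda>\<sigma>. p \<sigma> \<xi>) has_derivative (\<lambda>h. h *\<^sub>R p' \<sigma> \<xi>)) (at \<sigma> within {0..T})" for \<sigma>
            using d[OF False, of \<sigma>] unfolding has_vector_derivative_def by (rule has_derivative_at_withinI)
          show "onorm (\<lambda>h. h *\<^sub>R p' \<sigma> \<xi>) \<le> B" if "\<sigma> \<in> {0..T}" for \<sigma>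
          proof (rule onorm_le)
            fix h
            show "norm (h *\<^sub>R p' \<sigma> \<xi>) \<le> B * norm h"
              using mult_right_mono[OF B[of \<sigma>], of "\<bar>h\<bar>"] that by (simp add: mult.commute)
          qed
        qed (use T0 T[of i] \<tau>(1)[of i] in auto)
        then have "norm (c i * (p (\<tau> i) \<xi> - p 0 \<xi>)) \<le> B"
          using \<tau>(1)[of i] by (simp add: c_def norm_mult norm_inverse) (simp add: field_simps)
        then have "norm (c i * (p (\<tau> i) \<xi> - p 0 \<xi>) - p' 0 \<xi>) \<le> 2 * B"
          using B[of 0] T0 norm_triangle_ineq4[of "c i * (p (\<tau> i) \<xi> - p 0 \<xi>)" "p' 0 \<xi>"] by simp
        then have "(1 + norm \<xi>) ^ m * norm (c i * (p (\<tau> i) \<xi> - p 0 \<xi>) - p' 0 \<xi>) \<le> (1 + norm \<xi>) ^ m * (2 * B)"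
          using pos by (intro mult_left_mono) auto
        also have "\<dots> = 2 * C"
        proof -
          have "a * (2 * (C / a)) = 2 * C" if "0 < a" for a :: real using that by simp
          then show ?thesis unfolding B_def using pos by blast
        qed
        finally show ?thesis using False by (simp add: Z_def)
      qed
      then show "\<exists>C. \<forall>i \<xi>. (1 + norm \<xi>) ^ m * norm (Z (\<lambda>\<xi>. c i * (p (\<tau> i) \<xi> - p 0 \<xi>) - p' 0 \<xi>) \<xi>) \<le> C" by blast
    qed
    show "\<forall>\<xi>. \<xi> \<noteq> 0 \<longrightarrow> (\<lambda>i. c i * (p (\<tau> i) \<xi> - p 0 \<xi>) - p' 0 \<xi>) \<longlonglongrightarrow> 0"
    proof (intro allI impI)
      fix \<xi> :: "real^'n" assume "\<xi> \<noteq> 0"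
      from d[OF this, of 0] have der: "((\<lambda>y. (1 / norm (y - 0)) *\<^sub>R (p y \<xi> - (p 0 \<xi> + (y - 0) *\<^sub>R p' 0 \<xi>))) \<longlongrightarrow> 0) (at 0)"
        unfolding has_vector_derivative_def has_derivative_within by blast
      have ne: "\<tau> i \<noteq> 0" for i using \<tau>(1)[of i] by simp
      from der have lim: "(\<lambda>i. (1 / norm (\<tau> i - 0)) *\<^sub>R (p (\<tau> i) \<xi> - (p 0 \<xi> + (\<tau> i - 0) *\<^sub>R p' 0 \<xi>))) \<longlonglongrightarrow> 0"
        by (rule filterlim_compose) (use \<tau>(2) ne in \<open>simp add: filterlim_at\<close>)
      have "(1 / norm (\<tau> i - 0)) *\<^sub>R (p (\<tau> i) \<xi> - (p 0 \<xi> + (\<tau> i - 0) *\<^sub>R p' 0 \<xi>)) = c i * (p (\<tau> i) \<xi> - p 0 \<xi>) - p' 0 \<xi>" for i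
        using \<tau>(1)[of i] by (simp add: c_def scaleR_conv_of_real[where 'a = complex] field_simps)
      with lim show "(\<lambda>i. c i * (p (\<tau> i) \<xi> - p 0 \<xi>) - p' 0 \<xi>) \<longlonglongrightarrow> 0" by simp
    qed
  qed
  have rw: "rapid (\<lambda>\<sigma>::real. fst (Ssym (max 0 (min T \<sigma>)) (ft2 w)))" "rapid (\<lambda>\<sigma>::real. snd (Ssym (max 0 (min T \<sigma>)) (ft2 w)))"
    using rapid_Ssym[OF w, of "\<lambda>\<sigma>. max 0 (min T \<sigma>)" T] T0 by auto
  note k1 = key[of "\<lambda>\<tau>. fst (Ssym \<tau> (ft2 u))" "\<lambda>\<tau>. fst (Ssym \<tau> (ft2 w))", OF Ssym_derivative(1)[OF u, folded w_def] rw(1)]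
  note k2 = key[of "\<lambda>\<tau>. snd (Ssym \<tau> (ft2 u))" "\<lambda>\<tau>. snd (Ssym \<tau> (ft2 w))", OF Ssym_derivative(2)[OF u, folded w_def] rw(2)]
  have Q1: "fst (Q i) = (\<lambda>\<xi>. c i * (fst (Ssym (\<tau> i) (ft2 u)) \<xi> - fst (Ssym 0 (ft2 u)) \<xi>) - fst (Ssym 0 (ft2 w)) \<xi>)"
    and Q2: "snd (Q i) = (\<lambda>\<xi>. c i * (snd (Ssym (\<tau> i) (ft2 u)) \<xi> - snd (Ssym 0 (ft2 u)) \<xi>) - snd (Ssym 0 (ft2 w)) \<xi>)" for i
    by (simp_all add: Q_def Ssym_0 fun_diff_def)
  have Qm: "fst (Q i) \<in> borel_measurable borel" "snd (Q i) \<in> borel_measurable borel" for i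
    using R[of i] by (auto simp: Rep_def inX_def)
  have "(\<lambda>i. Nsq (Z (fst (Q i)), Z (snd (Q i)))) \<longlonglongrightarrow> 0"
  proof (rule Nsq_tendsto_0)
    show "rapid (\<lambda>i. Z (fst (Q i)))" "rapid (\<lambda>i. Z (snd (Q i)))" unfolding Q1 Q2 using k1 k2 by blast+
    show "(\<lambda>i. Z (fst (Q i)) \<xi>) \<longlonglongrightarrow> 0" "(\<lambda>i. Z (snd (Q i)) \<xi>) \<longlonglongrightarrow> 0" if "\<xi> \<noteq> 0" for \<xi>
      using k1 k2 that unfolding Q1 Q2 Z_def by auto
  qed (intro Zm Qm)+
  then have "(\<lambda>i. (norm (c i *\<^sub>C (S (\<tau> i) (\<iota> u) - \<iota> u) - \<iota> w))\<^sup>2) \<longlonglongrightarrow> 0"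
    unfolding NsqZ Rep_norm[OF R] .
  from tendsto_real_sqrt[OF this] have "(\<lambda>i. norm (c i *\<^sub>C (S (\<tau> i) (\<iota> u) - \<iota> u) - \<iota> w)) \<longlonglongrightarrow> 0" by simp
  then have "(\<lambda>i. c i *\<^sub>C (S (\<tau> i) (\<iota> u) - \<iota> u) - \<iota> w) \<longlonglongrightarrow> 0" by (rule tendsto_norm_zero_cancel)
  then have "(\<lambda>i. c i *\<^sub>C (S (\<tau> i) (\<iota> u) - \<iota> u)) \<longlonglongrightarrow> \<iota> w" by (rule Lim_null[THEN iffD2])
  then show ?thesis unfolding c_def scaleC_of_real w_def .
qed

lemma generator_test: "u \<in> L0_domain \<Longrightarrow> (\<iota> u, \<iota> (L0_tilde u)) \<in> generator S"
  unfolding generator_def tendsto_at_iff_sequentially comp_def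
  using difference_quotient_tendsto by auto

text \<open>Continuity at 0 on the dense set of test pairs follows from differentiability
  there.\<close>

lemma C0_semigroup_S: "C0_semigroup S"
proof (rule C0_semigroupI[OF S_props(1) S_zero S_add S_props(3) dense_\<iota>])
  show "((\<lambda>\<tau>. S \<tau> x) \<longlongrightarrow> x) (at_right 0)" if x: "x \<in> \<iota> ` L0_domain" for x
  proof -
    obtain u where u: "u \<in> L0_domain" "x = \<iota> u" using x by blast
    have "((\<lambda>\<tau>. (S \<tau> x - x) /\<^sub>R \<tau>) \<longlongrightarrow> \<iota> (L0_tilde u)) (at_right 0)"
      using generator_test[OF u(1)] u(2) by (simp add: generator_def)
    then have "((\<lambda>\<tau>. \<tau> *\<^sub>R ((S \<tau> x - x) /\<^sub>R \<tau>) + x) \<longlongrightarrow> 0 *\<^sub>R \<iota> (L0_tilde u) + x) (at_right 0)"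
      by (intro tendsto_intros)
    then have "((\<lambda>\<tau>. S \<tau> x) \<longlongrightarrow> 0 *\<^sub>R \<iota> (L0_tilde u) + x) (at_right 0)"
      by (rule Lim_transform_eventually) (rule eventually_mono[OF eventually_at_right_less[of 0]], simp)
    then show ?thesis by simp
  qed
qed

lemma subspace_graph: "subspace (L0_tilde_graph \<iota>)"
proof (rule subspaceI)
  have scale: "c *\<^sub>R p \<in> L0_tilde_graph \<iota>" if "p \<in> L0_tilde_graph \<iota>" for c p
  proof -
    obtain u where u: "u \<in> L0_domain" "p = (\<iota> u, \<iota> (L0_tilde u))" using \<open>p \<in> L0_tilde_graph \<iota>\<close> by (auto simp: L0_tilde_graph_def)
    let ?v = "(\<lambda>x. of_real c * fst u x, \<lambda>x. of_real c * snd u x)"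
    have "c *\<^sub>R p = (\<iota> ?v, \<iota> (L0_tilde ?v))"
      unfolding L0_tilde_cmult[OF u(1)] \<iota>_scale(1)[OF u(1)] \<iota>_scale(1)[OF L0_tilde_domain[OF u(1)]] u(2) by (simp add: scaleC_of_real)
    then show ?thesis using \<iota>_scale(2)[OF u(1)] unfolding L0_tilde_graph_def by blast
  qed
  then show "\<And>c p. p \<in> L0_tilde_graph \<iota> \<Longrightarrow> c *\<^sub>R p \<in> L0_tilde_graph \<iota>" .
  have "(\<iota> (\<lambda>x. 0, \<lambda>x. 0), \<iota> (L0_tilde (\<lambda>x. 0, \<lambda>x. 0))) \<in> L0_tilde_graph \<iota>"
    using zero_L0_domain(2) unfolding L0_tilde_graph_def by blast
  from scale[OF this, of 0] show "0 \<in> L0_tilde_graph \<iota>" by (simp add: zero_prod_def)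
  fix p q assume "p \<in> L0_tilde_graph \<iota>" "q \<in> L0_tilde_graph \<iota>"
  then obtain u v where uv: "u \<in> L0_domain" "p = (\<iota> u, \<iota> (L0_tilde u))" "v \<in> L0_domain" "q = (\<iota> v, \<iota> (L0_tilde v))"
    by (auto simp: L0_tilde_graph_def)
  let ?w = "(\<lambda>x. fst u x + fst v x, \<lambda>x. snd u x + snd v x)"
  have "p + q = (\<iota> ?w, \<iota> (L0_tilde ?w))"
    unfolding L0_tilde_add[OF uv(1,3)] \<iota>_add(1)[OF uv(1,3)] \<iota>_add(1)[OF L0_tilde_domain[OF uv(1)] L0_tilde_domain[OF uv(3)]] uv(2,4) by simp
  then show "p + q \<in> L0_tilde_graph \<iota>" using \<iota>_add(2)[OF uv(1,3)] unfolding L0_tilde_graph_def by blast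
qed

text \<open>The approximants of \<open>Ssym_approx\<close> converge in the completion together with
  their images under \<open>L0_tilde\<close>, and \<open>Rep_unique\<close> identifies the limits as
  \<open>S \<tau> x\<close> and \<open>S \<tau> y\<close>.\<close>

lemma graph_invariant:
  assumes "(x, y) \<in> L0_tilde_graph \<iota>" "0 \<le> \<tau>"
  shows "(S \<tau> x, S \<tau> y) \<in> closure (L0_tilde_graph \<iota>)"
proof -
  obtain u where u: "u \<in> L0_domain" "x = \<iota> u" "y = \<iota> (L0_tilde u)" using assms(1) by (auto simp: L0_tilde_graph_def)
  obtain w where w: "\<And>k. w k \<in> L0_domain" "(\<lambda>k::nat. Nsq (ft2 (w k) - Ssym \<tau> (ft2 u))) \<longlonglongrightarrow> 0"
    "(\<lambda>k. Nsq (ft2 (L0_tilde (w k)) - Ssym \<tau> (ft2 (L0_tilde u)))) \<longlonglongrightarrow> 0"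
    using Ssym_approx[OF u(1) assms(2)] by metis
  have l: "(\<lambda>k. \<iota> (v k)) \<longlonglongrightarrow> S \<tau> (\<iota> z)"
    if v: "\<And>k. v k \<in> L0_domain" and z: "z \<in> L0_domain" and lim: "(\<lambda>k::nat. Nsq (ft2 (v k) - Ssym \<tau> (ft2 z))) \<longlonglongrightarrow> 0" for v z
  proof -
    obtain h where h: "Rep (Ssym \<tau> (ft2 z)) h" "(\<lambda>k. \<iota> (v k)) \<longlonglongrightarrow> h"
      using Rep_limit[OF v inX_Ssym(1)[OF inX_ft2[OF z] assms(2)] lim] by blast
    then show ?thesis using Rep_unique[OF h(1) S_props(2)[OF assms(2) z]] by simp
  qed
  have "(\<lambda>k. (\<iota> (w k), \<iota> (L0_tilde (w k)))) \<longlonglongrightarrow> (S \<tau> x, S \<tau> y)"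
    unfolding u(2,3) by (intro tendsto_Pair l w L0_tilde_domain u)
  moreover have "(\<iota> (w k), \<iota> (L0_tilde (w k))) \<in> L0_tilde_graph \<iota>" for k using w(1) unfolding L0_tilde_graph_def by blast
  ultimately show ?thesis
    unfolding closure_sequential by (intro exI[of _ "\<lambda>k. (\<iota> (w k), \<iota> (L0_tilde (w k)))"]) simp
qed

sublocale sg: exp_bounded_semigroup S growth
  by standard (use C0_semigroup_S S_props(3) in auto)

lemma generator_S: "generator S = closure (L0_tilde_graph \<iota>)"
proof (rule sg.generator_eq_closure[OF subspace_graph])
  have "fst ` L0_tilde_graph \<iota> = \<iota> ` L0_domain" by (force simp: L0_tilde_graph_def)
  then show "closure (fst ` L0_tilde_graph \<iota>) = UNIV" by (simp add: dense_\<iota>)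
  show "L0_tilde_graph \<iota> \<subseteq> generator S" using generator_test by (auto simp: L0_tilde_graph_def)
qed (rule graph_invariant)

end

theorem proposition3p1:
  fixes s1 s2 :: real
    and \<iota> :: "'n::finite fpair \<Rightarrow> 'h::complex_hilbert"
  assumes "CARD('n) \<ge> 3"
    and "1 < s1" and "s1 < real CARD('n) / 2" and "s1 \<le> s2"
    and "H_completion s1 s2 \<iota>"
  shows "closable (L0_tilde_graph \<iota>) \<and>
    (\<exists>S. C0_semigroup S \<and> generator S = closure (L0_tilde_graph \<iota>) \<and>
      (\<forall>u. \<forall>\<tau>\<ge>0. norm (S \<tau> u) \<le> exp ((real CARD('n) / 2 - 2 - s1) * \<tau>) * norm u))"
proof -
  interpret H_space s1 s2 \<iota>
    using assms by unfold_locales auto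
  \<comment> \<open>The closed graph is a generator, and a generator is single-valued by uniqueness
    of limits.\<close>
  have "closable (L0_tilde_graph \<iota>)"
    unfolding closable_def single_valued_def generator_S[symmetric] using sg.generator_unique by blast
  moreover have "norm (S \<tau> u) \<le> exp ((real CARD('n) / 2 - 2 - s1) * \<tau>) * norm u" if "0 \<le> \<tau>" for u \<tau>
    using S_props(3)[OF that] by (simp add: growth_def)
  ultimately show ?thesis using C0_semigroup_S generator_S by blast
qed

end
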